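(* Let $d=2q\in\mathbb{N}$ with $q>2$. For $p\in\{2,3,\dots,q\}$ and $\epsilon\in\{+,-\}$, the sets $\mathbf{R_r}(\bar{\mathcal{F}}_d;\Phi_{d,p,\epsilon})$ and $\mathbf{R_s}(\bar{\mathcal{F}}_d;\Phi_{d,R})$ of tilings of the plane, with prototiles congruent to members of $\bar{\mathcal{F}}_d$, are non-empty. The inflation factor associated with $\mathbf{R_s}(\bar{\mathcal{F}}_d;\Phi_{d,R})$ is $\iota_{d,q}=\sin(q\pi/d)/\sin(\pi/d)$.
   Context: **Segments.** Identify $\mathbb{R}^2$ with $\mathbb{C}$. Let $z(\varphi)=2e^{i\varphi}+e^{-2i\varphi}$ (a parametrization of the deltoid), and let $G(\varphi)$ be the closed segment with endpoints $z(\varphi)$ and $z(\varphi+\pi)$; it depends only on $\varphi$ mod $\pi$. For integers $d,\nu$ and $\kappa\in\{-2,0,2\}$ put $G^{(\kappa)}_{\nu,d}=G\big(\tfrac{(3\nu-\kappa)\pi}{3d}\big)$; the index $\nu$ is taken mod $d$. Let $K_d=\{0\}$ if $3\nmid d$ and $K_d=\{-2,0,2\}$ if $3\mid d$. For $\kappa\in K_d$ the family of segments $\{G^{(\kappa)}_{\nu,d}\}_{\nu\bmod d}$ is called family $\kappa$. Put $s_\nu=\sin(\nu\pi/d)$, $\iota_{d,p}=s_p/s_1$, and let $S_\nu$ denote a segment of length $4s_1s_\nu$. **Elementary triangles.** $\Delta_d^{(\kappa)}(\lambda,\mu,\nu)$ denotes the triangle formed by $G^{(\kappa)}_{\lambda,d},G^{(\kappa)}_{\mu,d},G^{(\kappa)}_{\nu,d}$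 ($\lambda,\mu,\nu$ distinct mod $d$, segments not concurrent). It is elementary if $\lambda+\mu+\nu\equiv\kappa\pm1\pmod d$; equivalently, if it is formed by $G(\varphi_1),G(\varphi_2),G(\varphi_3)$ with $\varphi_1+\varphi_2+\varphi_3\equiv\pm\pi/d\pmod\pi$. The sign $\pm$ is called the sign of the triangle. **Decorated prototiles $\mathcal{F}_d$ and undecorated prototiles $\bar{\mathcal{F}}_d$.** An elementary triangle $t$ of sign $\pm$ formed by $G(\varphi_1),G(\varphi_2),G(\varphi_3)$ is decorated by the triangle $t'$ formed by $G(\varphi_i\mp\frac{\pi}{2d})$, $i=1,2,3$, which is inscribed in $t$ and cuts each edge of $t$ into two sections; $T=t\cup t'$ is a decorated prototile. $\mathcal{F}_d$ is the set of all decorated elementary triangles arising from the families $\kappa\in K_d$, and $\bar{\mathcal{F}}_d$ is the same set of triangles without decoration. For $T\in\mathcal{F}_d$, $\widetilde T$ is the mirror image of $T$ including its decoration; if $T$ is not isosceles, $\hat T$ is the prototile whose underlying triangle is the mirror image of that of $T$ but whose edges (read anticlockwise) carry the same subdivisions into sections as those of $T$. **Tilings.** A tiling of the plane is a decomposition into countably many tiles with pairwise disjoint interiors whose union is the plane; a patch is a collection of tiles any two of which intersect only in their boundaries. Tiles are isometric copies (reflections allowed) of prototiles. **Deterministic rules.** Let $T\in\mathcal{F}_d$ be formed by $G(\varphi_1),G(\varphi_2),G(\varphi_3)$. Choose $\theta$ with $3\theta\equiv(p+1)\pi/d\pmod\pi$ if $T$ has sign $-$, and $3\theta\equiv-(p+1)\pi/d\pmod\pi$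 if $T$ has sign $+$, such that all three segments $G(\varphi_i+\theta)$ belong to one family $\kappa'\in K_d$. The triangle formed by the $G(\varphi_i+\theta)$ is directly congruent to $\iota_{d,p}\cdot T$ and is cut by the segments of family $\kappa'$ into elementary triangles, each carrying its decoration. This patch, transported to $\iota_{d,p}\cdot T$, is $\Phi_{d,p,+}(T)$. Further, $\Phi_{d,p,-}(T)=\Phi_{d,p,+}(\widetilde{\hat T})$ if $T$ is not isosceles and $\Phi_{d,p,-}(T)=\Phi_{d,p,+}(\widetilde T)$ if $T$ is isosceles. The rules extend to patches by inflating by $\iota_{d,p}$ and replacing each inflated tile by the corresponding isometric copy of its patch. $\mathbf{S}(\mathcal{F}_d;\Phi_{d,p,\epsilon})$ is the set of all tilings of the plane every (finite) patch of which is congruent to some patch in some $\Phi_{d,p,\epsilon}^n(T)$, $T\in\mathcal{F}_d$. **Tile rearrangements and $\mathbf{R_r}$.** If a quadrilateral with diagonals $S_i,S_j$ is the union of two (undecorated) elementary triangles sharing the edge $S_i$, a tile rearrangement (edge flip) consists in replacing $S_i$ by $S_j$, so that the quadrilateral becomes the union of two different prototiles. $\mathbf{R_r}(\bar{\mathcal{F}}_d;\Phi_{d,p,\epsilon})$ is the set of tilings obtained by tile rearrangements in any member of $\mathbf{S}(\mathcal{F}_d;\Phi_{d,p,\epsilon})$ (decorations being dropped). **The rules $\Phi_{d,R}$.** Let $d=2q$. In family $\kappa\in K_d$ let $P_c=G^{(\kappa)}_{c,d}\cap G^{(\kappa)}_{q+c,d}$; the points $P_0,\dots,P_{q-1}$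 are the vertices of a regular polygon with sides of length $4s_1s_{q-1}$ joining $P_c$ to $P_{c+1}$ ($P_q=P_0$). For each side $P_cP_{c+1}$ not lying on a segment of family $\kappa$, the two elementary triangles $\Delta_d^{(\kappa)}(c,q+c,\nu)$ and $\Delta_d^{(\kappa)}(c+1,q+c+1,\nu)$ with $\nu\equiv\kappa-1-q-2c \pmod d$ share an edge $S_q$, and their union is a quadrilateral whose other diagonal is the side $P_cP_{c+1}$ (an $S_{q-1}$); the associated rearrangement is the edge flip $S_q\to S_{q-1}$. The base rule dissects, for each prototile in $\bar{\mathcal{F}}_d$, the inflated prototile as for $\Phi_{d,q,+}$ (inflation factor $\iota_{d,q}$, decorations dropped). $\Phi_{d,R}=\{\Phi_{d,1},\dots,\Phi_{d,k}\}$ is the set of substitution rules obtained from the base rule by all possible combinations of these rearrangements, in the quadrilaterals contained in the inflated prototiles. **Random substitution tilings $\mathbf{R_s}$.** $\mathbf{R_s}(\bar{\mathcal{F}}_d;\Phi_{d,R})$ is the set of tilings of the plane constructed by iterated substitution starting from prototiles of $\bar{\mathcal{F}}_d$, where at each inflation step one can apply to each tile a different substitution rule belonging to $\Phi_{d,R}$ (i.e. every finite patch of the tiling is congruent to a patch occurring in a patch obtained from a single prototile by finitely many such steps). *)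

theory Defs
  imports "HOL-Analysis.Analysis" "HOL-Number_Theory.Cong"
begin

section \<open>Segments\<close>

definition deltoid_point :: "real \<Rightarrow> complex" where
  "deltoid_point \<phi> = 2 * cis \<phi> + cis (- 2 * \<phi>)"

definition G :: "real \<Rightarrow> complex set" where
  "G \<phi> = closed_segment (deltoid_point \<phi>) (deltoid_point (\<phi> + pi))"

definition ang :: "nat \<Rightarrow> int \<Rightarrow> int \<Rightarrow> real" where
  "ang d \<kappa> \<nu> = real_of_int (3 * \<nu> - \<kappa>) * pi / (3 * real d)"

definition Gfam :: "nat \<Rightarrow> int \<Rightarrow> int \<Rightarrow> complex set" where
  "Gfam d \<kappa> \<nu> = G (ang d \<kappa> \<nu>)"

definition K :: "nat \<Rightarrow> int set" where
  "K d = (if 3 dvd d then {-2, 0, 2} else {0})"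

definition s :: "nat \<Rightarrow> nat \<Rightarrow> real" where
  "s d \<nu> = sin (real \<nu> * pi / real d)"

definition iota :: "nat \<Rightarrow> nat \<Rightarrow> real" where
  "iota d p = s d p / s d 1"

text \<open>Any two different segments \<^term>\<open>G \<phi>\<close>, \<^term>\<open>G \<psi>\<close> have exactly one common point.\<close>

definition meet :: "real \<Rightarrow> real \<Rightarrow> complex" where
  "meet \<phi> \<psi> = (THE x. x \<in> G \<phi> \<inter> G \<psi>)"

definition triangle :: "real \<Rightarrow> real \<Rightarrow> real \<Rightarrow> complex set" where
  "triangle \<phi>1 \<phi>2 \<phi>3 = convex hull {meet \<phi>1 \<phi>2, meet \<phi>2 \<phi>3, meet \<phi>1 \<phi>3}"


section \<open>Prototiles\<close>

text \<open>The sign of a triangle is the integer \<open>1\<close> or \<open>-1\<close>.\<close>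

definition elementary :: "nat \<Rightarrow> int \<Rightarrow> int \<Rightarrow> int \<Rightarrow> int \<Rightarrow> int \<Rightarrow> bool" where
  "elementary d \<kappa> \<sigma> l \<mu> \<nu> \<longleftrightarrow>
     \<sigma> \<in> {1, -1} \<and>
     \<not> [l = \<mu>] (mod int d) \<and> \<not> [\<mu> = \<nu>] (mod int d) \<and> \<not> [l = \<nu>] (mod int d) \<and>
     Gfam d \<kappa> l \<inter> Gfam d \<kappa> \<mu> \<inter> Gfam d \<kappa> \<nu> = {} \<and>
     [l + \<mu> + \<nu> = \<kappa> + \<sigma>] (mod int d)"

text \<open>A decorated tile \<open>t \<union> t'\<close> is represented by the pair \<open>(t, t')\<close> of solid triangles;
  an undecorated tile is the solid triangle \<open>t\<close>.\<close>

type_synonym dtile = "complex set \<times> complex set"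

definition decorated :: "nat \<Rightarrow> int \<Rightarrow> real \<Rightarrow> real \<Rightarrow> real \<Rightarrow> dtile" where
  "decorated d \<sigma> \<phi>1 \<phi>2 \<phi>3 =
     (let \<delta> = real_of_int \<sigma> * pi / (2 * real d)
      in (triangle \<phi>1 \<phi>2 \<phi>3, triangle (\<phi>1 - \<delta>) (\<phi>2 - \<delta>) (\<phi>3 - \<delta>)))"

definition F :: "nat \<Rightarrow> dtile set" where
  "F d = {decorated d \<sigma> (ang d \<kappa> l) (ang d \<kappa> \<mu>) (ang d \<kappa> \<nu>) | \<kappa> \<sigma> l \<mu> \<nu>.
            \<kappa> \<in> K d \<and> elementary d \<kappa> \<sigma> l \<mu> \<nu>}"

definition Fbar :: "nat \<Rightarrow> complex set set" where
  "Fbar d = fst ` F d"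


section \<open>Tilings and substitution rules\<close>

text \<open>The notions of this section are used both for decorated tiles
  (\<open>act = dmap\<close>, \<open>supp = fst\<close>) and for undecorated ones (\<open>act = image\<close>, \<open>supp = id\<close>).
  \<open>P\<close>, \<open>X\<close> denote collections of tiles and \<open>\<F>\<close> a set of prototiles.\<close>

definition isometry :: "(complex \<Rightarrow> complex) \<Rightarrow> bool" where
  "isometry f \<longleftrightarrow> (\<forall>x y. dist (f x) (f y) = dist x y)"

definition reflection :: "(complex \<Rightarrow> complex) \<Rightarrow> bool" where \<comment> \<open>orientation-reversing isometry\<close>
  "reflection f \<longleftrightarrow> (\<exists>a b. cmod a = 1 \<and> f = (\<lambda>x. a * cnj x + b))"

definition dmap :: "(complex \<Rightarrow> complex) \<Rightarrow> dtile \<Rightarrow> dtile" where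
  "dmap f T = (f ` fst T, f ` snd T)"

definition copies :: "((complex \<Rightarrow> complex) \<Rightarrow> 't \<Rightarrow> 't) \<Rightarrow> 't set \<Rightarrow> 't set" where
  "copies act \<F> = {act f T | f T. isometry f \<and> T \<in> \<F>}"

definition nonoverlapping :: "('t \<Rightarrow> complex set) \<Rightarrow> 't set \<Rightarrow> bool" where
  "nonoverlapping supp P \<longleftrightarrow>
     (\<forall>T\<in>P. \<forall>U\<in>P. T \<noteq> U \<longrightarrow> interior (supp T) \<inter> interior (supp U) = {})"

definition tiling ::
  "((complex \<Rightarrow> complex) \<Rightarrow> 't \<Rightarrow> 't) \<Rightarrow> ('t \<Rightarrow> complex set) \<Rightarrow> 't set \<Rightarrow> 't set \<Rightarrow> bool" where
  "tiling act supp \<F> X \<longleftrightarrow>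
     countable X \<and> X \<subseteq> copies act \<F> \<and> nonoverlapping supp X \<and> (\<Union>T\<in>X. supp T) = UNIV"

text \<open>A rule on \<open>\<F>\<close> assigns to a prototile \<open>T\<close> the set of the patches, located on the inflated
  triangle \<open>l \<cdot> T\<close>, by which \<open>l \<cdot> T\<close> may be replaced (several ones in the random case).
  It is extended to all isometric copies \<open>f T\<close> of prototiles by means of the isometry that
  \<open>f\<close> induces on the inflated plane.\<close>

definition extend_rule ::
  "((complex \<Rightarrow> complex) \<Rightarrow> 't \<Rightarrow> 't) \<Rightarrow> real \<Rightarrow> 't set \<Rightarrow> ('t \<Rightarrow> 't set set) \<Rightarrow> 't \<Rightarrow> 't set set" where
  "extend_rule act l \<F> R U =
     {act (\<lambda>x. l *\<^sub>R f (x /\<^sub>R l)) ` P | f T P.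
        isometry f \<and> T \<in> \<F> \<and> U = act f T \<and> P \<in> R T}"

primrec iterates :: "('t \<Rightarrow> 't set set) \<Rightarrow> nat \<Rightarrow> 't \<Rightarrow> 't set set" where
  "iterates R 0 T = {{T}}"
| "iterates R (Suc n) T = {\<Union>U\<in>P. Q U | P Q. P \<in> iterates R n T \<and> (\<forall>U\<in>P. Q U \<in> R U)}"

definition substitution_tilings ::
  "((complex \<Rightarrow> complex) \<Rightarrow> 't \<Rightarrow> 't) \<Rightarrow> ('t \<Rightarrow> complex set) \<Rightarrow> 't set \<Rightarrow> ('t \<Rightarrow> 't set set) \<Rightarrow>
    't set set" where
  "substitution_tilings act supp \<F> R =
     {X. tiling act supp \<F> X \<and>
         (\<forall>P. P \<subseteq> X \<and> finite P \<longrightarrow>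
            (\<exists>T\<in>\<F>. \<exists>n. \<exists>Q\<in>iterates R n T. \<exists>f. isometry f \<and> act f ` P \<subseteq> Q))}"

definition inflation_factor ::
  "complex set set \<Rightarrow> (complex set \<Rightarrow> complex set set) set \<Rightarrow> real \<Rightarrow> bool" where
  "inflation_factor \<F> \<Psi>s l \<longleftrightarrow>
     l > 1 \<and> \<Psi>s \<noteq> {} \<and>
     (\<forall>\<Psi>\<in>\<Psi>s. \<forall>t\<in>\<F>.
        finite (\<Psi> t) \<and> \<Psi> t \<subseteq> copies image \<F> \<and> nonoverlapping id (\<Psi> t) \<and>
        \<Union>(\<Psi> t) = (\<lambda>x. l *\<^sub>R x) ` t)"


section \<open>The deterministic rules\<close>

text \<open>\<open>inflation_data d p T \<kappa>' B h\<close>: the prototile \<open>T\<close> is formed by \<open>G(\<phi>\<^sub>i)\<close>, the triangle \<open>B\<close> by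
  \<open>G(\<phi>\<^sub>i + \<theta>)\<close> with \<open>\<theta>\<close> chosen such that these segments belong to family \<open>\<kappa>'\<close>, and \<open>h\<close> is the
  isometry that transports \<open>B\<close> to \<open>\<iota>\<^bsub>d,p\<^esub> \<cdot> T\<close>, corresponding sides being mapped to each other.\<close>

definition inflation_data ::
  "nat \<Rightarrow> nat \<Rightarrow> dtile \<Rightarrow> int \<Rightarrow> complex set \<Rightarrow> (complex \<Rightarrow> complex) \<Rightarrow> bool" where
  "inflation_data d p T \<kappa>' B h \<longleftrightarrow>
     (\<exists>\<kappa> \<sigma> l \<mu> \<nu> \<theta> \<phi>1 \<phi>2 \<phi>3.
        \<kappa> \<in> K d \<and> elementary d \<kappa> \<sigma> l \<mu> \<nu> \<and>
        \<phi>1 = ang d \<kappa> l \<and> \<phi>2 = ang d \<kappa> \<mu> \<and> \<phi>3 = ang d \<kappa> \<nu> \<and>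
        T = decorated d \<sigma> \<phi>1 \<phi>2 \<phi>3 \<and>
        (\<exists>k::int. 3 * \<theta> = - real_of_int \<sigma> * (real p + 1) * pi / real d + real_of_int k * pi) \<and>
        \<kappa>' \<in> K d \<and> {\<phi>1 + \<theta>, \<phi>2 + \<theta>, \<phi>3 + \<theta>} \<subseteq> range (ang d \<kappa>') \<and>
        B = triangle (\<phi>1 + \<theta>) (\<phi>2 + \<theta>) (\<phi>3 + \<theta>) \<and>
        isometry h \<and>
        h (meet (\<phi>1 + \<theta>) (\<phi>2 + \<theta>)) = iota d p *\<^sub>R meet \<phi>1 \<phi>2 \<and>
        h (meet (\<phi>2 + \<theta>) (\<phi>3 + \<theta>)) = iota d p *\<^sub>R meet \<phi>2 \<phi>3 \<and>
        h (meet (\<phi>1 + \<theta>) (\<phi>3 + \<theta>)) = iota d p *\<^sub>R meet \<phi>1 \<phi>3)"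

definition cells :: "nat \<Rightarrow> int \<Rightarrow> complex set \<Rightarrow> dtile set" where
  "cells d \<kappa> B =
     {decorated d \<sigma> (ang d \<kappa> l) (ang d \<kappa> \<mu>) (ang d \<kappa> \<nu>) | \<sigma> l \<mu> \<nu>.
        elementary d \<kappa> \<sigma> l \<mu> \<nu> \<and> triangle (ang d \<kappa> l) (ang d \<kappa> \<mu>) (ang d \<kappa> \<nu>) \<subseteq> B}"

text \<open>The possible choices of \<open>\<theta>\<close> differ by multiples of \<open>\<pi>/3\<close>, which act on the segments as
  rotations; so the following set contains a single patch.\<close>

definition Phi_plus :: "nat \<Rightarrow> nat \<Rightarrow> dtile \<Rightarrow> dtile set set" where
  "Phi_plus d p T = {dmap h ` cells d \<kappa>' B | \<kappa>' B h. inflation_data d p T \<kappa>' B h}"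

definition isosceles :: "complex set \<Rightarrow> bool" where
  "isosceles t \<longleftrightarrow>
     (\<exists>A B C. \<not> collinear {A, B, C} \<and> t = convex hull {A, B, C} \<and> dist A B = dist A C)"

definition mirror_images :: "dtile \<Rightarrow> dtile set" where
  "mirror_images T = {dmap f T | f. reflection f}"

text \<open>The copies of the prototile called T-hat. A reflection reverses the sense in which an edge
  \<open>BC\<close> is read, so the mirror image of \<open>BC\<close>, read anticlockwise, is subdivided as \<open>BC\<close> itself
  if the mirror image of \<open>B + C - D\<close> is taken instead of that of the division point \<open>D\<close>.\<close>

definition hats :: "dtile \<Rightarrow> dtile set" where
  "hats T = {U. \<exists>A B C D E H f.
     \<not> collinear {A, B, C} \<and> fst T = convex hull {A, B, C} \<and> snd T = convex hull {D, E, H} \<and>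
     D \<in> closed_segment B C \<and> E \<in> closed_segment C A \<and> H \<in> closed_segment A B \<and>
     reflection f \<and>
     U = (f ` fst T, convex hull {f (B + C - D), f (C + A - E), f (A + B - H)})}"

text \<open>Since the patch must be located on \<open>\<iota>\<^bsub>d,p\<^esub> \<cdot> T\<close>, the copy \<open>U\<close> of the prototile whose patch is
  used is the one with the same underlying triangle as \<open>T\<close>.\<close>

definition Phi_minus :: "nat \<Rightarrow> nat \<Rightarrow> dtile \<Rightarrow> dtile set set" where
  "Phi_minus d p T =
     (\<Union>U \<in> {U. fst U = fst T \<and>
               U \<in> (if isosceles (fst T) then mirror_images T else \<Union> (mirror_images ` hats T))}.
        extend_rule dmap (iota d p) (F d) (Phi_plus d p) U)"

text \<open>The sign \<open>\<epsilon>\<close> is \<open>1\<close> or \<open>-1\<close>.\<close>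

definition Phi :: "nat \<Rightarrow> nat \<Rightarrow> int \<Rightarrow> dtile \<Rightarrow> dtile set set" where
  "Phi d p \<epsilon> =
     extend_rule dmap (iota d p) (F d) (if \<epsilon> = 1 then Phi_plus d p else Phi_minus d p)"

definition S :: "nat \<Rightarrow> nat \<Rightarrow> int \<Rightarrow> dtile set set" where
  "S d p \<epsilon> = substitution_tilings dmap fst (F d) (Phi d p \<epsilon>)"


section \<open>Tile rearrangements\<close>

definition congruent_sets :: "complex set \<Rightarrow> complex set \<Rightarrow> bool" where
  "congruent_sets t u \<longleftrightarrow> (\<exists>f. isometry f \<and> u = f ` t)"

text \<open>The quadrilateral with vertices \<open>A, C, B, D\<close> and diagonals \<open>AB\<close> (an \<open>S\<^sub>i\<close>) and
  \<open>CD\<close> (an \<open>S\<^sub>j\<close>).\<close>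

definition flip :: "nat \<Rightarrow> complex set set \<Rightarrow> complex set set \<Rightarrow> bool" where
  "flip d P Q \<longleftrightarrow>
     (\<exists>A B C D i j t1 t2 u1 u2.
        i \<in> {1..<d} \<and> j \<in> {1..<d} \<and>
        dist A B = 4 * s d 1 * s d i \<and> dist C D = 4 * s d 1 * s d j \<and>
        open_segment A B \<inter> open_segment C D \<noteq> {} \<and>
        t1 = convex hull {A, B, C} \<and> t2 = convex hull {A, B, D} \<and>
        u1 = convex hull {C, D, A} \<and> u2 = convex hull {C, D, B} \<and>
        {t1, t2, u1, u2} \<subseteq> copies image (Fbar d) \<and>
        \<not> (congruent_sets t1 u1 \<and> congruent_sets t2 u2) \<and>
        \<not> (congruent_sets t1 u2 \<and> congruent_sets t2 u1) \<and>
        P = {t1, t2} \<and> Q = {u1, u2})"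

text \<open>Rearrangements in a non-empty, possibly infinite set \<open>R\<close> of quadrilaterals without common
  tiles.\<close>

definition rearrangement :: "nat \<Rightarrow> complex set set \<Rightarrow> complex set set \<Rightarrow> bool" where
  "rearrangement d X Y \<longleftrightarrow>
     (\<exists>R. R \<noteq> {} \<and> (\<forall>(P, Q)\<in>R. flip d P Q \<and> P \<subseteq> X) \<and>
          (\<forall>a\<in>R. \<forall>b\<in>R. a \<noteq> b \<longrightarrow> fst a \<inter> fst b = {}) \<and>
          Y = (X - \<Union> (fst ` R)) \<union> \<Union> (snd ` R))"

definition R_r :: "nat \<Rightarrow> nat \<Rightarrow> int \<Rightarrow> complex set set set" where
  "R_r d p \<epsilon> =
     {Y. tiling image id (Fbar d) Y \<and> (\<exists>X\<in>S d p \<epsilon>. (rearrangement d)\<^sup>+\<^sup>+ (fst ` X) Y)}"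


section \<open>The random substitution rules\<close>

definition P_vertex :: "nat \<Rightarrow> int \<Rightarrow> int \<Rightarrow> complex" where
  "P_vertex d \<kappa> c = meet (ang d \<kappa> c) (ang d \<kappa> (int (d div 2) + c))"

definition quad_index :: "nat \<Rightarrow> int \<Rightarrow> int \<Rightarrow> int" where
  "quad_index d \<kappa> c = \<kappa> - 1 - int (d div 2) - 2 * c"

definition quad_old :: "nat \<Rightarrow> int \<Rightarrow> int \<Rightarrow> complex set set" where
  "quad_old d \<kappa> c =
     (\<lambda>e. triangle (ang d \<kappa> e) (ang d \<kappa> (int (d div 2) + e)) (ang d \<kappa> (quad_index d \<kappa> c))) ` {c, c + 1}"

text \<open>The shared edge \<open>S\<^sub>q\<close> lies on the segment with index \<open>\<nu> = quad_index d \<kappa> c\<close>; its end points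
  are the intersections with the segments of indices \<open>c\<close> and \<open>q + c\<close>.\<close>

definition quad_new :: "nat \<Rightarrow> int \<Rightarrow> int \<Rightarrow> complex set set" where
  "quad_new d \<kappa> c =
     (\<lambda>e. convex hull {P_vertex d \<kappa> c, P_vertex d \<kappa> (c + 1),
                       meet (ang d \<kappa> e) (ang d \<kappa> (quad_index d \<kappa> c))}) ` {c, int (d div 2) + c}"

definition flippable :: "nat \<Rightarrow> int \<Rightarrow> complex set \<Rightarrow> int set" where
  "flippable d \<kappa> B =
     {c \<in> {0..<int (d div 2)}.
        \<not> (\<exists>\<nu>. closed_segment (P_vertex d \<kappa> c) (P_vertex d \<kappa> (c + 1)) \<subseteq> Gfam d \<kappa> \<nu>) \<and>
        \<Union> (quad_old d \<kappa> c) \<subseteq> B}"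

text \<open>The patches obtained from the base rule for \<open>t\<close> by rearrangements in an arbitrary set \<open>C\<close> of
  quadrilaterals; \<open>C = {}\<close> gives the base rule itself.\<close>

definition variants :: "nat \<Rightarrow> complex set \<Rightarrow> complex set set set" where
  "variants d t =
     {image h ` ((fst ` cells d \<kappa>' B - (\<Union>c\<in>C. quad_old d \<kappa>' c)) \<union> (\<Union>c\<in>C. quad_new d \<kappa>' c))
        | T \<kappa>' B h C. T \<in> F d \<and> fst T = t \<and> inflation_data d (d div 2) T \<kappa>' B h \<and>
                        C \<subseteq> flippable d \<kappa>' B}"

definition Phi_R :: "nat \<Rightarrow> (complex set \<Rightarrow> complex set set) set" where
  "Phi_R d = (\<Pi>\<^sub>E t\<in>Fbar d. variants d t)"

text \<open>In each step every tile may be substituted by a different rule.\<close>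

definition random_rule :: "nat \<Rightarrow> complex set \<Rightarrow> complex set set set" where
  "random_rule d u =
     (\<Union>\<Psi>\<in>Phi_R d. extend_rule image (iota d (d div 2)) (Fbar d) (\<lambda>t. {\<Psi> t}) u)"

definition R_s :: "nat \<Rightarrow> complex set set set" where
  "R_s d = substitution_tilings image id (Fbar d) (random_rule d)"

end

theory Submission
  imports Defs
begin

text \<open>
  The vertices of an elementary triangle have the form \<open>z + w e\<close> with \<open>\<bar>w\<bar> = 2 s\<^sub>1\<close> and \<open>e\<close> a
  \<open>d\<close>-th root of unity, so that a tile is determined, up to an orientation-preserving isometry, by its
  angles \<open>a\<pi>/d, b\<pi>/d, c\<pi>/d\<close> and its sign. On these types, inflation acts as a finite directed graph
  that carries a permutation of its arcs; hence reachability is symmetric and every tile recurs in the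
  interior of one of its iterated patches. The patches around the recurring tile exhaust the plane.
  The patch of the tile with angles \<open>2, q - p + 2, q + p - 4\<close> (times \<open>\<pi>/d\<close>) and sign \<open>\<epsilon>\<close> contains two right-angled
  triangles that share their hypotenuse, a diameter of their common circumcircle, and flipping this
  edge in a tiling that contains the tile gives an element of \<open>R_r\<close>. For \<open>R_s\<close> it suffices to
  choose one patch for every tile, since some prototile recurs by the pigeonhole principle.
\<close>

section \<open>Intersections of the segments\<close>

text \<open>The lines that carry the segments are the tangents of the deltoid. A point inside it
  lies on three of them, with parameters adding up to a multiple of \<pi>, and these parameters
  serve as coordinates: the lines of a family are the integer indices, and the dissection of a
  triangle becomes a decomposition by integer parts. The obstacle for \<open>R_r\<close> is that
  recurrence of some tile is too weak: a prescribed tile, one whose patch contains a flippable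
  quadrilateral, has to recur. Instead of strong connectivity of the type graph only a return to the
  starting type is shown, which the permutation of the arcs yields without any knowledge of the
  components. The second difficulty is that a rule returns a set of located patches and that a tile
  may be presented in several ways as a copy of a prototile. So one patch is chosen for every
  located tile. This choice need not commute with isometries; only the full rule does, and this is
  enough to bring the iterated patches back to prototiles.\<close>

definition pt :: "real \<Rightarrow> real \<Rightarrow> complex" where
  "pt \<phi> \<psi> = cis (- 2 * \<phi>) + cis (- 2 * \<psi>) + cis (2 * \<phi> + 2 * \<psi>)"

text \<open>Signed distance of \<open>x\<close> from the line that carries \<open>G \<eta>\<close>:
  this line passes through \<open>cis (- 2 * \<eta>)\<close> in direction \<open>cis \<eta>\<close>,
  and \<open>sin (3 * \<eta>)\<close> makes the value at that point zero.\<close>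

definition lf :: "real \<Rightarrow> complex \<Rightarrow> real" where
  "lf \<eta> x = Im (x * cis (- \<eta>)) + sin (3 * \<eta>)"

lemma four_sin_product:
  "4 * sin a * sin b * sin c = sin (a + b - c) + sin (a + c - b) + sin (b + c - a) - sin (a + b + c)"
  for a b c :: real
proof -
  have "sin (a + b - c) + sin (a + c - b) + sin (b + c - a) - sin (a + b + c) =
    4 * sin a * sin b * sin c"
    by (simp add: sin_add sin_diff cos_add cos_diff algebra_simps)
  then show ?thesis ..
qed

text \<open>The exponentials in \<open>pt\<close> contribute three sines, which together with
  \<open>sin (3 * \<eta>)\<close> expand a product. Its last factor shows that a further line \<eta>
  passes through the point exactly if \<eta> + \<phi> + \<psi> is a multiple of \<pi>.\<close>

lemma lf_pt: "lf \<eta> (pt \<phi> \<psi>) = - 4 * sin (\<eta> - \<phi>) * sin (\<eta> - \<psi>) * sin (\<eta> + \<phi> + \<psi>)"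
proof -
  have *: "lf \<eta> (pt \<phi> \<psi>) = - sin (2 * \<phi> + \<eta>) - sin (2 * \<psi> + \<eta>) - sin (\<eta> - 2 * \<phi> - 2 * \<psi>) + sin (3 * \<eta>)"
  proof -
    have "cis (- 2 * \<phi>) * cis (- \<eta>) = cis (- (2 * \<phi> + \<eta>))" "cis (- 2 * \<psi>) * cis (- \<eta>) = cis (- (2 * \<psi> + \<eta>))"
      "cis (2 * \<phi> + 2 * \<psi>) * cis (- \<eta>) = cis (- (\<eta> - 2 * \<phi> - 2 * \<psi>))"
      by (simp_all add: cis_mult algebra_simps)
    then have "pt \<phi> \<psi> * cis (- \<eta>) = cis (- (2 * \<phi> + \<eta>)) + cis (- (2 * \<psi> + \<eta>)) + cis (- (\<eta> - 2 * \<phi> - 2 * \<psi>))"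
      unfolding pt_def distrib_right by (simp only:)
    then have "Im (pt \<phi> \<psi> * cis (- \<eta>)) = Im (cis (- (2 * \<phi> + \<eta>)) + cis (- (2 * \<psi> + \<eta>)) + cis (- (\<eta> - 2 * \<phi> - 2 * \<psi>)))"
      by (simp only:)
    then show ?thesis unfolding lf_def plus_complex.simps cis.simps sin_minus by (simp only:)
  qed
  have e: "(\<eta> - \<phi>) + (\<eta> - \<psi>) - (\<eta> + \<phi> + \<psi>) = \<eta> - 2 * \<phi> - 2 * \<psi>"
    "(\<eta> - \<phi>) + (\<eta> + \<phi> + \<psi>) - (\<eta> - \<psi>) = 2 * \<psi> + \<eta>"
    "(\<eta> - \<psi>) + (\<eta> + \<phi> + \<psi>) - (\<eta> - \<phi>) = 2 * \<phi> + \<eta>"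
    "(\<eta> - \<phi>) + (\<eta> - \<psi>) + (\<eta> + \<phi> + \<psi>) = 3 * \<eta>" by simp_all
  show ?thesis
    using four_sin_product[of "\<eta> - \<phi>" "\<eta> - \<psi>" "\<eta> + \<phi> + \<psi>"] * unfolding e by linarith
qed

lemma pt_commute: "pt \<phi> \<psi> = pt \<psi> \<phi>"
  by (simp add: pt_def add.commute)

lemma cis_add_2pi_int: "cis (x + 2 * pi * of_int k) = cis x"
  by (simp add: complex_eq_iff cos_add sin_add cos_int_2pin sin_int_2pin)

text \<open>\<open>pt\<close> is the symmetric sum of \<open>cis (- 2 * x)\<close> over three
  parameters whose sum is a multiple of \<pi>, so any two of the three determine the same
  point.\<close>

lemma pt_third:
  assumes "\<phi> + \<psi> + \<eta> = pi * of_int k" shows "pt \<phi> \<psi> = pt \<phi> \<eta>"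
proof -
  have 1: "\<eta> = pi * of_int k - \<phi> - \<psi>" using assms by simp
  have "cis (- 2 * \<eta>) = cis (2 * \<phi> + 2 * \<psi>)"
    using cis_add_2pi_int[of "2 * \<phi> + 2 * \<psi>" "- k"] unfolding 1 by (simp add: algebra_simps)
  moreover have "cis (2 * \<phi> + 2 * \<eta>) = cis (- 2 * \<psi>)"
    using cis_add_2pi_int[of "- 2 * \<psi>" "k"] unfolding 1 by (simp add: algebra_simps)
  ultimately show ?thesis by (simp add: pt_def)
qed

lemma G_eq: "G \<phi> = {cis (- 2 * \<phi>) + of_real t * cis \<phi> | t. \<bar>t\<bar> \<le> 2}"
proof -
  have c: "cis (\<phi> + pi) = - cis \<phi>" "cis (- 2 * (\<phi> + pi)) = cis (- 2 * \<phi>)"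
    using cis_add_2pi_int[of "- 2 * \<phi>" "- 1"] by (simp_all add: algebra_simps flip: cis_mult)
  have e: "(1 - u) *\<^sub>R deltoid_point \<phi> + u *\<^sub>R deltoid_point (\<phi> + pi)
     = cis (- 2 * \<phi>) + of_real (2 - 4 * u) * cis \<phi>" for u
    unfolding deltoid_point_def c by (simp add: scaleR_conv_of_real algebra_simps)
  show ?thesis
  proof (intro equalityI subsetI)
    fix x assume "x \<in> G \<phi>"
    then obtain u where "0 \<le> u" "u \<le> 1" "x = (1 - u) *\<^sub>R deltoid_point \<phi> + u *\<^sub>R deltoid_point (\<phi> + pi)"
      unfolding G_def in_segment by auto
    then show "x \<in> {cis (- 2 * \<phi>) + of_real t * cis \<phi> | t. \<bar>t\<bar> \<le> 2}"
      unfolding e by (intro CollectI exI[of _ "2 - 4 * u"]) auto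
  next
    fix x assume "x \<in> {cis (- 2 * \<phi>) + of_real t * cis \<phi> | t. \<bar>t\<bar> \<le> 2}"
    then obtain t where "\<bar>t\<bar> \<le> 2" "x = cis (- 2 * \<phi>) + of_real t * cis \<phi>" by auto
    moreover have "2 - 4 * ((2 - t) / 4) = t" by (simp add: field_simps)
    ultimately have "x = (1 - (2 - t) / 4) *\<^sub>R deltoid_point \<phi> + ((2 - t) / 4) *\<^sub>R deltoid_point (\<phi> + pi)"
      unfolding e by (simp only:)
    moreover have "0 \<le> (2 - t) / 4" "(2 - t) / 4 \<le> 1" using \<open>\<bar>t\<bar> \<le> 2\<close> by auto
    ultimately show "x \<in> G \<phi>" unfolding G_def in_segment by blast
  qed
qed

lemma cis_add_cis_minus: "cis x + cis (- x) = of_real (2 * cos x)"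
  by (simp add: complex_eq_iff)

text \<open>The coordinate along the segment is twice a cosine, hence at most 2 in absolute value.
  The intersection of the two lines therefore never leaves the closed segments.\<close>

lemma pt_in_G: "pt \<phi> \<psi> \<in> G \<phi>"
proof -
  have "pt \<phi> \<psi> = cis (- 2 * \<phi>) + of_real (2 * cos (\<phi> + 2 * \<psi>)) * cis \<phi>"
  proof -
    have "of_real (2 * cos (\<phi> + 2 * \<psi>)) = cis (\<phi> + 2 * \<psi>) + cis (- (\<phi> + 2 * \<psi>))"
      by (rule cis_add_cis_minus[symmetric])
    then have "of_real (2 * cos (\<phi> + 2 * \<psi>)) * cis \<phi> = cis (2 * \<phi> + 2 * \<psi>) + cis (- 2 * \<psi>)"
      by (simp add: distrib_right cis_mult algebra_simps)
    then show ?thesis by (simp add: pt_def)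
  qed
  moreover have "\<bar>2 * cos (\<phi> + 2 * \<psi>)\<bar> \<le> 2" by (simp add: abs_mult)
  ultimately show ?thesis unfolding G_eq by blast
qed

lemma lf_zero_on_G: "x \<in> G \<phi> \<Longrightarrow> lf \<phi> x = 0"
proof -
  assume "x \<in> G \<phi>"
  then obtain t where x: "x = cis (- 2 * \<phi>) + of_real t * cis \<phi>" unfolding G_eq by auto
  have "x * cis (- \<phi>) = cis (- (3 * \<phi>)) + of_real t"
    unfolding x distrib_right mult.assoc cis_mult by simp
  then show ?thesis by (simp add: lf_def)
qed

lemma lf_diff: "lf \<eta> x - lf \<eta> y = Im ((x - y) * cis (- \<eta>))"
  by (simp add: lf_def left_diff_distrib)

lemma lf_zeros_unique:
  assumes "lf \<phi> x = 0" "lf \<psi> x = 0" "lf \<phi> y = 0" "lf \<psi> y = 0" "sin (\<phi> - \<psi>) \<noteq> 0"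
  shows "x = y"
proof -
  define z where "z = x - y"
  have "Im (z * cis (- \<phi>)) = 0" "Im (z * cis (- \<psi>)) = 0"
    using lf_diff[of \<phi> x y] lf_diff[of \<psi> x y] assms by (auto simp: z_def)
  then have a: "Im z * cos \<phi> = Re z * sin \<phi>" "Im z * cos \<psi> = Re z * sin \<psi>" by auto
  have "Re z * sin (\<phi> - \<psi>) = 0" unfolding sin_diff using a by algebra
  moreover have "Im z * sin (\<phi> - \<psi>) = 0" unfolding sin_diff using a by algebra
  ultimately have "z = 0" using assms(5) by (simp add: complex_eq_iff)
  then show ?thesis by (simp add: z_def)
qed

lemma lf_pt_self: "lf \<phi> (pt \<phi> \<psi>) = 0" "lf \<psi> (pt \<phi> \<psi>) = 0"
  by (simp_all add: lf_pt)

text \<open>Different directions make the common zero of the two line functions unique, which turns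
  the definite description in \<open>meet\<close> into an explicit formula.\<close>

lemma meet_eq_pt:
  assumes "sin (\<phi> - \<psi>) \<noteq> 0" shows "meet \<phi> \<psi> = pt \<phi> \<psi>"
  unfolding meet_def
proof (rule the_equality)
  show "pt \<phi> \<psi> \<in> G \<phi> \<inter> G \<psi>" using pt_in_G pt_commute by (metis IntI)
next
  fix x assume "x \<in> G \<phi> \<inter> G \<psi>"
  then show "x = pt \<phi> \<psi>"
    using lf_zeros_unique[OF _ _ _ _ assms] lf_zero_on_G lf_pt_self by (metis IntD1 IntD2)
qed

text \<open>Barycentric coordinates with respect to \<open>A, B, C\<close> are affine functions that vanish on one
  side each, so they are the normalised line functions.\<close>

lemma triangle_membership:
  fixes A B C :: complex and f1 f2 f3 :: "complex \<Rightarrow> real"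
  assumes aff: "\<And>x y z a b c. a + b + c = 1 \<Longrightarrow> f1 (a *\<^sub>R x + b *\<^sub>R y + c *\<^sub>R z) = a * f1 x + b * f1 y + c * f1 z"
     "\<And>x y z a b c. a + b + c = 1 \<Longrightarrow> f2 (a *\<^sub>R x + b *\<^sub>R y + c *\<^sub>R z) = a * f2 x + b * f2 y + c * f2 z"
     "\<And>x y z a b c. a + b + c = 1 \<Longrightarrow> f3 (a *\<^sub>R x + b *\<^sub>R y + c *\<^sub>R z) = a * f3 x + b * f3 y + c * f3 z"
   and z: "f1 B = 0" "f1 C = 0" "f2 A = 0" "f2 C = 0" "f3 A = 0" "f3 B = 0"
   and nz: "f1 A \<noteq> 0" "f2 B \<noteq> 0" "f3 C \<noteq> 0"
  shows "\<not> collinear {A, B, C}"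
    and "x \<in> convex hull {A, B, C} \<longleftrightarrow> f1 x * f1 A \<ge> 0 \<and> f2 x * f2 B \<ge> 0 \<and> f3 x * f3 C \<ge> 0"
    and "x \<in> interior (convex hull {A, B, C}) \<longleftrightarrow> f1 x * f1 A > 0 \<and> f2 x * f2 B > 0 \<and> f3 x * f3 C > 0"
proof -
  show nc: "\<not> collinear {A, B, C}"
  proof
    assume "collinear {A, B, C}"
    then have "collinear {A, C, B}" by (simp add: insert_commute)
    moreover have "A \<noteq> B" using z nz by metis
    ultimately obtain u where "C = u *\<^sub>R A + (1 - u) *\<^sub>R B"
      unfolding collinear_3_expand by blast
    then have "f3 C = 0" using aff(3)[of u "1 - u" 0 A B A] z by simp
    then show False using nz by simp
  qed
  have ad: "aff_dim {A, B, C} = 2"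
    using nc aff_dim_le_DIM[of "{A,B,C}"] by (simp add: collinear_aff_dim)
  have "affine hull {A, B, C} = UNIV" using ad aff_dim_eq_full[of "{A,B,C}"] by simp
  then obtain a b c where abc: "a + b + c = 1" "x = a *\<^sub>R A + b *\<^sub>R B + c *\<^sub>R C"
    unfolding affine_hull_3 by blast
  have f: "f1 x = a * f1 A" "f2 x = b * f2 B" "f3 x = c * f3 C"
    using aff(1)[OF abc(1)] aff(2)[OF abc(1)] aff(3)[OF abc(1)] z by (simp_all add: abc(2))
  have uniq: "a' = a \<and> b' = b \<and> c' = c" if "a' + b' + c' = 1" "x = a' *\<^sub>R A + b' *\<^sub>R B + c' *\<^sub>R C" for a' b' c'
    using aff(1)[OF that(1)] aff(2)[OF that(1)] aff(3)[OF that(1)] z nz f by (simp add: that(2))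
  have sq: "f1 A * f1 A > 0" "f2 B * f2 B > 0" "f3 C * f3 C > 0"
    using nz not_real_square_gt_zero by blast+
  have sgn_le: "0 \<le> u * v \<longleftrightarrow> 0 \<le> u" and sgn_less: "0 < u * v \<longleftrightarrow> 0 < u" if "0 < v" for u v :: real
    using that by (simp_all add: zero_le_mult_iff zero_less_mult_iff)
  have s: "f1 x * f1 A \<ge> 0 \<longleftrightarrow> a \<ge> 0" "f2 x * f2 B \<ge> 0 \<longleftrightarrow> b \<ge> 0" "f3 x * f3 C \<ge> 0 \<longleftrightarrow> c \<ge> 0"
     "f1 x * f1 A > 0 \<longleftrightarrow> a > 0" "f2 x * f2 B > 0 \<longleftrightarrow> b > 0" "f3 x * f3 C > 0 \<longleftrightarrow> c > 0"
    unfolding f mult.assoc using sgn_le[OF sq(1)] sgn_le[OF sq(2)] sgn_le[OF sq(3)]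
      sgn_less[OF sq(1)] sgn_less[OF sq(2)] sgn_less[OF sq(3)] by blast+
  show "x \<in> convex hull {A, B, C} \<longleftrightarrow> f1 x * f1 A \<ge> 0 \<and> f2 x * f2 B \<ge> 0 \<and> f3 x * f3 C \<ge> 0"
    unfolding s convex_hull_3 using abc uniq by blast
  show "x \<in> interior (convex hull {A, B, C}) \<longleftrightarrow> f1 x * f1 A > 0 \<and> f2 x * f2 B > 0 \<and> f3 x * f3 C > 0"
    unfolding s interior_convex_hull_3_minimal[OF nc DIM_complex] using abc uniq by blast
qed

lemma lf_affine:
  assumes "a + b + c = 1"
  shows "lf \<eta> (a *\<^sub>R x + b *\<^sub>R y + c *\<^sub>R z) = a * lf \<eta> x + b * lf \<eta> y + c * lf \<eta> z"
proof -
  have "sin (3 * \<eta>) = (a + b + c) * sin (3 * \<eta>)" using assms by simp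
  then show ?thesis by (simp add: lf_def algebra_simps)
qed

lemma triangle_iff:
  assumes "sin (\<phi>1 - \<phi>2) \<noteq> 0" "sin (\<phi>2 - \<phi>3) \<noteq> 0" "sin (\<phi>1 - \<phi>3) \<noteq> 0" "sin (\<phi>1 + \<phi>2 + \<phi>3) \<noteq> 0"
  shows "\<not> collinear {pt \<phi>2 \<phi>3, pt \<phi>1 \<phi>3, pt \<phi>1 \<phi>2}"
    "triangle \<phi>1 \<phi>2 \<phi>3 = convex hull {pt \<phi>2 \<phi>3, pt \<phi>1 \<phi>3, pt \<phi>1 \<phi>2}"
    "x \<in> triangle \<phi>1 \<phi>2 \<phi>3 \<longleftrightarrow> lf \<phi>1 x * lf \<phi>1 (pt \<phi>2 \<phi>3) \<ge> 0 \<and>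
        lf \<phi>2 x * lf \<phi>2 (pt \<phi>1 \<phi>3) \<ge> 0 \<and> lf \<phi>3 x * lf \<phi>3 (pt \<phi>1 \<phi>2) \<ge> 0"
    "x \<in> interior (triangle \<phi>1 \<phi>2 \<phi>3) \<longleftrightarrow> lf \<phi>1 x * lf \<phi>1 (pt \<phi>2 \<phi>3) > 0 \<and>
        lf \<phi>2 x * lf \<phi>2 (pt \<phi>1 \<phi>3) > 0 \<and> lf \<phi>3 x * lf \<phi>3 (pt \<phi>1 \<phi>2) > 0"
proof -
  have s: "sin (\<phi>2 - \<phi>1) \<noteq> 0" "sin (\<phi>3 - \<phi>2) \<noteq> 0" "sin (\<phi>3 - \<phi>1) \<noteq> 0"
    using assms(1-3) by (metis minus_diff_eq neg_equal_0_iff_equal sin_minus)+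
  show t: "triangle \<phi>1 \<phi>2 \<phi>3 = convex hull {pt \<phi>2 \<phi>3, pt \<phi>1 \<phi>3, pt \<phi>1 \<phi>2}"
    unfolding triangle_def using assms by (simp add: meet_eq_pt insert_commute)
  have z: "lf \<phi>1 (pt \<phi>1 \<phi>3) = 0" "lf \<phi>1 (pt \<phi>1 \<phi>2) = 0" "lf \<phi>2 (pt \<phi>2 \<phi>3) = 0"
     "lf \<phi>2 (pt \<phi>1 \<phi>2) = 0" "lf \<phi>3 (pt \<phi>2 \<phi>3) = 0" "lf \<phi>3 (pt \<phi>1 \<phi>3) = 0"
    by (simp_all add: lf_pt_self)
  have p: "\<phi>2 + \<phi>1 + \<phi>3 = \<phi>1 + \<phi>2 + \<phi>3" "\<phi>3 + \<phi>1 + \<phi>2 = \<phi>1 + \<phi>2 + \<phi>3" by simp_all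
  have nz: "lf \<phi>1 (pt \<phi>2 \<phi>3) \<noteq> 0" "lf \<phi>2 (pt \<phi>1 \<phi>3) \<noteq> 0" "lf \<phi>3 (pt \<phi>1 \<phi>2) \<noteq> 0"
    unfolding lf_pt p using assms s by simp_all
  note T = triangle_membership[OF lf_affine lf_affine lf_affine z nz]
  show "\<not> collinear {pt \<phi>2 \<phi>3, pt \<phi>1 \<phi>3, pt \<phi>1 \<phi>2}" using T(1) .
  show "x \<in> triangle \<phi>1 \<phi>2 \<phi>3 \<longleftrightarrow> lf \<phi>1 x * lf \<phi>1 (pt \<phi>2 \<phi>3) \<ge> 0 \<and>
        lf \<phi>2 x * lf \<phi>2 (pt \<phi>1 \<phi>3) \<ge> 0 \<and> lf \<phi>3 x * lf \<phi>3 (pt \<phi>1 \<phi>2) \<ge> 0"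
    unfolding t by (rule T(2))
  show "x \<in> interior (triangle \<phi>1 \<phi>2 \<phi>3) \<longleftrightarrow> lf \<phi>1 x * lf \<phi>1 (pt \<phi>2 \<phi>3) > 0 \<and>
        lf \<phi>2 x * lf \<phi>2 (pt \<phi>1 \<phi>3) > 0 \<and> lf \<phi>3 x * lf \<phi>3 (pt \<phi>1 \<phi>2) > 0"
    unfolding t by (rule T(3))
qed

section \<open>Elementary triangles\<close>

text \<open>The centroid is an interior point, and a closed convex set with interior points is the
  closure of its interior. This extends statements about interiors to whole triangles.\<close>

lemma regular_triangle:
  fixes A B C :: complex
  assumes "\<not> collinear {A, B, C}"
  shows "interior (convex hull {A, B, C}) \<noteq> {}"
    and "closure (interior (convex hull {A, B, C})) = convex hull {A, B, C}"
proof -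
  have "(1/3) *\<^sub>R A + (1/3) *\<^sub>R B + (1/3) *\<^sub>R C \<in> interior (convex hull {A, B, C})"
    unfolding interior_convex_hull_3_minimal[OF assms DIM_complex]
    by (intro CollectI exI[of _ "1/3"]) auto
  then show i: "interior (convex hull {A, B, C}) \<noteq> {}" by blast
  have "closed (convex hull {A, B, C})"
    by (intro compact_imp_closed finite_imp_compact_convex_hull) auto
  then show "closure (interior (convex hull {A, B, C})) = convex hull {A, B, C}"
    using convex_closure_interior[OF convex_convex_hull i] by simp
qed

text \<open>A finite open set is empty, so nothing of \<open>S\<close> can lie outside the closure.
  In the dissection this absorbs the finitely many points with integer parameters.\<close>

lemma open_subset_closure_diff_finite:
  fixes S :: "'a::euclidean_space set"
  assumes "open S" "finite V" shows "S \<subseteq> closure (S - V)"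
proof -
  have "S - closure (S - V) \<subseteq> V" using closure_subset[of "S - V"] by auto
  then have "finite (S - closure (S - V))" using assms(2) by (rule finite_subset)
  moreover have "open (S - closure (S - V))" using assms(1) by (simp add: open_Diff)
  ultimately have "S - closure (S - V) = {}" by (rule finite_imp_not_open)
  then show ?thesis by blast
qed

section \<open>Line functions with real indices\<close>

definition sg :: "nat \<Rightarrow> real \<Rightarrow> real" where "sg d z = sin (z * pi / real d)"

text \<open>\<open>ang\<close> with a real index: integers give the segments of the family, the
  other values the remaining tangents, which are needed as coordinates of points off the
  family.\<close>

definition angr :: "nat \<Rightarrow> int \<Rightarrow> real \<Rightarrow> real" where
  "angr d \<kappa> y = (3 * y - of_int \<kappa>) * pi / (3 * real d)"

definition ell :: "nat \<Rightarrow> int \<Rightarrow> real \<Rightarrow> complex \<Rightarrow> real" where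
  "ell d \<kappa> y x = lf (angr d \<kappa> y) x"

definition ptf :: "nat \<Rightarrow> int \<Rightarrow> real \<Rightarrow> real \<Rightarrow> complex" where
  "ptf d \<kappa> y z = pt (angr d \<kappa> y) (angr d \<kappa> z)"

definition Tri :: "nat \<Rightarrow> int \<Rightarrow> int \<Rightarrow> int \<Rightarrow> int \<Rightarrow> complex set" where
  "Tri d \<kappa> l m n = triangle (ang d \<kappa> l) (ang d \<kappa> m) (ang d \<kappa> n)"

lemma ang_angr: "ang d \<kappa> n = angr d \<kappa> (of_int n)"
  by (simp add: ang_def angr_def)

lemma sg_minus: "sg d (- z) = - sg d z" by (simp add: sg_def)

context
  fixes d :: nat
  assumes d2: "d > 2"
begin

lemma sin_angr_diff: "sin (angr d \<kappa> y - angr d \<kappa> z) = sg d (y - z)"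
proof -
  have "angr d \<kappa> y - angr d \<kappa> z = (y - z) * pi / real d" using d2 by (simp add: angr_def field_simps)
  then show ?thesis by (simp add: sg_def)
qed

lemma sin_angr_sum: "sin (angr d \<kappa> y + angr d \<kappa> z + angr d \<kappa> t) = sg d (y + z + t - of_int \<kappa>)"
proof -
  have "angr d \<kappa> y + angr d \<kappa> z + angr d \<kappa> t = (y + z + t - of_int \<kappa>) * pi / real d"
    using d2 by (simp add: angr_def field_simps)
  then show ?thesis by (simp add: sg_def)
qed

lemma ell_ptf: "ell d \<kappa> y (ptf d \<kappa> a b) = - 4 * sg d (y - a) * sg d (y - b) * sg d (y + a + b - of_int \<kappa>)"
  unfolding ell_def ptf_def lf_pt sin_angr_diff sin_angr_sum ..

lemma ell_ptf_self [simp]: "ell d \<kappa> a (ptf d \<kappa> a b) = 0" "ell d \<kappa> b (ptf d \<kappa> a b) = 0"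
  by (simp_all add: ell_ptf sg_def)

lemma ell_affine:
  "a + b + c = 1 \<Longrightarrow> ell d \<kappa> y (a *\<^sub>R u + b *\<^sub>R v + c *\<^sub>R w) = a * ell d \<kappa> y u + b * ell d \<kappa> y v + c * ell d \<kappa> y w"
  unfolding ell_def by (rule lf_affine)

lemma ell_zeros_unique:
  assumes "ell d \<kappa> a x = 0" "ell d \<kappa> b x = 0" "ell d \<kappa> a y = 0" "ell d \<kappa> b y = 0" "sg d (a - b) \<noteq> 0"
  shows "x = y"
  using lf_zeros_unique[of "angr d \<kappa> a" x "angr d \<kappa> b" y] assms by (simp add: ell_def sin_angr_diff)

lemma sg_pos: "0 < z \<Longrightarrow> z < real d \<Longrightarrow> 0 < sg d z"
  unfolding sg_def using d2 by (intro sin_gt_zero) (simp_all add: field_simps)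

lemma sg_nonneg: "0 \<le> z \<Longrightarrow> z \<le> real d \<Longrightarrow> 0 \<le> sg d z"
  unfolding sg_def using d2 by (intro sin_ge_zero) (simp_all add: field_simps)

lemma sg_neg: "- real d < z \<Longrightarrow> z < 0 \<Longrightarrow> sg d z < 0"
  using sg_pos[of "- z"] by (simp add: sg_minus)

lemma sg_shift:
  obtains s0 :: real where "s0 = 1 \<or> s0 = - 1" "\<And>z. sg d (z + real d * of_int k) = s0 * sg d z"
proof
  have *: "sg d (z + real d * of_int k) = cos (of_int k * pi) * sg d z" for z
  proof -
    have "(z + real d * of_int k) * pi / real d = z * pi / real d + of_int k * pi"
      using d2 by (simp add: field_simps)
    then show ?thesis by (simp add: sg_def sin_add sin_times_pi_eq_0)
  qed
  then show "\<And>z. sg d (z + real d * of_int k) = cos (of_int k * pi) * sg d z" .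
  show "cos (of_int k * pi) = 1 \<or> cos (of_int k * pi) = - 1"
  proof -
    have "sin (of_int k * pi) = 0" by (simp add: sin_times_pi_eq_0)
    then have "(cos (of_int k * pi))\<^sup>2 = 1" using sin_cos_squared_add[of "of_int k * pi"] by simp
    then show ?thesis by (simp only: power2_eq_1_iff)
  qed
qed

lemma sg_zero_iff: "sg d (of_int n) = 0 \<longleftrightarrow> int d dvd n"
proof
  assume "sg d (of_int n) = 0"
  then obtain i where "of_int n * pi / real d = of_int i * pi"
    unfolding sg_def sin_zero_iff_int2 by blast
  then have "of_int n = real d * of_int i" using d2 by (simp add: field_simps)
  then have "n = int d * i" by (metis of_int_eq_iff of_int_mult of_int_of_nat_eq)
  then show "int d dvd n" by simp
next
  assume "int d dvd n"
  then obtain i where "n = int d * i" by blast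
  then show "sg d (of_int n) = 0" using d2 by (simp add: sg_def sin_times_pi_eq_0)
qed

text \<open>The zeros of \<open>sg d\<close> are the multiples of \<open>d\<close>, so between an
  integer that is no such multiple and its two neighbours the sign cannot change.\<close>

lemma sg_same:
  assumes "\<not> int d dvd k" "\<bar>e\<bar> \<le> 1"
  shows "sg d (of_int k) * sg d (of_int k + e) \<ge> 0"
    and "\<bar>e\<bar> < 1 \<Longrightarrow> sg d (of_int k) * sg d (of_int k + e) > 0"
proof -
  define r where "r = k mod int d"
  have r: "0 < r" "r < int d" using assms(1) d2 pos_mod_sign[of "int d" k] pos_mod_bound[of "int d" k]
    by (auto simp: r_def dvd_eq_mod_eq_0 order_le_less)
  have k: "of_int k = of_int r + real d * of_int (k div int d)"
    unfolding r_def by (metis mod_mult_div_eq of_int_add of_int_mult of_int_of_nat_eq)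
  obtain s0 where s0: "s0 = 1 \<or> s0 = - 1" "\<And>z. sg d (z + real d * of_int (k div int d)) = s0 * sg d z"
    using sg_shift by blast
  have r': "1 \<le> real_of_int r" "real_of_int r \<le> real d - 1"
  proof -
    have "real_of_int 1 \<le> real_of_int r" "real_of_int r \<le> real_of_int (int d - 1)"
      unfolding of_int_le_iff using r by auto
    then show "1 \<le> real_of_int r" "real_of_int r \<le> real d - 1" by simp_all
  qed
  have "sg d (of_int k) * sg d (of_int k + e) = s0 * s0 * (sg d (of_int r) * sg d (of_int r + e))"
    using s0(2)[of "of_int r"] s0(2)[of "of_int r + e"] k by (simp add: add_ac)
  then have *: "sg d (of_int k) * sg d (of_int k + e) = sg d (of_int r) * sg d (of_int r + e)"
    using s0(1) by auto
  show "sg d (of_int k) * sg d (of_int k + e) \<ge> 0" unfolding *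
    using r' assms(2) by (intro mult_nonneg_nonneg sg_nonneg) auto
  show "\<bar>e\<bar> < 1 \<Longrightarrow> sg d (of_int k) * sg d (of_int k + e) > 0" unfolding *
    using r' assms(2) by (intro mult_pos_pos sg_pos) auto
qed

section \<open>Triangles formed by lines of one family\<close>

lemma Tri_iff:
  assumes "\<not> int d dvd l - m" "\<not> int d dvd m - n" "\<not> int d dvd l - n" "\<not> int d dvd l + m + n - \<kappa>"
  shows "\<not> collinear {ptf d \<kappa> m n, ptf d \<kappa> l n, ptf d \<kappa> l m}"
    "Tri d \<kappa> l m n = convex hull {ptf d \<kappa> m n, ptf d \<kappa> l n, ptf d \<kappa> l m}"
    "x \<in> Tri d \<kappa> l m n \<longleftrightarrow> ell d \<kappa> l x * ell d \<kappa> l (ptf d \<kappa> m n) \<ge> 0 \<and>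
        ell d \<kappa> m x * ell d \<kappa> m (ptf d \<kappa> l n) \<ge> 0 \<and> ell d \<kappa> n x * ell d \<kappa> n (ptf d \<kappa> l m) \<ge> 0"
    "x \<in> interior (Tri d \<kappa> l m n) \<longleftrightarrow> ell d \<kappa> l x * ell d \<kappa> l (ptf d \<kappa> m n) > 0 \<and>
        ell d \<kappa> m x * ell d \<kappa> m (ptf d \<kappa> l n) > 0 \<and> ell d \<kappa> n x * ell d \<kappa> n (ptf d \<kappa> l m) > 0"
proof -
  have "sin (ang d \<kappa> l - ang d \<kappa> m) \<noteq> 0" "sin (ang d \<kappa> m - ang d \<kappa> n) \<noteq> 0" "sin (ang d \<kappa> l - ang d \<kappa> n) \<noteq> 0"
     "sin (ang d \<kappa> l + ang d \<kappa> m + ang d \<kappa> n) \<noteq> 0"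
    unfolding ang_angr sin_angr_diff sin_angr_sum of_int_diff[symmetric] of_int_add[symmetric] sg_zero_iff
    using assms by simp_all
  note T = triangle_iff[OF this, folded Tri_def, unfolded ang_angr, folded ptf_def ell_def]
  show "\<not> collinear {ptf d \<kappa> m n, ptf d \<kappa> l n, ptf d \<kappa> l m}" by (rule T(1))
  show "Tri d \<kappa> l m n = convex hull {ptf d \<kappa> m n, ptf d \<kappa> l n, ptf d \<kappa> l m}" by (rule T(2))
  show "x \<in> Tri d \<kappa> l m n \<longleftrightarrow> ell d \<kappa> l x * ell d \<kappa> l (ptf d \<kappa> m n) \<ge> 0 \<and>
        ell d \<kappa> m x * ell d \<kappa> m (ptf d \<kappa> l n) \<ge> 0 \<and> ell d \<kappa> n x * ell d \<kappa> n (ptf d \<kappa> l m) \<ge> 0" by (rule T(3))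
  show "x \<in> interior (Tri d \<kappa> l m n) \<longleftrightarrow> ell d \<kappa> l x * ell d \<kappa> l (ptf d \<kappa> m n) > 0 \<and>
        ell d \<kappa> m x * ell d \<kappa> m (ptf d \<kappa> l n) > 0 \<and> ell d \<kappa> n x * ell d \<kappa> n (ptf d \<kappa> l m) > 0" by (rule T(4))
qed

text \<open>Non-concurrency follows from the congruence: at a common point one factor of
  \<open>ell_ptf\<close> would vanish, but the index differences are excluded and the index sum is
  congruent to \<kappa> + \<sigma>, not to \<kappa>.\<close>

lemma elementary_iff:
  "elementary d \<kappa> \<sigma> l m n \<longleftrightarrow> (\<sigma> = 1 \<or> \<sigma> = - 1) \<and> \<not> int d dvd l - m \<and> \<not> int d dvd m - n \<and> \<not> int d dvd l - n
     \<and> int d dvd l + m + n - (\<kappa> + \<sigma>)"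
proof -
  have "Gfam d \<kappa> l \<inter> Gfam d \<kappa> m \<inter> Gfam d \<kappa> n = {}"
    if \<sigma>: "\<sigma> = 1 \<or> \<sigma> = - 1" and a: "\<not> int d dvd l - m" "\<not> int d dvd m - n" "\<not> int d dvd l - n" "int d dvd l + m + n - (\<kappa> + \<sigma>)"
  proof (rule ccontr)
    assume "Gfam d \<kappa> l \<inter> Gfam d \<kappa> m \<inter> Gfam d \<kappa> n \<noteq> {}"
    then obtain x where x: "ell d \<kappa> l x = 0" "ell d \<kappa> m x = 0" "ell d \<kappa> n x = 0"
      unfolding Gfam_def ang_angr ell_def using lf_zero_on_G by blast
    have "sg d (of_int l - of_int m) \<noteq> 0" using a(1) sg_zero_iff[of "l - m"] by simp
    with x have "x = ptf d \<kappa> l m" by (intro ell_zeros_unique[of \<kappa> l x m]) simp_all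
    with x(3) have "sg d (of_int (n - l)) * sg d (of_int (n - m)) * sg d (of_int (n + l + m - \<kappa>)) = 0"
      by (simp add: ell_ptf)
    then have "int d dvd n - l \<or> int d dvd n - m \<or> int d dvd n + l + m - \<kappa>" unfolding mult_eq_0_iff sg_zero_iff by blast
    then have "int d dvd n + l + m - \<kappa>" using a(2,3) by (metis dvd_minus_iff minus_diff_eq)
    then have "int d dvd (n + l + m - \<kappa>) - (l + m + n - (\<kappa> + \<sigma>))" using a(4) dvd_diff by blast
    then have "int d dvd \<sigma>" by simp
    then show False using \<sigma> d2 by auto
  qed
  then show ?thesis unfolding elementary_def by (auto simp: cong_iff_dvd_diff)
qed

lemma elementary_Tri:
  assumes "elementary d \<kappa> \<sigma> l m n"
  shows "\<not> int d dvd l - m" "\<not> int d dvd m - n" "\<not> int d dvd l - n" "\<not> int d dvd l + m + n - \<kappa>"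
proof -
  note e = assms[unfolded elementary_iff]
  show "\<not> int d dvd l - m" "\<not> int d dvd m - n" "\<not> int d dvd l - n" using e by auto
  show "\<not> int d dvd l + m + n - \<kappa>"
  proof
    assume "int d dvd l + m + n - \<kappa>"
    then have "int d dvd (l + m + n - \<kappa>) - (l + m + n - (\<kappa> + \<sigma>))" using e dvd_diff by blast
    then have "int d dvd \<sigma>" by simp
    then show False using e d2 by auto
  qed
qed

text \<open>The point with parameters \<open>y1\<close>, \<open>y2\<close> also lies on a third line \<open>y3\<close> (as \<open>y1 + y2 + y3\<close>
  is congruent to \<open>\<kappa>\<close>), and \<open>ell\<close> factors over the three parameters.\<close>

lemma ell_ptf3:
  assumes "int d dvd k - \<kappa>"
  obtains s0 :: real where "s0 \<noteq> 0"
    "\<And>z y1 y2 y3. y1 + y2 + y3 = of_int k \<Longrightarrow>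
       ell d \<kappa> z (ptf d \<kappa> y1 y2) = s0 * (sg d (z - y1) * sg d (z - y2) * sg d (z - y3))"
proof -
  obtain N where "k - \<kappa> = int d * N" using assms by blast
  then have N: "of_int k - of_int \<kappa> = real d * of_int N" by (metis of_int_diff of_int_mult of_int_of_nat_eq)
  obtain s1 where s1: "s1 = 1 \<or> s1 = - 1" "\<And>z. sg d (z + real d * of_int N) = s1 * sg d z"
    using sg_shift by blast
  show ?thesis
  proof (rule that[of "- 4 * s1"])
    show "- 4 * s1 \<noteq> 0" using s1 by auto
    fix z y1 y2 y3 :: real assume "y1 + y2 + y3 = of_int k"
    then have h: "z + y1 + y2 - of_int \<kappa> = (z - y3) + real d * of_int N" using N by simp
    show "ell d \<kappa> z (ptf d \<kappa> y1 y2) = - 4 * s1 * (sg d (z - y1) * sg d (z - y2) * sg d (z - y3))"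
      unfolding ell_ptf h s1(2) by simp
  qed
qed

text \<open>No line of the family runs through the interior of an elementary triangle. The vertex
  opposite to the line \<open>l\<close> has the third parameter \<open>l - \<sigma>\<close>; so each
  vertex value arises from one fixed product of sines at \<open>z - l\<close>, \<open>z - m\<close>,
  \<open>z - n\<close> by moving one argument to a neighbouring integer, which cannot reverse the
  sign. The number \<open>P\<close> carries the common sign.\<close>

lemma elementary_uncut:
  assumes e: "elementary d \<kappa> \<sigma> l m n"
  obtains P where "P \<noteq> 0" "\<And>x. x \<in> Tri d \<kappa> l m n \<Longrightarrow> P * ell d \<kappa> (of_int z) x \<ge> 0"
    "\<lbrakk>\<not> int d dvd z - l; \<not> int d dvd z - m; \<not> int d dvd z - n\<rbrakk> \<Longrightarrow>
      P * ell d \<kappa> (of_int z) (ptf d \<kappa> m n) \<ge> 0 \<and> P * ell d \<kappa> (of_int z) (ptf d \<kappa> l n) \<ge> 0 \<and>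
      P * ell d \<kappa> (of_int z) (ptf d \<kappa> l m) \<ge> 0 \<and>
      (ell d \<kappa> (of_int z) (ptf d \<kappa> m n) = 0 \<longleftrightarrow> int d dvd z - l + \<sigma>) \<and>
      (ell d \<kappa> (of_int z) (ptf d \<kappa> l n) = 0 \<longleftrightarrow> int d dvd z - m + \<sigma>) \<and>
      (ell d \<kappa> (of_int z) (ptf d \<kappa> l m) = 0 \<longleftrightarrow> int d dvd z - n + \<sigma>)"
proof -
  have \<sigma>: "\<sigma> = 1 \<or> \<sigma> = -1" and "int d dvd l + m + n - (\<kappa> + \<sigma>)" using e by (auto simp: elementary_iff)
  then have "int d dvd (l + m + n - \<sigma>) - \<kappa>" by (simp add: algebra_simps)
  then obtain s0 where s0: "s0 \<noteq> 0" "\<And>z y1 y2 y3. y1 + y2 + y3 = of_int (l + m + n - \<sigma>) \<Longrightarrow>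
       ell d \<kappa> z (ptf d \<kappa> y1 y2) = s0 * (sg d (z - y1) * sg d (z - y2) * sg d (z - y3))" using ell_ptf3 by blast
  define zl zm zn where "zl = sg d (of_int (z - l))" "zm = sg d (of_int (z - m))" "zn = sg d (of_int (z - n))"
  define wl wm wn where "wl = sg d (of_int (z - l) + of_int \<sigma>)" "wm = sg d (of_int (z - m) + of_int \<sigma>)" "wn = sg d (of_int (z - n) + of_int \<sigma>)"
  note defs = zl_zm_zn_def wl_wm_wn_def
  have v: "ell d \<kappa> z (ptf d \<kappa> m n) = s0 * (zm * zn * wl)" "ell d \<kappa> z (ptf d \<kappa> l n) = s0 * (zl * zn * wm)"
     "ell d \<kappa> z (ptf d \<kappa> l m) = s0 * (zl * zm * wn)"
    using s0(2)[of m n "l - \<sigma>" z] s0(2)[of l n "m - \<sigma>" z] s0(2)[of l m "n - \<sigma>" z]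
    by (simp_all add: defs algebra_simps)
  have z0: "zl = 0 \<longleftrightarrow> int d dvd z - l" "zm = 0 \<longleftrightarrow> int d dvd z - m" "zn = 0 \<longleftrightarrow> int d dvd z - n"
    "wl = 0 \<longleftrightarrow> int d dvd z - l + \<sigma>" "wm = 0 \<longleftrightarrow> int d dvd z - m + \<sigma>" "wn = 0 \<longleftrightarrow> int d dvd z - n + \<sigma>"
    unfolding defs of_int_add[symmetric] sg_zero_iff by simp_all
  have conv: "P * ell d \<kappa> z x \<ge> 0" if "P * ell d \<kappa> z (ptf d \<kappa> m n) \<ge> 0" "P * ell d \<kappa> z (ptf d \<kappa> l n) \<ge> 0"
     "P * ell d \<kappa> z (ptf d \<kappa> l m) \<ge> 0" "x \<in> Tri d \<kappa> l m n" for P x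
  proof -
    from that(4) obtain a b c where abc: "0 \<le> a" "0 \<le> b" "0 \<le> c" "a + b + c = 1"
      "x = a *\<^sub>R ptf d \<kappa> m n + b *\<^sub>R ptf d \<kappa> l n + c *\<^sub>R ptf d \<kappa> l m"
      unfolding Tri_iff(2)[OF elementary_Tri[OF e]] convex_hull_3 by blast
    have "P * ell d \<kappa> z x = a * (P * ell d \<kappa> z (ptf d \<kappa> m n)) + b * (P * ell d \<kappa> z (ptf d \<kappa> l n)) + c * (P * ell d \<kappa> z (ptf d \<kappa> l m))"
      unfolding abc(5) ell_affine[OF abc(4)] by (simp add: algebra_simps)
    then show ?thesis using abc that by simp
  qed
  show ?thesis
  proof (cases "int d dvd z - l \<or> int d dvd z - m \<or> int d dvd z - n")
    case True
    then have "zl = 0 \<or> zm = 0 \<or> zn = 0" using z0 by simp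
    then have two: "(ell d \<kappa> z (ptf d \<kappa> m n) = 0 \<and> ell d \<kappa> z (ptf d \<kappa> l n) = 0) \<or>
      (ell d \<kappa> z (ptf d \<kappa> m n) = 0 \<and> ell d \<kappa> z (ptf d \<kappa> l m) = 0) \<or>
      (ell d \<kappa> z (ptf d \<kappa> l n) = 0 \<and> ell d \<kappa> z (ptf d \<kappa> l m) = 0)" unfolding v by auto
    \<comment> \<open>A side contains two of the vertices, so the sum of the three values is the
      value at the remaining one.\<close>
    define P :: real where "P = (if ell d \<kappa> z (ptf d \<kappa> m n) + ell d \<kappa> z (ptf d \<kappa> l n) + ell d \<kappa> z (ptf d \<kappa> l m) \<ge> 0 then 1 else - 1)"
    show ?thesis
    proof (rule that[of P])
      show "P \<noteq> 0" by (simp add: P_def)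
      show "P * ell d \<kappa> z x \<ge> 0" if "x \<in> Tri d \<kappa> l m n" for x
        by (rule conv[OF _ _ _ that]) (use two in \<open>auto simp: P_def\<close>)
    qed (use True in blast)
  next
    case False
    then have nz: "zl \<noteq> 0" "zm \<noteq> 0" "zn \<noteq> 0" using z0 by auto
    define P where "P = s0 * (zl * zm * zn)"
    have abs1: "\<bar>real_of_int \<sigma>\<bar> \<le> 1" using \<sigma> by auto
    have ss: "zl * wl \<ge> 0" "zm * wm \<ge> 0" "zn * wn \<ge> 0"
      unfolding defs using False abs1 by (blast intro: sg_same(1))+
    have "P * ell d \<kappa> z (ptf d \<kappa> m n) = (s0 * zm * zn)\<^sup>2 * (zl * wl)" "P * ell d \<kappa> z (ptf d \<kappa> l n) = (s0 * zl * zn)\<^sup>2 * (zm * wm)"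
      "P * ell d \<kappa> z (ptf d \<kappa> l m) = (s0 * zl * zm)\<^sup>2 * (zn * wn)"
      unfolding v P_def by (simp_all add: power2_eq_square algebra_simps)
    then have v0: "P * ell d \<kappa> z (ptf d \<kappa> m n) \<ge> 0" "P * ell d \<kappa> z (ptf d \<kappa> l n) \<ge> 0" "P * ell d \<kappa> z (ptf d \<kappa> l m) \<ge> 0"
      using ss by (metis mult_nonneg_nonneg zero_le_power2)+
    show ?thesis
    proof (rule that[of P])
      show "P \<noteq> 0" using nz s0(1) by (simp add: P_def)
      show "P * ell d \<kappa> z x \<ge> 0" if "x \<in> Tri d \<kappa> l m n" for x
        by (rule conv[OF v0 that])
    qed (use v0 z0 nz s0(1) in \<open>simp add: v\<close>)
  qed
qed

text \<open>A line other than the three sides vanishes at one vertex at most, since two zeros would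
  make two indices congruent. As the vertex values have one common sign, a convex combination with
  value zero is concentrated in that vertex.\<close>

lemma elementary_edge_lines:
  assumes e: "elementary d \<kappa> \<sigma> l m n" and xy: "x \<in> Tri d \<kappa> l m n" "y \<in> Tri d \<kappa> l m n" "x \<noteq> y"
    and z: "ell d \<kappa> (of_int z) x = 0" "ell d \<kappa> (of_int z) y = 0"
  shows "int d dvd z - l \<or> int d dvd z - m \<or> int d dvd z - n"
proof (rule ccontr)
  assume c: "\<not> ?thesis"
  define V1 V2 V3 where "V1 = ptf d \<kappa> m n" "V2 = ptf d \<kappa> l n" "V3 = ptf d \<kappa> l m"
  note V = V1_V2_V3_def
  obtain P where P: "P \<noteq> 0" "P * ell d \<kappa> z V1 \<ge> 0" "P * ell d \<kappa> z V2 \<ge> 0" "P * ell d \<kappa> z V3 \<ge> 0"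
     "ell d \<kappa> z V1 = 0 \<longleftrightarrow> int d dvd z - l + \<sigma>" "ell d \<kappa> z V2 = 0 \<longleftrightarrow> int d dvd z - m + \<sigma>"
     "ell d \<kappa> z V3 = 0 \<longleftrightarrow> int d dvd z - n + \<sigma>"
    unfolding V using elementary_uncut[OF e, of z] c by metis
  have nd: "\<not> (int d dvd z - a + \<sigma> \<and> int d dvd z - b + \<sigma>)" if "\<not> int d dvd a - b" for a b
  proof
    assume "int d dvd z - a + \<sigma> \<and> int d dvd z - b + \<sigma>"
    then have "int d dvd (z - b + \<sigma>) - (z - a + \<sigma>)" using dvd_diff by blast
    then show False using that by simp
  qed
  have two: "(ell d \<kappa> z V2 \<noteq> 0 \<and> ell d \<kappa> z V3 \<noteq> 0) \<or> (ell d \<kappa> z V1 \<noteq> 0 \<and> ell d \<kappa> z V3 \<noteq> 0) \<or> (ell d \<kappa> z V1 \<noteq> 0 \<and> ell d \<kappa> z V2 \<noteq> 0)"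
    using nd[of l m] nd[of m n] nd[of l n] elementary_Tri[OF e] P(5-7) by blast
  have k: "(ell d \<kappa> z V1 \<noteq> 0 \<longrightarrow> a = 0) \<and> (ell d \<kappa> z V2 \<noteq> 0 \<longrightarrow> b = 0) \<and> (ell d \<kappa> z V3 \<noteq> 0 \<longrightarrow> c = 0)"
    if "0 \<le> a" "0 \<le> b" "0 \<le> c" "a + b + c = 1" "ell d \<kappa> z (a *\<^sub>R V1 + b *\<^sub>R V2 + c *\<^sub>R V3) = 0" for a b c :: real
  proof -
    have "a * (P * ell d \<kappa> z V1) + b * (P * ell d \<kappa> z V2) + c * (P * ell d \<kappa> z V3) = P * ell d \<kappa> z (a *\<^sub>R V1 + b *\<^sub>R V2 + c *\<^sub>R V3)"
      unfolding ell_affine[OF that(4)] by (simp add: algebra_simps)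
    then have "a * (P * ell d \<kappa> z V1) + b * (P * ell d \<kappa> z V2) + c * (P * ell d \<kappa> z V3) = 0" using that by simp
    moreover have "a * (P * ell d \<kappa> z V1) \<ge> 0" "b * (P * ell d \<kappa> z V2) \<ge> 0" "c * (P * ell d \<kappa> z V3) \<ge> 0"
      using that P by simp_all
    ultimately have "a * (P * ell d \<kappa> z V1) = 0" "b * (P * ell d \<kappa> z V2) = 0" "c * (P * ell d \<kappa> z V3) = 0" by linarith+
    then show ?thesis using P(1) by auto
  qed
  obtain a b c where abc: "0 \<le> a" "0 \<le> b" "0 \<le> c" "a + b + c = 1" "x = a *\<^sub>R V1 + b *\<^sub>R V2 + c *\<^sub>R V3"
    using xy(1) unfolding Tri_iff(2)[OF elementary_Tri[OF e]] convex_hull_3 V by blast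
  obtain a' b' c' where abc': "0 \<le> a'" "0 \<le> b'" "0 \<le> c'" "a' + b' + c' = 1" "y = a' *\<^sub>R V1 + b' *\<^sub>R V2 + c' *\<^sub>R V3"
    using xy(2) unfolding Tri_iff(2)[OF elementary_Tri[OF e]] convex_hull_3 V by blast
  have "a = a' \<and> b = b' \<and> c = c'"
    using k[OF abc(1-4)] k[OF abc'(1-4)] z abc abc' two by auto
  then show False using abc(5) abc'(5) xy(3) by simp
qed

lemma sign_transfer: "p \<noteq> 0 \<Longrightarrow> p * x \<ge> 0 \<Longrightarrow> p * y \<ge> 0 \<Longrightarrow> x * e > 0 \<Longrightarrow> y * e \<ge> 0" for p x y e :: real
  by (auto simp: zero_le_mult_iff zero_less_mult_iff)

text \<open>The sides of the larger triangle are lines of the family and do not cut the elementary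
  one, so a single common point decides on which side all its points lie.\<close>

lemma elementary_subset:
  assumes e: "elementary d \<kappa> \<sigma> l m n"
    and B: "\<not> int d dvd l' - m'" "\<not> int d dvd m' - n'" "\<not> int d dvd l' - n'" "\<not> int d dvd l' + m' + n' - \<kappa>"
    and x: "x \<in> Tri d \<kappa> l m n" "x \<in> interior (Tri d \<kappa> l' m' n')"
  shows "Tri d \<kappa> l m n \<subseteq> Tri d \<kappa> l' m' n'"
proof
  fix y assume y: "y \<in> Tri d \<kappa> l m n"
  have "ell d \<kappa> z y * t \<ge> 0" if "ell d \<kappa> z x * t > 0" for z :: int and t
  proof -
    obtain P where P: "P \<noteq> 0" "\<And>x. x \<in> Tri d \<kappa> l m n \<Longrightarrow> P * ell d \<kappa> (of_int z) x \<ge> 0"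
      using elementary_uncut[OF e, of z] by blast
    show ?thesis by (rule sign_transfer[OF P(1) P(2)[OF x(1)] P(2)[OF y] that])
  qed
  then show "y \<in> Tri d \<kappa> l' m' n'" using x(2) unfolding Tri_iff(3,4)[OF B] by blast
qed

text \<open>Each side line of the inner triangle contains two of its vertices, hence two points of
  the outer triangle, and must be a side line of that one.\<close>

lemma elementary_Tri_eq_residues:
  assumes e: "elementary d \<kappa> \<sigma> l m n" and e': "elementary d \<kappa> \<sigma>' l' m' n'"
    and eq: "Tri d \<kappa> l' m' n' \<subseteq> Tri d \<kappa> l m n"
  shows "(\<lambda>j. j mod int d) ` {l', m', n'} \<subseteq> (\<lambda>j. j mod int d) ` {l, m, n}"
proof -
  let ?V1 = "ptf d \<kappa> m' n'" and ?V2 = "ptf d \<kappa> l' n'" and ?V3 = "ptf d \<kappa> l' m'"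
  note T = Tri_iff[OF elementary_Tri[OF e']]
  have in_T: "?V1 \<in> Tri d \<kappa> l m n" "?V2 \<in> Tri d \<kappa> l m n" "?V3 \<in> Tri d \<kappa> l m n"
    using eq unfolding T(2) by (auto intro: hull_inc)
  have ne: "?V1 \<noteq> ?V2" "?V1 \<noteq> ?V3" "?V2 \<noteq> ?V3" using T(1) by (auto simp: insert_commute)
  have *: "j mod int d \<in> (\<lambda>j. j mod int d) ` {l, m, n}" if "int d dvd j - l \<or> int d dvd j - m \<or> int d dvd j - n" for j
    using that by (auto simp: mod_eq_dvd_iff)
  show ?thesis
    using elementary_edge_lines[OF e in_T(2,3) ne(3), of l'] elementary_edge_lines[OF e in_T(1,3) ne(2), of m']
      elementary_edge_lines[OF e in_T(1,2) ne(1), of n'] * by simp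
qed

text \<open>Overlap gives inclusion in both directions. The residues of the indices then agree, and
  their sum modulo \<open>d\<close> reveals the sign, because \<open>d > 2\<close> separates 1 from
  -1.\<close>

lemma elementary_overlap:
  assumes e: "elementary d \<kappa> \<sigma> l m n" and e': "elementary d \<kappa> \<sigma>' l' m' n'"
    and "interior (Tri d \<kappa> l m n) \<inter> interior (Tri d \<kappa> l' m' n') \<noteq> {}"
  shows "Tri d \<kappa> l m n = Tri d \<kappa> l' m' n'" "\<sigma> = \<sigma>'"
     "(\<lambda>j. j mod int d) ` {l, m, n} = (\<lambda>j. j mod int d) ` {l', m', n'}"
proof -
  obtain x where x: "x \<in> interior (Tri d \<kappa> l m n)" "x \<in> interior (Tri d \<kappa> l' m' n')" using assms(3) by blast
  show eq: "Tri d \<kappa> l m n = Tri d \<kappa> l' m' n'"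
    using elementary_subset[OF e elementary_Tri[OF e'] _ x(2)] elementary_subset[OF e' elementary_Tri[OF e] _ x(1)]
      x interior_subset by blast
  show res: "(\<lambda>j. j mod int d) ` {l, m, n} = (\<lambda>j. j mod int d) ` {l', m', n'}"
    using elementary_Tri_eq_residues[OF e e'] elementary_Tri_eq_residues[OF e' e] eq by blast
  have sum: "int d dvd \<Sum>((\<lambda>j. j mod int d) ` {a, b, c}) - (\<kappa> + \<tau>)" if "elementary d \<kappa> \<tau> a b c" for \<tau> a b c
  proof -
    have "a mod int d \<noteq> b mod int d" "b mod int d \<noteq> c mod int d" "a mod int d \<noteq> c mod int d"
      using elementary_Tri[OF that] by (auto simp: mod_eq_dvd_iff)
    then have "\<Sum>((\<lambda>j. j mod int d) ` {a, b, c}) = a mod int d + b mod int d + c mod int d" by simp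
    moreover have "(a mod int d + b mod int d + c mod int d) mod int d = (a + b + c) mod int d"
      by (intro mod_add_cong) simp_all
    moreover have "(a + b + c) mod int d = (\<kappa> + \<tau>) mod int d" using that unfolding elementary_iff mod_eq_dvd_iff by blast
    ultimately show ?thesis unfolding mod_eq_dvd_iff[symmetric] by simp
  qed
  have "int d dvd (\<kappa> + \<sigma>') - (\<kappa> + \<sigma>)" using dvd_diff[OF sum[OF e] sum[OF e']] unfolding res by simp
  then have "int d dvd \<sigma>' - \<sigma>" by simp
  moreover have "\<bar>\<sigma>' - \<sigma>\<bar> < int d" using e e' d2 by (auto simp: elementary_iff)
  ultimately show "\<sigma> = \<sigma>'" using dvd_imp_le_int[of "\<sigma>' - \<sigma>" "int d"] by auto
qed

end

section \<open>Dissection of a triangle into elementary triangles\<close>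

text \<open>The level \<open>M\<close> is the amount by which the index sum falls short of \<kappa>
  modulo \<open>d\<close>: level 1 is an elementary triangle of sign -1, level \<open>d - 1\<close>
  one of sign 1. The gaps between consecutive lines, taken cyclically, are the angles in units of
  \<open>\<pi> / d\<close>.\<close>

definition frame :: "nat \<Rightarrow> int \<Rightarrow> int \<Rightarrow> int \<Rightarrow> int \<Rightarrow> int \<Rightarrow> bool" where
  "frame d \<kappa> M \<alpha> \<beta> \<gamma> \<longleftrightarrow> \<alpha> < \<beta> \<and> \<beta> < \<gamma> \<and> \<gamma> < \<alpha> + int d \<and> 0 < M \<and> M < int d \<and>
     int d dvd \<alpha> + \<beta> + \<gamma> + M - \<kappa>"

text \<open>The elementary triangles into which a frame is cut: their lines are \<open>\<alpha> + i, \<beta> + j, \<gamma> + k\<close>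
  if the sign is \<open>-1\<close>, and these indices increased by one if the sign is \<open>1\<close>.\<close>

definition child :: "int \<Rightarrow> int \<Rightarrow> int \<Rightarrow> int \<Rightarrow> int \<Rightarrow> int \<Rightarrow> int \<Rightarrow> int \<Rightarrow> bool" where
  "child M a b c \<tau> i j k \<longleftrightarrow> (\<tau> = 1 \<or> \<tau> = -1) \<and> 0 \<le> i \<and> i < a \<and> 0 \<le> j \<and> j < b \<and> 0 \<le> k \<and> k < c \<and>
     i + j + k = (if \<tau> = 1 then M - 2 else M - 1)"

definition up :: "int \<Rightarrow> int" where "up \<tau> = (if \<tau> = 1 then 1 else 0)"

context
  fixes d :: nat
  assumes d2: "d > 2"
begin

lemma not_dvd_diff: "a < b \<Longrightarrow> b < a + int d \<Longrightarrow> \<not> int d dvd a - b" for a b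
  using zdvd_imp_le[of "int d" "b - a"] by (auto simp: dvd_diff_commute)

lemma frame_Tri:
  assumes "frame d \<kappa> M \<alpha> \<beta> \<gamma>"
  shows "\<not> int d dvd \<alpha> - \<beta>" "\<not> int d dvd \<beta> - \<gamma>" "\<not> int d dvd \<alpha> - \<gamma>" "\<not> int d dvd \<alpha> + \<beta> + \<gamma> - \<kappa>"
proof -
  show "\<not> int d dvd \<alpha> - \<beta>" "\<not> int d dvd \<beta> - \<gamma>" "\<not> int d dvd \<alpha> - \<gamma>"
    using assms not_dvd_diff[of \<alpha> \<beta>] not_dvd_diff[of \<beta> \<gamma>] not_dvd_diff[of \<alpha> \<gamma>] by (auto simp: frame_def)
  show "\<not> int d dvd \<alpha> + \<beta> + \<gamma> - \<kappa>"
  proof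
    assume "int d dvd \<alpha> + \<beta> + \<gamma> - \<kappa>"
    then have "int d dvd (\<alpha> + \<beta> + \<gamma> + M - \<kappa>) - (\<alpha> + \<beta> + \<gamma> - \<kappa>)" using assms dvd_diff unfolding frame_def by blast
    then show False using assms zdvd_imp_le[of "int d" M] by (simp add: frame_def)
  qed
qed

text \<open>In a frame the sines of all index differences have known signs, and the third parameter
  of each vertex contributes \<open>sg d (- M)\<close>; the inequalities of \<open>Tri_iff\<close>
  thus become one fixed sign pattern.\<close>

lemma frame_interior_iff:
  assumes f: "frame d \<kappa> M \<alpha> \<beta> \<gamma>"
  obtains s0 :: real where "s0 \<noteq> 0"
    "\<And>z y1 y2 y3. y1 + y2 + y3 = of_int (\<alpha> + \<beta> + \<gamma> + M) \<Longrightarrow>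
       ell d \<kappa> z (ptf d \<kappa> y1 y2) = s0 * (sg d (z - y1) * sg d (z - y2) * sg d (z - y3))"
    "\<And>x. x \<in> interior (Tri d \<kappa> \<alpha> \<beta> \<gamma>) \<longleftrightarrow>
      s0 * ell d \<kappa> \<alpha> x < 0 \<and> s0 * ell d \<kappa> \<beta> x > 0 \<and> s0 * ell d \<kappa> \<gamma> x < 0"
proof -
  have "int d dvd (\<alpha> + \<beta> + \<gamma> + M) - \<kappa>" using f by (simp add: frame_def)
  then obtain s0 where s0: "s0 \<noteq> 0"
    "\<And>z y1 y2 y3. y1 + y2 + y3 = of_int (\<alpha> + \<beta> + \<gamma> + M) \<Longrightarrow>
       ell d \<kappa> z (ptf d \<kappa> y1 y2) = s0 * (sg d (z - y1) * sg d (z - y2) * sg d (z - y3))"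
    using ell_ptf3[OF d2] by blast
  have r: "real_of_int \<alpha> < \<beta>" "real_of_int \<beta> < \<gamma>" "real_of_int \<gamma> < \<alpha> + real d" "0 < real_of_int M" "real_of_int M < real d"
    using f by (simp_all add: frame_def)
  have n: "sg d (\<alpha> - \<beta>) < 0" "sg d (\<alpha> - \<gamma>) < 0" "sg d (\<beta> - \<gamma>) < 0" "sg d (- M) < 0"
      "sg d (\<beta> - \<alpha>) > 0" "sg d (\<gamma> - \<alpha>) > 0" "sg d (\<gamma> - \<beta>) > 0"
    using r by (auto intro!: sg_neg[OF d2] sg_pos[OF d2])
  have v: "ell d \<kappa> \<alpha> (ptf d \<kappa> \<beta> \<gamma>) = s0 * (sg d (\<alpha> - \<beta>) * sg d (\<alpha> - \<gamma>) * sg d (- M))"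
    "ell d \<kappa> \<beta> (ptf d \<kappa> \<alpha> \<gamma>) = s0 * (sg d (\<beta> - \<alpha>) * sg d (\<beta> - \<gamma>) * sg d (- M))"
    "ell d \<kappa> \<gamma> (ptf d \<kappa> \<alpha> \<beta>) = s0 * (sg d (\<gamma> - \<alpha>) * sg d (\<gamma> - \<beta>) * sg d (- M))"
    using s0(2)[of \<beta> \<gamma> "\<alpha> + M" \<alpha>] s0(2)[of \<alpha> \<gamma> "\<beta> + M" \<beta>] s0(2)[of \<alpha> \<beta> "\<gamma> + M" \<gamma>] by simp_all
  have n3: "sg d (\<alpha> - \<beta>) * sg d (\<alpha> - \<gamma>) * sg d (- M) < 0" "sg d (\<beta> - \<alpha>) * sg d (\<beta> - \<gamma>) * sg d (- M) > 0"
      "sg d (\<gamma> - \<alpha>) * sg d (\<gamma> - \<beta>) * sg d (- M) < 0"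
    using n by (simp_all add: mult_less_0_iff zero_less_mult_iff)
  have neg: "e * (s0 * t) > 0 \<longleftrightarrow> s0 * e < 0" if "t < 0" for e t
    using that by (auto simp: mult_less_0_iff zero_less_mult_iff)
  have pos: "e * (s0 * t) > 0 \<longleftrightarrow> s0 * e > 0" if "t > 0" for e t
    using that by (auto simp: mult_less_0_iff zero_less_mult_iff)
  show ?thesis
    by (rule that[OF s0]) (simp_all only: Tri_iff(4)[OF d2 frame_Tri[OF f]] v neg[OF n3(1)] neg[OF n3(3)] pos[OF n3(2)])
qed

text \<open>One parameter in each gap between consecutive lines fixes the signs of all nine sine
  factors, and they produce the pattern of \<open>frame_interior_iff\<close>.\<close>

lemma frame_param_interior:
  fixes y1 y2 y3 :: real
  assumes f: "frame d \<kappa> M \<alpha> \<beta> \<gamma>" and y: "\<alpha> < y1" "y1 < \<beta>" "\<beta> < y2" "y2 < \<gamma>" "\<gamma> < y3" "y3 < \<alpha> + int d"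
     "y1 + y2 + y3 = of_int (\<alpha> + \<beta> + \<gamma> + M)"
  shows "ptf d \<kappa> y1 y2 \<in> interior (Tri d \<kappa> \<alpha> \<beta> \<gamma>)"
proof -
  have r: "real_of_int \<alpha> < \<beta>" "real_of_int \<beta> < \<gamma>" "real_of_int \<gamma> < \<alpha> + real d" "y3 < \<alpha> + real d"
    using f y by (simp_all add: frame_def)
  have sq: "s0 * (s0 * t) < 0" if "t < 0" "s0 \<noteq> 0" for s0 t :: real
    using that by (auto simp: mult_less_0_iff zero_less_mult_iff)
  have sp: "s0 * (s0 * t) > 0" if "t > 0" "s0 \<noteq> 0" for s0 t :: real
    using that by (auto simp: mult_less_0_iff zero_less_mult_iff)
  have "sg d (\<alpha> - y1) < 0" "sg d (\<alpha> - y2) < 0" "sg d (\<alpha> - y3) < 0" "sg d (\<beta> - y1) > 0" "sg d (\<beta> - y2) < 0" "sg d (\<beta> - y3) < 0"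
     "sg d (\<gamma> - y1) > 0" "sg d (\<gamma> - y2) > 0" "sg d (\<gamma> - y3) < 0"
    using r y by (auto intro!: sg_neg[OF d2] sg_pos[OF d2])
  then have "sg d (\<alpha> - y1) * sg d (\<alpha> - y2) * sg d (\<alpha> - y3) < 0" "sg d (\<beta> - y1) * sg d (\<beta> - y2) * sg d (\<beta> - y3) > 0"
     "sg d (\<gamma> - y1) * sg d (\<gamma> - y2) * sg d (\<gamma> - y3) < 0"
    by (simp_all add: mult_less_0_iff zero_less_mult_iff)
  note t = this
  obtain s0 where s0: "s0 \<noteq> 0"
    "\<And>z y1 y2 y3. y1 + y2 + y3 = of_int (\<alpha> + \<beta> + \<gamma> + M) \<Longrightarrow>
       ell d \<kappa> z (ptf d \<kappa> y1 y2) = s0 * (sg d (z - y1) * sg d (z - y2) * sg d (z - y3))"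
     "\<And>x. x \<in> interior (Tri d \<kappa> \<alpha> \<beta> \<gamma>) \<longleftrightarrow>
      s0 * ell d \<kappa> \<alpha> x < 0 \<and> s0 * ell d \<kappa> \<beta> x > 0 \<and> s0 * ell d \<kappa> \<gamma> x < 0"
    using frame_interior_iff[OF f] by blast
  show ?thesis
    unfolding s0(3) s0(2)[OF y(7)] by (intro conjI sq sp t s0(1))
qed

lemma continuous_ell: "continuous_on A (\<lambda>y. ell d \<kappa> y x)"
  unfolding ell_def lf_def angr_def using d2 by (intro continuous_intros) auto

text \<open>For a fixed point the line function is continuous in the index and changes sign between
  \<alpha> and \<beta> and between \<beta> and \<gamma>, so the point lies on a line in each of
  these gaps. The third parameter is prescribed by the sum and located by the signs at \<alpha> and
  \<gamma>.\<close>

lemma frame_interior_param: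
  assumes f: "frame d \<kappa> M \<alpha> \<beta> \<gamma>" and x: "x \<in> interior (Tri d \<kappa> \<alpha> \<beta> \<gamma>)"
  obtains y1 y2 y3 :: real where "\<alpha> < y1" "y1 < \<beta>" "\<beta> < y2" "y2 < \<gamma>" "\<gamma> < y3" "y3 < \<alpha> + int d"
     "y1 + y2 + y3 = of_int (\<alpha> + \<beta> + \<gamma> + M)" "x = ptf d \<kappa> y1 y2"
proof -
  have r: "real_of_int \<alpha> < \<beta>" "real_of_int \<beta> < \<gamma>" "real_of_int \<gamma> < \<alpha> + real d" "0 < real_of_int M" "real_of_int M < real d"
    using f by (simp_all add: frame_def)
  obtain s0 where s0: "s0 \<noteq> 0"
    "\<And>z y1 y2 y3. y1 + y2 + y3 = of_int (\<alpha> + \<beta> + \<gamma> + M) \<Longrightarrow>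
       ell d \<kappa> z (ptf d \<kappa> y1 y2) = s0 * (sg d (z - y1) * sg d (z - y2) * sg d (z - y3))"
     "s0 * ell d \<kappa> \<alpha> x < 0" "s0 * ell d \<kappa> \<beta> x > 0" "s0 * ell d \<kappa> \<gamma> x < 0"
    using frame_interior_iff[OF f] x by metis
  define g where "g = (\<lambda>y. s0 * ell d \<kappa> y x)"
  have c: "continuous_on A g" for A unfolding g_def by (intro continuous_intros continuous_ell)
  obtain y1 :: real where y1: "\<alpha> \<le> y1" "y1 \<le> \<beta>" "g y1 = 0"
    using IVT'[of g \<alpha> 0 \<beta>] s0 r c by (auto simp: g_def)
  obtain y2 :: real where y2: "\<beta> \<le> y2" "y2 \<le> \<gamma>" "g y2 = 0"
    using IVT2'[of g \<gamma> 0 \<beta>] s0 r c by (auto simp: g_def)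
  have ne: "y1 \<noteq> \<alpha>" "y1 \<noteq> \<beta>" "y2 \<noteq> \<beta>" "y2 \<noteq> \<gamma>" using y1 y2 s0 by (auto simp: g_def)
  have y: "\<alpha> < y1" "y1 < \<beta>" "\<beta> < y2" "y2 < \<gamma>" using y1 y2 ne by auto
  have l: "ell d \<kappa> y1 x = 0" "ell d \<kappa> y2 x = 0" using y1 y2 s0(1) by (simp_all add: g_def)
  have "sg d (y1 - y2) < 0" using y r by (intro sg_neg[OF d2]) auto
  then have xe: "x = ptf d \<kappa> y1 y2"
    using l by (intro ell_zeros_unique[OF d2, of \<kappa> y1 x y2]) (simp_all add: ell_ptf_self[OF d2])
  define y3 where "y3 = of_int (\<alpha> + \<beta> + \<gamma> + M) - y1 - y2"
  have s: "y1 + y2 + y3 = of_int (\<alpha> + \<beta> + \<gamma> + M)" by (simp add: y3_def)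
  have sq: "t < 0" if "s0 * (s0 * t) < 0" for t :: real
    using that by (auto simp: mult_less_0_iff zero_less_mult_iff)
  have a: "sg d (\<alpha> - y1) * sg d (\<alpha> - y2) * sg d (\<alpha> - y3) < 0" "sg d (\<gamma> - y1) * sg d (\<gamma> - y2) * sg d (\<gamma> - y3) < 0"
    using s0(3,5) unfolding xe s0(2)[OF s] by (auto dest: sq)
  have b: "sg d (\<alpha> - y1) < 0" "sg d (\<alpha> - y2) < 0" "sg d (\<gamma> - y1) > 0" "sg d (\<gamma> - y2) > 0"
    using r y by (auto intro!: sg_neg[OF d2] sg_pos[OF d2])
  have c: "sg d (\<alpha> - y3) < 0" "sg d (\<gamma> - y3) < 0"
    using a b by (auto simp: mult_less_0_iff zero_less_mult_iff)
  have y3: "\<alpha> < y3" "y3 < \<gamma> + real d" using y r by (auto simp: y3_def)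
  have i1: "y3 < \<alpha> + real d"
  proof (rule ccontr)
    assume "\<not> ?thesis"
    \<comment> \<open>A shift by \<open>2 * d\<close> leaves the sine unchanged, whereas a shift by
      \<open>d\<close> would reverse its sign; the bounds on \<open>y3\<close> place the shifted
      argument between 0 and \<open>d\<close>.\<close>
    then have "0 \<le> sg d (\<alpha> - y3 + 2 * real d)" using y3 r by (intro sg_nonneg[OF d2]) auto
    moreover have "(\<alpha> - y3 + 2 * real d) * pi / real d = (\<alpha> - y3) * pi / real d + 2 * pi"
      using d2 by (simp add: field_simps)
    ultimately show False using c(1) by (simp add: sg_def)
  qed
  have i2: "\<gamma> < y3"
  proof (rule ccontr)
    assume "\<not> ?thesis"
    then have "0 \<le> sg d (\<gamma> - y3)" using y3 r by (intro sg_nonneg[OF d2]) auto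
    then show False using c(2) by simp
  qed
  show ?thesis using that[OF y i2 _ s xe] i1 by simp
qed

text \<open>The parameters lie within one unit of \<open>l, m, n\<close>, on the side given by
  \<sigma>. By \<open>sg_same\<close> no sine factor then changes its sign against the value at the
  opposite vertex.\<close>

lemma param_in_Tri:
  fixes y1 y2 y3 :: real
  assumes e: "elementary d \<kappa> \<sigma> l m n" and s: "l + m + n = k + \<sigma>" and k: "int d dvd k - \<kappa>"
    and y: "y1 + y2 + y3 = of_int k" "0 \<le> \<sigma> * (l - y1)" "\<sigma> * (l - y1) \<le> 1" "0 \<le> \<sigma> * (m - y2)" "\<sigma> * (m - y2) \<le> 1"
      "0 \<le> \<sigma> * (n - y3)" "\<sigma> * (n - y3) \<le> 1"
  shows "ptf d \<kappa> y1 y2 \<in> Tri d \<kappa> l m n"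
    and "\<lbrakk>0 < \<sigma> * (l - y1); \<sigma> * (l - y1) < 1; 0 < \<sigma> * (m - y2); \<sigma> * (m - y2) < 1; 0 < \<sigma> * (n - y3); \<sigma> * (n - y3) < 1\<rbrakk>
      \<Longrightarrow> ptf d \<kappa> y1 y2 \<in> interior (Tri d \<kappa> l m n)"
proof -
  note E = elementary_Tri[OF d2 e]
  have E': "\<not> int d dvd m - l" "\<not> int d dvd n - m" "\<not> int d dvd n - l"
    using E by (metis dvd_minus_iff minus_diff_eq)+
  have \<sigma>: "\<sigma> = 1 \<or> \<sigma> = - 1" using e elementary_iff[OF d2] by blast
  obtain s0 where s0: "s0 \<noteq> 0" "\<And>z y1 y2 y3. y1 + y2 + y3 = of_int k \<Longrightarrow>
       ell d \<kappa> z (ptf d \<kappa> y1 y2) = s0 * (sg d (z - y1) * sg d (z - y2) * sg d (z - y3))"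
    using ell_ptf3[OF d2 k] by blast
  have s': "real_of_int l + m + n = k + \<sigma>" using arg_cong[OF s, of real_of_int] by simp
  have v: "ell d \<kappa> l (ptf d \<kappa> m n) = s0 * (sg d (of_int (l - m)) * sg d (of_int (l - n)) * sg d \<sigma>)"
     "ell d \<kappa> m (ptf d \<kappa> l n) = s0 * (sg d (of_int (m - l)) * sg d (of_int (m - n)) * sg d \<sigma>)"
     "ell d \<kappa> n (ptf d \<kappa> l m) = s0 * (sg d (of_int (n - l)) * sg d (of_int (n - m)) * sg d \<sigma>)"
    using s0(2)[of m n "l - \<sigma>" l] s0(2)[of l n "m - \<sigma>" m] s0(2)[of l m "n - \<sigma>" n] s' by simp_all
  have w: "ell d \<kappa> l (ptf d \<kappa> y1 y2) = s0 * (sg d (of_int (l - m) + (m - y2)) * sg d (of_int (l - n) + (n - y3)) * sg d (l - y1))"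
     "ell d \<kappa> m (ptf d \<kappa> y1 y2) = s0 * (sg d (of_int (m - l) + (l - y1)) * sg d (of_int (m - n) + (n - y3)) * sg d (m - y2))"
     "ell d \<kappa> n (ptf d \<kappa> y1 y2) = s0 * (sg d (of_int (n - l) + (l - y1)) * sg d (of_int (n - m) + (m - y2)) * sg d (n - y3))"
    by (simp_all add: s0(2)[OF y(1)] mult_ac)
  have ab: "\<bar>l - y1\<bar> \<le> 1" "\<bar>m - y2\<bar> \<le> 1" "\<bar>n - y3\<bar> \<le> 1" using y \<sigma> by auto
  have t: "0 \<le> sg d (\<sigma>) * sg d t" if "0 \<le> \<sigma> * t" "\<sigma> * t \<le> 1" for t :: real
    using \<sigma> that d2 sg_pos[OF d2, of 1] sg_nonneg[OF d2, of t] sg_nonneg[OF d2, of "- t"]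
    by (auto simp: sg_minus zero_le_mult_iff)
  have t': "0 < sg d (\<sigma>) * sg d t" if "0 < \<sigma> * t" "\<sigma> * t \<le> 1" for t :: real
    using \<sigma> that d2 sg_pos[OF d2, of 1] sg_pos[OF d2, of t] sg_pos[OF d2, of "- t"]
    by (auto simp: sg_minus zero_less_mult_iff)
  have prod: "(s0 * (a' * b' * c')) * (s0 * (a * b * c)) \<ge> 0" if "a * a' \<ge> 0" "b * b' \<ge> 0" "c * c' \<ge> 0" for a b c a' b' c' :: real
  proof -
    have eq: "(s0 * (a' * b' * c')) * (s0 * (a * b * c)) = s0\<^sup>2 * ((a * a') * (b * b') * (c * c'))" by (simp add: power2_eq_square mult_ac)
    show ?thesis unfolding eq by (intro mult_nonneg_nonneg that zero_le_power2)
  qed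
  have prod': "(s0 * (a' * b' * c')) * (s0 * (a * b * c)) > 0" if "a * a' > 0" "b * b' > 0" "c * c' > 0" for a b c a' b' c' :: real
  proof -
    have eq: "(s0 * (a' * b' * c')) * (s0 * (a * b * c)) = s0\<^sup>2 * ((a * a') * (b * b') * (c * c'))" by (simp add: power2_eq_square mult_ac)
    show ?thesis unfolding eq using s0(1) by (intro mult_pos_pos that) simp
  qed
  show "ptf d \<kappa> y1 y2 \<in> Tri d \<kappa> l m n"
    unfolding Tri_iff(3)[OF d2 E] unfolding v w
    by (intro conjI prod sg_same(1)[OF d2] E E' ab t y)
  show "ptf d \<kappa> y1 y2 \<in> interior (Tri d \<kappa> l m n)" if "0 < \<sigma> * (l - y1)" "\<sigma> * (l - y1) < 1" "0 < \<sigma> * (m - y2)" "\<sigma> * (m - y2) < 1" "0 < \<sigma> * (n - y3)" "\<sigma> * (n - y3) < 1"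
  proof -
    have "\<bar>l - y1\<bar> < 1" "\<bar>m - y2\<bar> < 1" "\<bar>n - y3\<bar> < 1" using that \<sigma> by auto
    then show ?thesis
      unfolding Tri_iff(4)[OF d2 E] unfolding v w
      by (intro conjI prod' sg_same(2)[OF d2] E E' ab t' y that)
  qed
qed

section \<open>The cells of a frame\<close>

lemma child_elementary:
  assumes f: "frame d \<kappa> M \<alpha> \<beta> \<gamma>" and c: "child M (\<beta> - \<alpha>) (\<gamma> - \<beta>) (\<alpha> + int d - \<gamma>) \<tau> i j k"
  shows "elementary d \<kappa> \<tau> (\<alpha> + i + up \<tau>) (\<beta> + j + up \<tau>) (\<gamma> + k + up \<tau>)"
proof -
  have eq: "\<alpha> + i + up \<tau> + (\<beta> + j + up \<tau>) + (\<gamma> + k + up \<tau>) - (\<kappa> + \<tau>) = \<alpha> + \<beta> + \<gamma> + M - \<kappa>"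
    using c by (auto simp: child_def up_def)
  have "int d dvd \<alpha> + \<beta> + \<gamma> + M - \<kappa>" "\<tau> = 1 \<or> \<tau> = -1" using f c by (simp_all add: frame_def child_def)
  moreover have "\<not> int d dvd (\<alpha> + i + up \<tau>) - (\<beta> + j + up \<tau>)" "\<not> int d dvd (\<beta> + j + up \<tau>) - (\<gamma> + k + up \<tau>)"
     "\<not> int d dvd (\<alpha> + i + up \<tau>) - (\<gamma> + k + up \<tau>)"
    using f c by (simp_all only: child_def frame_def) (rule not_dvd_diff; linarith)+
  ultimately show ?thesis unfolding elementary_iff[OF d2] eq by blast
qed

lemma child_subset_frame:
  assumes f: "frame d \<kappa> M \<alpha> \<beta> \<gamma>" and c: "child M (\<beta> - \<alpha>) (\<gamma> - \<beta>) (\<alpha> + int d - \<gamma>) \<tau> i j k"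
  shows "Tri d \<kappa> (\<alpha> + i + up \<tau>) (\<beta> + j + up \<tau>) (\<gamma> + k + up \<tau>) \<subseteq> Tri d \<kappa> \<alpha> \<beta> \<gamma>"
proof -
  \<comment> \<open>Lowering every index by \<tau> / 3 removes the excess \<tau> of the index sum;
    the resulting point lies in the child and inside the frame, so \<open>elementary_subset\<close>
    applies.\<close>
  define y1 y2 y3 where "y1 = \<alpha> + i + up \<tau> - of_int \<tau> / 3" "y2 = \<beta> + j + up \<tau> - of_int \<tau> / 3" "y3 = \<gamma> + k + up \<tau> - of_int \<tau> / 3"
  note y = y1_y2_y3_def
  let ?l = "\<alpha> + i + up \<tau>" and ?m = "\<beta> + j + up \<tau>" and ?n = "\<gamma> + k + up \<tau>"
  have \<tau>: "\<tau> = 1 \<or> \<tau> = -1" using c by (simp add: child_def)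
  have s: "?l + ?m + ?n = (\<alpha> + \<beta> + \<gamma> + M) + \<tau>" using c by (auto simp: child_def up_def)
  then have s': "real_of_int ?l + ?m + ?n = of_int (\<alpha> + \<beta> + \<gamma> + M) + \<tau>"
    using arg_cong[OF s, of real_of_int] by simp
  have sy: "y1 + y2 + y3 = of_int (\<alpha> + \<beta> + \<gamma> + M)" using s' unfolding y by simp
  have box: "0 \<le> i" "i + 1 \<le> \<beta> - \<alpha>" "0 \<le> j" "j + 1 \<le> \<gamma> - \<beta>" "0 \<le> k" "k + 1 \<le> \<alpha> + int d - \<gamma>" using c by (auto simp: child_def)
  then have box': "0 \<le> real_of_int i" "real_of_int i + 1 \<le> \<beta> - \<alpha>" "0 \<le> real_of_int j" "real_of_int j + 1 \<le> \<gamma> - \<beta>"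
    "0 \<le> real_of_int k" "real_of_int k + 1 \<le> \<alpha> + real d - \<gamma>" by linarith+
  have 1: "ptf d \<kappa> y1 y2 \<in> interior (Tri d \<kappa> \<alpha> \<beta> \<gamma>)"
    by (rule frame_param_interior[OF f _ _ _ _ _ _ sy]) (use box' \<tau> in \<open>auto simp: y up_def\<close>)
  have 2: "ptf d \<kappa> y1 y2 \<in> Tri d \<kappa> ?l ?m ?n"
    by (rule param_in_Tri(1)[OF child_elementary[OF f c] s _ sy]) (use f \<tau> in \<open>auto simp: y frame_def\<close>)
  show ?thesis by (rule elementary_subset[OF d2 child_elementary[OF f c] frame_Tri[OF f] 2 1])
qed

text \<open>The integer parts of the three parameters select the cell. The fractional parts add up
  to an integer \<open>r\<close> below 3: 0 means a point with integer parameters, 1 a child of sign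
  -1, and 2 a child of sign 1.\<close>

lemma frame_covered:
  assumes f: "frame d \<kappa> M \<alpha> \<beta> \<gamma>" and x: "x \<in> interior (Tri d \<kappa> \<alpha> \<beta> \<gamma>)"
  shows "x \<in> (\<lambda>(n1, n2). ptf d \<kappa> (of_int n1) (of_int n2)) ` ({\<alpha>..\<beta>} \<times> {\<beta>..\<gamma>}) \<or>
    (\<exists>\<tau> i j k. child M (\<beta> - \<alpha>) (\<gamma> - \<beta>) (\<alpha> + int d - \<gamma>) \<tau> i j k \<and>
      x \<in> Tri d \<kappa> (\<alpha> + i + up \<tau>) (\<beta> + j + up \<tau>) (\<gamma> + k + up \<tau>))"
proof -
  obtain y1 y2 y3 :: real where y: "\<alpha> < y1" "y1 < \<beta>" "\<beta> < y2" "y2 < \<gamma>" "\<gamma> < y3" "y3 < \<alpha> + int d"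
     "y1 + y2 + y3 = of_int (\<alpha> + \<beta> + \<gamma> + M)" "x = ptf d \<kappa> y1 y2"
    using frame_interior_param[OF f x] by blast
  define i j k where "i = \<lfloor>y1\<rfloor> - \<alpha>" "j = \<lfloor>y2\<rfloor> - \<beta>" "k = \<lfloor>y3\<rfloor> - \<gamma>"
  note ijk = i_j_k_def
  have fl: "\<lfloor>y1\<rfloor> = \<alpha> + i" "\<lfloor>y2\<rfloor> = \<beta> + j" "\<lfloor>y3\<rfloor> = \<gamma> + k" by (simp_all add: ijk)
  have box: "0 \<le> i" "i < \<beta> - \<alpha>" "0 \<le> j" "j < \<gamma> - \<beta>" "0 \<le> k" "k < \<alpha> + int d - \<gamma>"
    using y unfolding ijk by (simp_all add: le_floor_iff floor_less_iff)
  have b: "of_int (\<alpha> + i) \<le> y1" "y1 < of_int (\<alpha> + i) + 1" "of_int (\<beta> + j) \<le> y2" "y2 < of_int (\<beta> + j) + 1"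
     "of_int (\<gamma> + k) \<le> y3" "y3 < of_int (\<gamma> + k) + 1"
    unfolding fl[symmetric] by linarith+
  define r where "r = M - (i + j + k)"
  have "of_int r = (y1 - of_int (\<alpha> + i)) + (y2 - of_int (\<beta> + j)) + (y3 - of_int (\<gamma> + k))"
    using y(7) by (simp add: r_def)
  then have r: "of_int r \<ge> (0::real)" "of_int r < (3::real)" and r0: "r = 0 \<Longrightarrow> y1 = of_int (\<alpha> + i) \<and> y2 = of_int (\<beta> + j)"
    using b by auto
  have "r = 0 \<or> r = 1 \<or> r = 2" using r by linarith
  then show ?thesis
  proof (elim disjE)
    assume "r = 0"
    then have "x = (\<lambda>(n1, n2). ptf d \<kappa> (of_int n1) (of_int n2)) (\<alpha> + i, \<beta> + j)" using r0 y(8) by simp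
    then show ?thesis using box by (intro disjI1 image_eqI[of _ _ "(\<alpha> + i, \<beta> + j)"]) auto
  next
    assume "r = 1"
    then have c: "child M (\<beta> - \<alpha>) (\<gamma> - \<beta>) (\<alpha> + int d - \<gamma>) (-1) i j k" using box by (simp add: child_def r_def)
    have "x \<in> Tri d \<kappa> (\<alpha> + i + up (-1)) (\<beta> + j + up (-1)) (\<gamma> + k + up (-1))"
      unfolding y(8)
      by (rule param_in_Tri(1)[OF child_elementary[OF f c] _ _ y(7)]) (use f b \<open>r = 1\<close> in \<open>auto simp: frame_def up_def r_def\<close>)
    then show ?thesis using c by blast
  next
    assume "r = 2"
    then have c: "child M (\<beta> - \<alpha>) (\<gamma> - \<beta>) (\<alpha> + int d - \<gamma>) 1 i j k" using box by (simp add: child_def r_def)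
    have "x \<in> Tri d \<kappa> (\<alpha> + i + up 1) (\<beta> + j + up 1) (\<gamma> + k + up 1)"
      unfolding y(8)
      by (rule param_in_Tri(1)[OF child_elementary[OF f c] _ _ y(7)]) (use f b \<open>r = 2\<close> in \<open>auto simp: frame_def up_def r_def\<close>)
    then show ?thesis using c by blast
  qed
qed

text \<open>\<open>frame_covered\<close> leaves only finitely many interior points open. The
  finitely many closed children cover all others, hence their closure, which is the whole
  triangle.\<close>

lemma frame_union:
  assumes f: "frame d \<kappa> M \<alpha> \<beta> \<gamma>"
  shows "(\<Union>{Tri d \<kappa> (\<alpha> + i + up \<tau>) (\<beta> + j + up \<tau>) (\<gamma> + k + up \<tau>) | \<tau> i j k.
     child M (\<beta> - \<alpha>) (\<gamma> - \<beta>) (\<alpha> + int d - \<gamma>) \<tau> i j k}) = Tri d \<kappa> \<alpha> \<beta> \<gamma>" (is "\<Union>?C = ?B")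
proof
  show "\<Union>?C \<subseteq> ?B" using child_subset_frame[OF f] by blast
  define V where "V = (\<lambda>(n1, n2). ptf d \<kappa> (of_int n1) (of_int n2)) ` ({\<alpha>..\<beta>} \<times> {\<beta>..\<gamma>})"
  have "finite V" by (simp add: V_def)
  have fin: "finite ?C"
  proof -
    let ?g = "\<lambda>(\<tau>, i, j, k). Tri d \<kappa> (\<alpha> + i + up \<tau>) (\<beta> + j + up \<tau>) (\<gamma> + k + up \<tau>)"
    have "?C \<subseteq> ?g ` ({-1, 1} \<times> {0..\<beta> - \<alpha>} \<times> {0..\<gamma> - \<beta>} \<times> {0..\<alpha> + int d - \<gamma>})"
    proof
      fix T assume "T \<in> ?C"
      then obtain \<tau> i j k where "T = ?g (\<tau>, i, j, k)" "child M (\<beta> - \<alpha>) (\<gamma> - \<beta>) (\<alpha> + int d - \<gamma>) \<tau> i j k" by auto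
      then show "T \<in> ?g ` ({-1, 1} \<times> {0..\<beta> - \<alpha>} \<times> {0..\<gamma> - \<beta>} \<times> {0..\<alpha> + int d - \<gamma>})"
        by (intro image_eqI[of _ _ "(\<tau>, i, j, k)"]) (auto simp: child_def)
    qed
    then show ?thesis by (rule finite_subset) auto
  qed
  have cl: "closed T" if "T \<in> ?C" for T
    using that by (auto simp: Tri_def triangle_def intro!: compact_imp_closed finite_imp_compact_convex_hull)
  have "closed (\<Union>?C)" using fin cl by (intro closed_Union) blast+
  moreover have "interior ?B - V \<subseteq> \<Union>?C"
  proof
    fix x assume x: "x \<in> interior ?B - V"
    then obtain \<tau> i j k where c: "child M (\<beta> - \<alpha>) (\<gamma> - \<beta>) (\<alpha> + int d - \<gamma>) \<tau> i j k"
      "x \<in> Tri d \<kappa> (\<alpha> + i + up \<tau>) (\<beta> + j + up \<tau>) (\<gamma> + k + up \<tau>)"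
      using frame_covered[OF f, of x, folded V_def] by auto
    show "x \<in> \<Union>?C" by (rule UnionI[OF _ c(2)]) (use c(1) in auto)
  qed
  ultimately have "closure (interior ?B - V) \<subseteq> \<Union>?C" by (simp add: closure_minimal)
  then have "interior ?B \<subseteq> \<Union>?C" using open_subset_closure_diff_finite[OF open_interior \<open>finite V\<close>] by blast
  then have "closure (interior ?B) \<subseteq> \<Union>?C" using \<open>closed (\<Union>?C)\<close> by (simp add: closure_minimal)
  then show "?B \<subseteq> \<Union>?C"
    using regular_triangle(2)[OF Tri_iff(1)[OF d2 frame_Tri[OF f]]] Tri_iff(2)[OF d2 frame_Tri[OF f]] by simp
qed

end

section \<open>Tiles inscribed in circles\<close>

lemma convex_hull_complex_affine:
  "(\<lambda>x. u * x + v) ` (convex hull A) = convex hull ((\<lambda>x. u * x + v) ` A)" for u v :: complex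
proof -
  have "linear (\<lambda>x. u * x)" by (simp add: bounded_linear.linear bounded_linear_mult_right)
  then have "(\<lambda>x. v + x) ` ((\<lambda>x. u * x) ` (convex hull A)) = convex hull ((\<lambda>x. v + x) ` ((\<lambda>x. u * x) ` A))"
    by (simp only: convex_hull_linear_image convex_hull_translation)
  then show ?thesis by (simp add: image_image add.commute)
qed

section \<open>Isometries of the plane\<close>

lemma isometry_direct: "cmod u = 1 \<Longrightarrow> isometry (\<lambda>x. u * x + v)"
  by (simp add: isometry_def dist_norm norm_mult flip: right_diff_distrib)

lemma isometry_decompose:
  assumes "isometry f"
  obtains g c where "orthogonal_transformation g" "f = (\<lambda>x. c + g x)"
proof (rule that[of "\<lambda>x. f x - f 0" "f 0"])
  show "orthogonal_transformation (\<lambda>x. f x - f 0)"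
    using assms by (simp add: orthogonal_transformation_isometry isometry_def dist_norm)
  show "f = (\<lambda>x. f 0 + (f x - f 0))" by auto
qed

lemma isometry_convex_hull:
  assumes "isometry f" shows "f ` (convex hull A) = convex hull (f ` A)"
proof -
  obtain g c where g: "orthogonal_transformation g" and "f = (\<lambda>x. c + g x)"
    using isometry_decompose[OF assms] .
  then have f: "f ` A = (\<lambda>x. c + x) ` (g ` A)" for A by (simp only: image_image)
  show ?thesis unfolding f
    using g by (simp only: convex_hull_linear_image[OF orthogonal_transformation_linear] convex_hull_translation)
qed

lemma isometry_bij:
  assumes "isometry f" shows "bij f"
proof -
  obtain g c where g: "orthogonal_transformation g" and f: "f = (\<lambda>x. c + g x)"
    using isometry_decompose[OF assms] .
  have "bij ((+) c)" by (simp add: bij_def)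
  then have "bij ((+) c \<circ> g)" using orthogonal_transformation_bij[OF g] by (simp add: bij_comp)
  moreover have "f = (+) c \<circ> g" by (simp add: f fun_eq_iff)
  ultimately show ?thesis by simp
qed

lemma isometry_comp: "isometry f \<Longrightarrow> isometry g \<Longrightarrow> isometry (f \<circ> g)"
  by (simp add: isometry_def)

lemma isometry_id: "isometry id" by (simp add: isometry_def)

lemma isometry_inv:
  assumes "isometry f" shows "isometry (inv f)"
  unfolding isometry_def
proof (intro allI)
  fix x y
  have "dist (f (inv f x)) (f (inv f y)) = dist x y"
    using isometry_bij[OF assms] by (simp add: bij_is_surj surj_f_inv_f)
  then show "dist (inv f x) (inv f y) = dist x y" using assms by (simp add: isometry_def)
qed

lemma isometry_interior:
  assumes "isometry f" shows "interior (f ` A) = f ` interior A"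
proof -
  obtain g c where g: "orthogonal_transformation g" and "f = (\<lambda>x. c + g x)"
    using isometry_decompose[OF assms] .
  then have f: "f ` A = (\<lambda>x. c + x) ` (g ` A)" for A by (simp only: image_image)
  show ?thesis unfolding f
    using interior_injective_linear_image[OF orthogonal_transformation_linear[OF g] orthogonal_transformation_inj[OF g]]
    by (simp only: interior_translation)
qed

lemma fst_dmap [simp]: "fst (dmap f T) = f ` fst T" by (simp add: dmap_def)

lemma dmap_comp: "dmap (f \<circ> g) T = dmap f (dmap g T)" by (simp add: dmap_def image_comp)

lemma dmap_id: "dmap id T = T" by (simp add: dmap_def)

text \<open>The vertices of all tiles lie on circles of radius \<open>2 s\<^sub>1\<close>, at angular positions which are
  multiples of \<open>2\<pi>/d\<close>. The tile \<open>DT d z0 w \<sigma> Z\<close> has circumcentre \<open>z0\<close> and vertices \<open>z0 + w z\<close> with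
  \<open>z\<close> in the three-element set \<open>Z\<close> of \<open>d\<close>-th roots of unity. Replacing \<open>\<sigma>\<close> by \<open>- \<sigma>\<close> reverses the
  subdivision of every edge.\<close>

definition E :: "nat \<Rightarrow> int \<Rightarrow> complex" where "E d j = cis (- (2 * pi * of_int j / real d))"

definition DT :: "nat \<Rightarrow> complex \<Rightarrow> complex \<Rightarrow> int \<Rightarrow> complex set \<Rightarrow> dtile" where
  "DT d z0 w \<sigma> Z = (convex hull ((\<lambda>z. z0 + w * z) ` Z),
     convex hull ((\<lambda>z. z0 + w * ((\<Sum>Z - z) / (1 + cis (of_int \<sigma> * pi / real d)))) ` Z))"

lemma dmap_DT: "dmap (\<lambda>x. u * x + v) (DT d z0 w \<sigma> Z) = DT d (u * z0 + v) (u * w) \<sigma> Z"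
  unfolding dmap_def DT_def fst_conv snd_conv convex_hull_complex_affine image_image
  by (simp only: distrib_left mult.assoc add_ac)

text \<open>A rotation of the set of roots can be absorbed in \<open>w\<close>. This is the source
  of the cyclic ambiguity in the presentation of a tile.\<close>

lemma DT_rotate:
  assumes "\<zeta> \<noteq> 0" shows "DT d z0 w \<sigma> ((\<lambda>z. \<zeta> * z) ` Z) = DT d z0 (w * \<zeta>) \<sigma> Z"
proof -
  have "\<Sum>((\<lambda>z. \<zeta> * z) ` Z) = \<zeta> * \<Sum>Z"
    using assms by (subst sum.reindex) (auto simp: inj_on_def sum_distrib_left)
  then show ?thesis by (simp add: DT_def image_image mult.assoc flip: right_diff_distrib)
qed

text \<open>The rotation by which the positions \<open>cis (- 2 * ang d \<kappa> j)\<close> of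
  family \<kappa> deviate from the roots of unity \<open>E d j\<close>.\<close>

definition rot :: "nat \<Rightarrow> int \<Rightarrow> complex" where "rot d \<kappa> = cis (2 * of_int \<kappa> * pi / (3 * real d))"

lemma E_add: "E d (i + j) = E d i * E d j"
  by (simp add: E_def cis_mult ring_distribs add_divide_distrib)

lemma norm_E [simp]: "cmod (E d j) = 1" by (simp add: E_def)

lemma E_nonzero [simp]: "E d j \<noteq> 0" by (simp add: E_def)

lemma E_shift: "E d ` {x + l, x + m, x + n} = (\<lambda>z. E d x * z) ` E d ` {l, m, n}"
  by (simp add: E_add)

context
  fixes d :: nat
  assumes d2: "d > 2"
begin

lemma E_eq_iff: "E d i = E d j \<longleftrightarrow> int d dvd i - j"
proof -
  have "cis x = cis y \<longleftrightarrow> sin x = sin y \<and> cos x = cos y" for x y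
    by (auto simp: complex_eq_iff)
  then have "E d i = E d j \<longleftrightarrow> (\<exists>n. - (2 * pi * of_int i / real d) = - (2 * pi * of_int j / real d) + 2 * pi * of_int n)"
    unfolding E_def sin_cos_eq_iff by simp
  also have "\<dots> \<longleftrightarrow> (\<exists>n. j - i = int d * n)"
  proof -
    have "- (2 * pi * of_int i / real d) = - (2 * pi * of_int j / real d) + 2 * pi * of_int n \<longleftrightarrow> j - i = int d * n" for n
    proof -
      have "- (2 * pi * of_int i / real d) = - (2 * pi * of_int j / real d) + 2 * pi * of_int n
         \<longleftrightarrow> 2 * pi * (real_of_int j - of_int i) = 2 * pi * (real d * of_int n)"
        using d2 by (simp add: field_simps)
      also have "\<dots> \<longleftrightarrow> real_of_int (j - i) = real_of_int (int d * n)" by simp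
      finally show ?thesis unfolding of_int_eq_iff .
    qed
    then show ?thesis by blast
  qed
  also have "\<dots> \<longleftrightarrow> int d dvd j - i" by (auto simp: dvd_def)
  finally show ?thesis by (simp add: dvd_diff_commute)
qed

lemma E_dvd: "int d dvd i - j \<Longrightarrow> E d i = E d j" using E_eq_iff by blast

lemma cis_ang: "cis (- 2 * ang d \<kappa> j) = rot d \<kappa> * E d j"
proof -
  have "- 2 * ang d \<kappa> j = 2 * of_int \<kappa> * pi / (3 * real d) + - (2 * pi * of_int j / real d)"
    using d2 by (simp add: ang_def field_simps)
  then show ?thesis by (simp only: rot_def E_def cis_mult)
qed

lemma cis_sum_ang:
  assumes "int d dvd l + m + n - (\<kappa> + t)"
  shows "cis (2 * (ang d \<kappa> m + ang d \<kappa> n)) = cis (2 * (of_int t * pi / real d)) * (rot d \<kappa> * E d l)"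
proof -
  obtain N where N: "l + m + n - (\<kappa> + t) = int d * N" using assms by blast
  have "real_of_int (l + m + n) = real_of_int (\<kappa> + t + int d * N)" unfolding of_int_eq_iff using N by simp
  then have t: "real_of_int t = l + m + n - \<kappa> - real d * of_int N" by simp
  have "2 * (ang d \<kappa> m + ang d \<kappa> n) = (2 * (of_int t * pi / real d) + - 2 * ang d \<kappa> l) + 2 * pi * of_int N"
    using d2 unfolding ang_def t by (simp add: field_simps)
  then show ?thesis by (simp only: cis_add_2pi_int cis_mult[symmetric, of _ "- 2 * ang d \<kappa> l"] cis_ang)
qed

text \<open>The meeting point of the lines \<open>m\<close> and \<open>n\<close> is a centre plus a
  multiple of \<open>E d l\<close>. As centre and factor are symmetric in the three indices, they
  are the circumcentre and the scaled rotation of the circumcircle, for every index sum congruent to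
  \<kappa> + t.\<close>

lemma ptf_E:
  assumes "int d dvd l + m + n - (\<kappa> + t)"
  shows "ptf d \<kappa> m n = rot d \<kappa> * (E d l + E d m + E d n) + rot d \<kappa> * (cis (2 * (of_int t * pi / real d)) - 1) * E d l"
proof -
  have "ptf d \<kappa> m n = cis (- 2 * ang d \<kappa> m) + cis (- 2 * ang d \<kappa> n) + cis (2 * (ang d \<kappa> m + ang d \<kappa> n))"
    by (simp add: ptf_def pt_def ang_angr)
  then show ?thesis unfolding cis_ang cis_sum_ang[OF assms] by (simp add: algebra_simps)
qed

text \<open>This computes circumradii: \<open>2 * sin (pi / d)\<close> if the index sum deviates
  from \<kappa> by one and \<open>2 * sin (p * pi / d)\<close> if it deviates by \<open>p\<close>;
  their quotient is the inflation factor.\<close>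

lemma norm_cis_minus_1: "cmod (cis (2 * x) - 1) = 2 * \<bar>sin x\<bar>"
proof -
  have "cis x - cis (- x) = 2 * \<i> * of_real (sin x)" by (simp add: complex_eq_iff)
  moreover have "cis (2 * x) - 1 = cis x * (cis x - cis (- x))" by (simp add: right_diff_distrib cis_mult)
  ultimately have "cis (2 * x) - 1 = cis x * (2 * \<i> * of_real (sin x))" by simp
  then show ?thesis by (simp add: norm_mult)
qed

lemma one_plus_cis_nonzero:
  assumes "\<sigma> = 1 \<or> \<sigma> = - 1" shows "1 + cis (of_int \<sigma> * pi / real d) \<noteq> 0"
proof -
  have "0 < sin (pi / real d)" using d2 by (intro sin_gt_zero) (auto simp: field_simps)
  then have "Im (1 + cis (of_int \<sigma> * pi / real d)) \<noteq> 0" using assms by auto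
  then show ?thesis by (metis zero_complex.simps(2))
qed

text \<open>After the shift of the angles the points \<open>m, n\<close> give
  \<open>c * (E d m + E d n) + E d l\<close> up to \<open>rot\<close>, with
  \<open>c = cis (\<sigma> * pi / d)\<close>. As the scaling factor of the circle contains
  \<open>c * c - 1\<close>, the quotient by \<open>1 + c\<close> in \<open>DT\<close>
  results.\<close>

lemma decorated_DT:
  assumes e: "elementary d \<kappa> \<sigma> l m n"
  shows "decorated d \<sigma> (ang d \<kappa> l) (ang d \<kappa> m) (ang d \<kappa> n) =
    DT d (rot d \<kappa> * \<Sum>(E d ` {l, m, n})) (rot d \<kappa> * (cis (2 * (of_int \<sigma> * pi / real d)) - 1)) \<sigma> (E d ` {l, m, n})"
    (is "_ = DT d ?O ?w \<sigma> ?Z")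
proof -
  note el = elementary_Tri[OF d2 e]
  have \<sigma>: "\<sigma> = 1 \<or> \<sigma> = - 1" and s: "int d dvd l + m + n - (\<kappa> + \<sigma>)" using e by (auto simp: elementary_iff[OF d2])
  have s': "int d dvd m + l + n - (\<kappa> + \<sigma>)" "int d dvd n + l + m - (\<kappa> + \<sigma>)" using s by (simp_all add: algebra_simps)
  have ne: "E d l \<noteq> E d m" "E d m \<noteq> E d n" "E d l \<noteq> E d n" using el by (simp_all add: E_eq_iff)
  have S: "\<Sum>?Z = E d l + E d m + E d n" using ne by simp
  have 1: "Tri d \<kappa> l m n = convex hull ((\<lambda>z. ?O + ?w * z) ` ?Z)"
    unfolding Tri_iff(2)[OF d2 el] S using ptf_E[OF s] ptf_E[OF s'(1)] ptf_E[OF s'(2)]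
    by (simp add: add_ac)
  define \<delta> where "\<delta> = of_int \<sigma> * pi / (2 * real d)"
  define c where "c = cis (of_int \<sigma> * pi / real d)"
  have c2: "cis (2 * \<delta>) = c" using d2 by (simp add: \<delta>_def c_def)
  have cc: "cis (2 * (of_int \<sigma> * pi / real d)) = c * c" unfolding c_def cis_mult mult_2 ..
  have c1: "1 + c \<noteq> 0" using one_plus_cis_nonzero[OF \<sigma>] by (simp add: c_def)
  have V: "meet (ang d \<kappa> m - \<delta>) (ang d \<kappa> n - \<delta>) = ?O + ?w * ((\<Sum>?Z - E d l) / (1 + c))"
    if lmn: "int d dvd l + m + n - (\<kappa> + \<sigma>)" "\<not> int d dvd m - n" "\<Sum>?Z = E d l + E d m + E d n" for l m n
  proof -
    have "sin (ang d \<kappa> m - \<delta> - (ang d \<kappa> n - \<delta>)) \<noteq> 0"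
      using sin_angr_diff[OF d2, of \<kappa> m n] lmn(2) sg_zero_iff[OF d2, of "m - n"] by (simp add: ang_angr)
    then have "meet (ang d \<kappa> m - \<delta>) (ang d \<kappa> n - \<delta>) = pt (ang d \<kappa> m - \<delta>) (ang d \<kappa> n - \<delta>)" by (rule meet_eq_pt)
    also have "\<dots> = cis (- 2 * ang d \<kappa> m + 2 * \<delta>) + cis (- 2 * ang d \<kappa> n + 2 * \<delta>) + cis (2 * (ang d \<kappa> m + ang d \<kappa> n) + - (2 * \<delta>) + - (2 * \<delta>))"
      unfolding pt_def by (simp add: algebra_simps)
    also have "\<dots> = rot d \<kappa> * (c * (E d m + E d n) + E d l)"
    proof -
      have "cis (2 * (ang d \<kappa> m + ang d \<kappa> n) + - (2 * \<delta>) + - (2 * \<delta>)) = c * c * (rot d \<kappa> * E d l) * inverse c * inverse c"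
        unfolding cis_mult[symmetric] cis_inverse[symmetric] c2 cis_sum_ang[OF lmn(1)] cc ..
      moreover have "c \<noteq> 0" by (simp add: c_def)
      ultimately have "cis (2 * (ang d \<kappa> m + ang d \<kappa> n) + - (2 * \<delta>) + - (2 * \<delta>)) = rot d \<kappa> * E d l" by (simp add: field_simps)
      then show ?thesis unfolding cis_mult[symmetric] c2 cis_ang by (simp add: algebra_simps)
    qed
    also have "\<dots> = ?O + ?w * ((\<Sum>?Z - E d l) / (1 + c))"
    proof -
      have "?w * ((\<Sum>?Z - E d l) / (1 + c)) = rot d \<kappa> * (c - 1) * (\<Sum>?Z - E d l)"
        unfolding cc using c1 by (simp add: field_simps)
      then show ?thesis unfolding lmn(3) by (simp add: algebra_simps)
    qed
    finally show ?thesis .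
  qed
  have t': "triangle (ang d \<kappa> l - \<delta>) (ang d \<kappa> m - \<delta>) (ang d \<kappa> n - \<delta>) = convex hull ((\<lambda>z. ?O + ?w * ((\<Sum>?Z - z) / (1 + c))) ` ?Z)"
  proof -
    have "meet (ang d \<kappa> m - \<delta>) (ang d \<kappa> n - \<delta>) = ?O + ?w * ((\<Sum>?Z - E d l) / (1 + c))"
      by (rule V) (use s el S in simp_all)
    moreover have "meet (ang d \<kappa> l - \<delta>) (ang d \<kappa> n - \<delta>) = ?O + ?w * ((\<Sum>?Z - E d m) / (1 + c))"
      by (rule V) (use s' el S in simp_all)
    moreover have "meet (ang d \<kappa> l - \<delta>) (ang d \<kappa> m - \<delta>) = ?O + ?w * ((\<Sum>?Z - E d n) / (1 + c))"
      by (rule V) (use s' el S in simp_all)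
    ultimately show ?thesis unfolding triangle_def by (simp add: insert_commute)
  qed
  have "decorated d \<sigma> (ang d \<kappa> l) (ang d \<kappa> m) (ang d \<kappa> n) = (Tri d \<kappa> l m n, triangle (ang d \<kappa> l - \<delta>) (ang d \<kappa> m - \<delta>) (ang d \<kappa> n - \<delta>))"
    by (simp add: decorated_def Let_def Tri_def \<delta>_def)
  then show ?thesis unfolding 1 t' DT_def c_def .
qed

lemma fst_decorated: "fst (decorated d \<sigma> (ang d \<kappa> l) (ang d \<kappa> m) (ang d \<kappa> n)) = Tri d \<kappa> l m n"
  by (simp add: decorated_def Let_def Tri_def)

text \<open>A common shift of three indices by \<open>x\<close> changes their sum by
  \<open>3 * x\<close>, so a sum has to be adjusted modulo 3 only: by a multiple of \<open>d\<close>
  if 3 does not divide \<open>d\<close>, and otherwise by the choice among -2, 0, 2. This is why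
  three families occur.\<close>

lemma K_solve: "\<exists>\<kappa>\<in>K d. \<exists>x k. N + 3 * x = \<kappa> + int d * k"
proof (cases "3 dvd d")
  case True
  have "N mod 3 = 0 \<or> N mod 3 = 1 \<or> N mod 3 = 2" by presburger
  then obtain \<kappa> :: int where "\<kappa> \<in> {-2, 0, 2}" "(\<kappa> - N) mod 3 = 0"
  proof (elim disjE)
    assume "N mod 3 = 0" then have "(0 - N) mod 3 = 0" by presburger
    then show ?thesis using that[of 0] by simp
  next
    assume "N mod 3 = 1" then have "(- 2 - N) mod 3 = 0" by presburger
    then show ?thesis using that[of "- 2"] by simp
  next
    assume "N mod 3 = 2" then have "(2 - N) mod 3 = 0" by presburger
    then show ?thesis using that[of 2] by simp
  qed
  then have "\<kappa> \<in> K d" "N + 3 * ((\<kappa> - N) div 3) = \<kappa> + int d * 0" using True by (auto simp: K_def)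
  then show ?thesis by blast
next
  case False
  then have "\<not> 3 dvd int d" by presburger
  then have "(N - int d * 0) mod 3 = 0 \<or> (N - int d * 1) mod 3 = 0 \<or> (N - int d * 2) mod 3 = 0" by presburger
  then obtain k where "(N - int d * k) mod 3 = 0" by (elim disjE) (rule that, assumption)+
  then have "N + 3 * (- ((N - int d * k) div 3)) = 0 + int d * k" by (simp add: minus_mod_eq_mult_div[symmetric])
  moreover have "0 \<in> K d" by (simp add: K_def)
  ultimately show ?thesis by blast
qed

lemma norm_rot [simp]: "cmod (rot d \<kappa>) = 1" by (simp add: rot_def)

lemma sorted_residues:
  assumes "\<not> int d dvd l - m" "\<not> int d dvd m - n" "\<not> int d dvd l - n"
  obtains l' m' n' where "l' < m'" "m' < n'" "n' < l' + int d" "E d ` {l', m', n'} = E d ` {l, m, n}"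
    "int d dvd (l + m + n) - (l' + m' + n')"
proof -
  let ?r = "\<lambda>j. j mod int d"
  have r: "?r l \<noteq> ?r m" "?r m \<noteq> ?r n" "?r l \<noteq> ?r n" using assms by (simp_all add: mod_eq_dvd_iff)
  obtain l' m' n' where p: "{l', m', n'} = {?r l, ?r m, ?r n}" "l' < m'" "m' < n'"
  proof -
    have "\<exists>l' m' n'. {l', m', n'} = {a, b, c} \<and> l' < m' \<and> m' < n'" if "a \<noteq> b" "b \<noteq> c" "a \<noteq> c" for a b c :: int
    proof -
      have "(a < b \<and> b < c) \<or> (a < c \<and> c < b) \<or> (b < a \<and> a < c) \<or> (b < c \<and> c < a) \<or> (c < a \<and> a < b) \<or> (c < b \<and> b < a)"
        using that by linarith
      moreover have "{a, c, b} = {a, b, c}" "{b, a, c} = {a, b, c}" "{b, c, a} = {a, b, c}" "{c, a, b} = {a, b, c}" "{c, b, a} = {a, b, c}"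
        by auto
      ultimately show ?thesis by blast
    qed
    from this[OF r] show ?thesis using that by blast
  qed
  have bd: "0 \<le> ?r j" "?r j < int d" for j using d2 by simp_all
  have "l' \<in> {?r l, ?r m, ?r n}" "n' \<in> {?r l, ?r m, ?r n}" unfolding p(1)[symmetric] by simp_all
  then have b: "0 \<le> l'" "n' < int d" using bd by auto
  have Z: "E d ` {l', m', n'} = E d ` {l, m, n}"
  proof -
    have "E d (?r j) = E d j" for j by (rule E_dvd) (simp add: mod_eq_dvd_iff[symmetric])
    then show ?thesis unfolding p(1) by simp
  qed
  have "l' + m' + n' = ?r l + ?r m + ?r n"
  proof -
    have "\<Sum>{l', m', n'} = \<Sum>{?r l, ?r m, ?r n}" using p(1) by simp
    then show ?thesis using p(2,3) r by (simp add: add.assoc)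
  qed
  then have "(l + m + n) mod int d = (l' + m' + n') mod int d"
    by (simp only:) (rule sym, intro mod_add_cong; simp)
  then show ?thesis using that[OF p(2,3) _ Z] b unfolding mod_eq_dvd_iff by simp
qed

lemma F_DT:
  assumes "T \<in> F d"
  obtains \<kappa> \<sigma> l m n where "\<kappa> \<in> K d" "elementary d \<kappa> \<sigma> l m n" "l < m" "m < n" "n < l + int d"
    "T = decorated d \<sigma> (ang d \<kappa> l) (ang d \<kappa> m) (ang d \<kappa> n)"
proof -
  obtain \<kappa> \<sigma> l m n where k: "\<kappa> \<in> K d" "elementary d \<kappa> \<sigma> l m n"
    "T = decorated d \<sigma> (ang d \<kappa> l) (ang d \<kappa> m) (ang d \<kappa> n)"
    using assms unfolding F_def by blast
  obtain l' m' n' where o: "l' < m'" "m' < n'" "n' < l' + int d" and Z: "E d ` {l', m', n'} = E d ` {l, m, n}"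
    and s: "int d dvd (l + m + n) - (l' + m' + n')"
    by (rule sorted_residues[OF elementary_Tri(1-3)[OF d2 k(2)]])
  have "int d dvd l + m + n - (\<kappa> + \<sigma>)" using k(2) unfolding elementary_iff[OF d2] by blast
  from dvd_diff[OF this s] have "int d dvd l' + m' + n' - (\<kappa> + \<sigma>)" by (simp add: algebra_simps)
  then have e': "elementary d \<kappa> \<sigma> l' m' n'"
    using k(2) o not_dvd_diff[OF d2, of l' m'] not_dvd_diff[OF d2, of m' n'] not_dvd_diff[OF d2, of l' n']
    unfolding elementary_iff[OF d2] by simp
  show ?thesis by (rule that[OF k(1) e' o]) (unfold k(3) decorated_DT[OF k(2)] decorated_DT[OF e'] Z, rule refl)
qed

text \<open>Any three distinct roots and any sign occur among the prototiles: \<open>K_solve\<close>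
  provides a shift and a family with an admissible index sum, and the factor \<open>u\<close> aligns
  the two circles.\<close>

lemma DT_copy_F:
  assumes \<sigma>: "\<sigma> = 1 \<or> \<sigma> = - 1" and ne: "\<not> int d dvd l - m" "\<not> int d dvd m - n" "\<not> int d dvd l - n"
    and w: "cmod w = 2 * sin (pi / real d)"
  obtains \<kappa> x u v where "\<kappa> \<in> K d" "elementary d \<kappa> \<sigma> (x + l) (x + m) (x + n)" "cmod u = 1"
    "DT d z0 w \<sigma> (E d ` {l, m, n}) =
      dmap (\<lambda>z. u * z + v) (decorated d \<sigma> (ang d \<kappa> (x + l)) (ang d \<kappa> (x + m)) (ang d \<kappa> (x + n)))"
proof -
  obtain \<kappa> x k where k: "\<kappa> \<in> K d" "(l + m + n - \<sigma>) + 3 * x = \<kappa> + int d * k" using K_solve by blast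
  have "(x + l) + (x + m) + (x + n) - (\<kappa> + \<sigma>) = int d * k" using k(2) by simp
  then have "int d dvd (x + l) + (x + m) + (x + n) - (\<kappa> + \<sigma>)" by simp
  then have e: "elementary d \<kappa> \<sigma> (x + l) (x + m) (x + n)"
    using \<sigma> ne unfolding elementary_iff[OF d2] by simp
  define z1 where "z1 = rot d \<kappa> * \<Sum>(E d ` {x + l, x + m, x + n})"
  define w1 where "w1 = rot d \<kappa> * (cis (2 * (of_int \<sigma> * pi / real d)) - 1) * E d x"
  have D: "decorated d \<sigma> (ang d \<kappa> (x + l)) (ang d \<kappa> (x + m)) (ang d \<kappa> (x + n)) = DT d z1 w1 \<sigma> (E d ` {l, m, n})"
    unfolding decorated_DT[OF e] z1_def[symmetric] unfolding E_shift w1_def by (rule DT_rotate) simp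
  have sp: "0 < sin (pi / real d)" using d2 by (intro sin_gt_zero) (auto simp: field_simps)
  have w1: "cmod w1 = 2 * sin (pi / real d)"
    unfolding w1_def norm_mult norm_cis_minus_1 using \<sigma> sp by auto
  then have "w1 \<noteq> 0" using sp by auto
  define u where "u = w / w1"
  show ?thesis
  proof (rule that[OF k(1) e])
    show "cmod u = 1" using w w1 sp by (simp add: u_def norm_divide)
    show "DT d z0 w \<sigma> (E d ` {l, m, n}) = dmap (\<lambda>z. u * z + (z0 - u * z1))
       (decorated d \<sigma> (ang d \<kappa> (x + l)) (ang d \<kappa> (x + m)) (ang d \<kappa> (x + n)))"
      unfolding D dmap_DT using \<open>w1 \<noteq> 0\<close> by (simp add: u_def)
  qed
qed

text \<open>The shift by \<theta> moves all indices by one integer \<open>x\<close> and takes their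
  sum to \<kappa>' - \<sigma> * p modulo \<open>d\<close>. This gives the level, which is
  \<open>d - p\<close> for sign -1, and the circumradius \<open>2 * sin (p * pi / d)\<close>; the
  angles are kept.\<close>

lemma inflation_exists:
  assumes \<kappa>: "\<kappa> \<in> K d" and e: "elementary d \<kappa> \<sigma> l m n" and o: "l < m" "m < n" "n < l + int d"
    and p: "0 < p" "p < d" and M: "M = (if \<sigma> = 1 then int p else int d - int p)"
  obtains \<kappa>' x u v where "\<kappa>' \<in> K d" "frame d \<kappa>' M (x + l) (x + m) (x + n)" "cmod u = 1"
    "inflation_data d p (decorated d \<sigma> (ang d \<kappa> l) (ang d \<kappa> m) (ang d \<kappa> n)) \<kappa>' (Tri d \<kappa>' (x + l) (x + m) (x + n)) (\<lambda>z. u * z + v)"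
    "(\<lambda>z. u * z + v) ` Tri d \<kappa>' (x + l) (x + m) (x + n) = (\<lambda>z. iota d p *\<^sub>R z) ` Tri d \<kappa> l m n"
proof -
  note el = elementary_Tri[OF d2 e]
  have \<sigma>: "\<sigma> = 1 \<or> \<sigma> = - 1" and s: "int d dvd l + m + n - (\<kappa> + \<sigma>)" using e by (auto simp: elementary_iff[OF d2])
  have s': "int d dvd m + l + n - (\<kappa> + \<sigma>)" "int d dvd n + l + m - (\<kappa> + \<sigma>)" using s by (simp_all add: algebra_simps)
  obtain \<kappa>' x k where k: "\<kappa>' \<in> K d" "(\<kappa> + \<sigma> * (int p + 1)) + 3 * x = \<kappa>' + int d * k" using K_solve by blast
  let ?a = "x + l" and ?b = "x + m" and ?c = "x + n"
  have t: "int d dvd ?a + ?b + ?c - (\<kappa>' + - \<sigma> * int p)"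
  proof -
    have eq: "?a + ?b + ?c - (\<kappa>' + - \<sigma> * int p) = (l + m + n - (\<kappa> + \<sigma>)) + int d * k"
      using k(2) by (simp add: algebra_simps)
    show ?thesis unfolding eq using s by simp
  qed
  then have t': "int d dvd ?b + ?a + ?c - (\<kappa>' + - \<sigma> * int p)" "int d dvd ?c + ?a + ?b - (\<kappa>' + - \<sigma> * int p)" by (simp_all add: algebra_simps)
  have f: "frame d \<kappa>' M ?a ?b ?c"
  proof -
    have eq: "?a + ?b + ?c + M - \<kappa>' = (?a + ?b + ?c - (\<kappa>' + - \<sigma> * int p)) + (if \<sigma> = 1 then 0 else int d)"
      using \<sigma> M by auto
    have "int d dvd ?a + ?b + ?c + M - \<kappa>'" unfolding eq using t by (cases "\<sigma> = 1") simp_all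
    then show ?thesis using o p M by (simp add: frame_def)
  qed
  note fT = frame_Tri[OF d2 f]
  define z0 where "z0 = rot d \<kappa> * (E d l + E d m + E d n)"
  define w where "w = rot d \<kappa> * (cis (2 * (of_int \<sigma> * pi / real d)) - 1)"
  define z1 where "z1 = rot d \<kappa>' * (E d ?a + E d ?b + E d ?c)"
  define w1 where "w1 = rot d \<kappa>' * (cis (2 * (of_int (- \<sigma> * int p) * pi / real d)) - 1)"
  have v: "ptf d \<kappa> m n = z0 + w * E d l" "ptf d \<kappa> l n = z0 + w * E d m" "ptf d \<kappa> l m = z0 + w * E d n"
    using ptf_E[OF s] ptf_E[OF s'(1)] ptf_E[OF s'(2)] by (simp_all add: z0_def w_def algebra_simps)
  have v1: "ptf d \<kappa>' ?b ?c = z1 + w1 * E d ?a" "ptf d \<kappa>' ?a ?c = z1 + w1 * E d ?b" "ptf d \<kappa>' ?a ?b = z1 + w1 * E d ?c"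
    using ptf_E[OF t] ptf_E[OF t'(1)] ptf_E[OF t'(2)] by (simp_all only: z1_def w1_def) (simp_all only: add_ac)
  have s1: "0 < sin (pi / real d)" using d2 by (intro sin_gt_zero) (auto simp: field_simps)
  have sp: "0 < sin (real p * pi / real d)" using p d2 by (intro sin_gt_zero) (auto simp: field_simps)
  have nw: "cmod w = 2 * sin (pi / real d)"
    unfolding w_def norm_mult norm_cis_minus_1 using \<sigma> s1 by auto
  have nw1: "cmod w1 = 2 * sin (real p * pi / real d)"
    unfolding w1_def norm_mult norm_cis_minus_1 using \<sigma> sp by auto
  have io: "iota d p = sin (real p * pi / real d) / sin (pi / real d)" by (simp add: iota_def s_def)
  have "w1 \<noteq> 0" using nw1 sp by auto
  \<comment> \<open>The factor \<open>E d x\<close> undoes the common shift of the indices, which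
    turns all vertices by the same root of unity.\<close>
  define u where "u = of_real (iota d p) * w / (w1 * E d x)"
  define v' where "v' = of_real (iota d p) * z0 - u * z1"
  have nu: "cmod u = 1" unfolding u_def norm_divide norm_mult norm_of_real nw nw1 unfolding io norm_E using s1 sp by simp
  have h: "u * (z1 + w1 * E d (x + j)) + v' = iota d p *\<^sub>R (z0 + w * E d j)" for j
    using \<open>w1 \<noteq> 0\<close> unfolding v'_def u_def E_add by (simp add: scaleR_conv_of_real field_simps)
  define \<theta> where "\<theta> = (- real_of_int \<sigma> * (real p + 1) + real_of_int k * real d) * pi / (3 * real d)"
  have a: "ang d \<kappa> j + \<theta> = ang d \<kappa>' (x + j)" for j
  proof -
    have "real_of_int (\<kappa> + \<sigma> * (int p + 1) + 3 * x) = real_of_int (\<kappa>' + int d * k)" unfolding of_int_eq_iff by (rule k(2))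
    then have "(3 * real_of_int j - \<kappa>) + (- real_of_int \<sigma> * (real p + 1) + real_of_int k * real d) = 3 * (x + j) - \<kappa>'"
      by (simp add: algebra_simps)
    then have "((3 * real_of_int j - \<kappa>) + (- real_of_int \<sigma> * (real p + 1) + real_of_int k * real d)) * pi / (3 * real d) = (3 * (x + j) - \<kappa>') * pi / (3 * real d)"
      by simp
    then show ?thesis unfolding ang_def \<theta>_def by (simp add: add_divide_distrib distrib_right)
  qed
  have meet: "meet (ang d \<kappa>'' i) (ang d \<kappa>'' j) = ptf d \<kappa>'' i j" if "\<not> int d dvd i - j" for i j \<kappa>''
    using that meet_eq_pt sin_angr_diff[OF d2, of \<kappa>'' i j] sg_zero_iff[OF d2, of "i - j"] by (simp add: ang_angr ptf_def)
  show ?thesis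
  proof (rule that[OF k(1) f nu])
    show "inflation_data d p (decorated d \<sigma> (ang d \<kappa> l) (ang d \<kappa> m) (ang d \<kappa> n)) \<kappa>' (Tri d \<kappa>' ?a ?b ?c) (\<lambda>z. u * z + v')"
      unfolding inflation_data_def
    proof (rule exI[of _ \<kappa>], rule exI[of _ \<sigma>], rule exI[of _ l], rule exI[of _ m], rule exI[of _ n], rule exI[of _ \<theta>],
        rule exI[of _ "ang d \<kappa> l"], rule exI[of _ "ang d \<kappa> m"], rule exI[of _ "ang d \<kappa> n"], intro conjI)
      show "\<exists>k. 3 * \<theta> = - real_of_int \<sigma> * (real p + 1) * pi / real d + real_of_int k * pi"
        using d2 by (intro exI[of _ k]) (simp add: \<theta>_def field_simps)
      show "{ang d \<kappa> l + \<theta>, ang d \<kappa> m + \<theta>, ang d \<kappa> n + \<theta>} \<subseteq> range (ang d \<kappa>')" unfolding a by blast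
    qed (use \<kappa> e k nu in \<open>simp_all add: a Tri_def meet el fT v v1 h isometry_direct del: of_int_add\<close>)
    have "(\<lambda>z. u * z + v') ` Tri d \<kappa>' ?a ?b ?c = convex hull {iota d p *\<^sub>R (z0 + w * E d l), iota d p *\<^sub>R (z0 + w * E d m), iota d p *\<^sub>R (z0 + w * E d n)}"
      unfolding Tri_iff(2)[OF d2 fT] convex_hull_complex_affine v1 by (simp only: image_insert image_empty h)
    also have "\<dots> = (\<lambda>z. iota d p *\<^sub>R z) ` Tri d \<kappa> l m n"
      unfolding Tri_iff(2)[OF d2 el] v using convex_hull_scaling[of "iota d p" "{z0 + w * E d l, z0 + w * E d m, z0 + w * E d n}"] by simp
    finally show "(\<lambda>z. u * z + v') ` Tri d \<kappa>' ?a ?b ?c = (\<lambda>z. iota d p *\<^sub>R z) ` Tri d \<kappa> l m n" .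
  qed
qed

end

section \<open>Tilings obtained by inflation\<close>

definition scaled :: "real \<Rightarrow> (complex \<Rightarrow> complex) \<Rightarrow> complex \<Rightarrow> complex" where
  "scaled l f = (\<lambda>x. l *\<^sub>R f (x /\<^sub>R l))"

lemma scaled_comp: "l \<noteq> 0 \<Longrightarrow> scaled l (f \<circ> g) = scaled l f \<circ> scaled l g"
  by (simp add: scaled_def fun_eq_iff)

lemma isometry_scaled:
  assumes "l > 0" "isometry f" shows "isometry (scaled l f)"
proof -
  have "norm (f (x /\<^sub>R l) - f (y /\<^sub>R l)) = norm (x - y) / l" for x y
  proof -
    have "norm (f (x /\<^sub>R l) - f (y /\<^sub>R l)) = norm (x /\<^sub>R l - y /\<^sub>R l)"
      using assms(2) by (simp add: isometry_def dist_norm)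
    also have "x /\<^sub>R l - y /\<^sub>R l = (x - y) /\<^sub>R l" by (simp add: scaleR_diff_right)
    finally show ?thesis using assms(1) by (simp add: divide_inverse mult.commute)
  qed
  then show ?thesis using assms(1) by (simp add: isometry_def scaled_def dist_norm flip: scaleR_diff_right)
qed

lemma interior_scale: "l \<noteq> 0 \<Longrightarrow> interior ((\<lambda>x. l *\<^sub>R x) ` A) = (\<lambda>x. l *\<^sub>R x) ` interior A" for A :: "complex set"
  by (rule interior_injective_linear_image) (auto simp: inj_on_def)

lemma dist_scale: "dist (c *\<^sub>R x) (c *\<^sub>R y) = \<bar>c\<bar> * dist x y" for x y :: complex
  by (simp add: dist_norm flip: scaleR_diff_right)

lemma nonoverlapping_isometry:
  assumes h: "isometry h" and supp: "\<And>T. supp (act h T) = h ` supp T" and Y: "nonoverlapping supp Y"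
  shows "nonoverlapping supp (act h ` Y)"
  unfolding nonoverlapping_def
proof (intro ballI impI)
  have inj: "inj h" using isometry_bij[OF h] by (rule bij_is_inj)
  fix V W assume "V \<in> act h ` Y" "W \<in> act h ` Y" "V \<noteq> W"
  then obtain V' W' where V: "V = act h V'" "W = act h W'" "V' \<in> Y" "W' \<in> Y" "V' \<noteq> W'" by blast
  then have "interior (supp V') \<inter> interior (supp W') = {}" using Y unfolding nonoverlapping_def by blast
  then have "h ` (interior (supp V') \<inter> interior (supp W')) = {}" by simp
  then show "interior (supp V) \<inter> interior (supp W) = {}" unfolding V(1,2) supp isometry_interior[OF h] image_Int[OF inj] .
qed

text \<open>\<open>grp\<close> will be the group of all isometries for the random rules and that of
  the direct ones for the deterministic rules, since types are invariant under direct isometries.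
  \<open>D\<close> picks one patch for each located tile; only \<open>R\<close> is required to be
  equivariant.\<close>

locale substitution =
  fixes act :: "(complex \<Rightarrow> complex) \<Rightarrow> 't \<Rightarrow> 't" and supp :: "'t \<Rightarrow> complex set"
    and protos :: "'t set" and R :: "'t \<Rightarrow> 't set set" and l :: real
    and tiles :: "'t set" and grp :: "(complex \<Rightarrow> complex) set" and D :: "'t \<Rightarrow> 't set" and m :: real
  assumes act_comp: "act (f \<circ> g) T = act f (act g T)"
    and act_id: "act id T = T"
    and supp_act: "supp (act f T) = f ` supp T"
    and grp_isometry: "f \<in> grp \<Longrightarrow> isometry f"
    and grp_comp: "f \<in> grp \<Longrightarrow> g \<in> grp \<Longrightarrow> f \<circ> g \<in> grp"
    and grp_inv: "f \<in> grp \<Longrightarrow> inv f \<in> grp"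
    and grp_scaled: "f \<in> grp \<Longrightarrow> scaled l f \<in> grp"
    and tiles_protos: "T \<in> tiles \<Longrightarrow> \<exists>f\<in>grp. \<exists>U\<in>protos. T = act f U"
    and tiles_act: "f \<in> grp \<Longrightarrow> T \<in> tiles \<Longrightarrow> act f T \<in> tiles"
    and R_act: "P \<in> R U \<Longrightarrow> f \<in> grp \<Longrightarrow> act (scaled l f) ` P \<in> R (act f U)"
    and D_rule: "U \<in> tiles \<Longrightarrow> D U \<in> R U"
    and D_finite: "U \<in> tiles \<Longrightarrow> finite (D U)"
    and D_tiles: "U \<in> tiles \<Longrightarrow> D U \<subseteq> tiles"
    and D_nonoverlapping: "U \<in> tiles \<Longrightarrow> nonoverlapping supp (D U)"
    and D_cover: "U \<in> tiles \<Longrightarrow> \<Union>(supp ` D U) = (\<lambda>x. l *\<^sub>R x) ` supp U"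
    and l_gt_1: "l > 1"
    and supp_compact: "T \<in> tiles \<Longrightarrow> compact (supp T)"
    and supp_interior: "T \<in> tiles \<Longrightarrow> interior (supp T) \<noteq> {}"
    and supp_diam: "T \<in> tiles \<Longrightarrow> x \<in> supp T \<Longrightarrow> y \<in> supp T \<Longrightarrow> dist x y \<le> m"
begin

lemma act_inv: "f \<in> grp \<Longrightarrow> act (inv f) (act f T) = T" "f \<in> grp \<Longrightarrow> act f (act (inv f) T) = T"
proof -
  assume "f \<in> grp"
  then have b: "bij f" using grp_isometry isometry_bij by blast
  show "act (inv f) (act f T) = T" "act f (act (inv f) T) = T"
    using b by (simp_all flip: act_comp add: act_id bij_is_inj bij_is_surj surj_iff[THEN iffD1])
qed

section \<open>Iteration of the chosen patches\<close>

definition sub :: "'t set \<Rightarrow> 't set" where "sub P = (\<Union>U\<in>P. D U)"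

lemma sub_mono: "P \<subseteq> Q \<Longrightarrow> sub P \<subseteq> sub Q" by (auto simp: sub_def)

lemma sub_pow_mono: "P \<subseteq> Q \<Longrightarrow> (sub ^^ n) P \<subseteq> (sub ^^ n) Q"
  by (induction n) (auto simp: sub_mono)

lemma sub_tiles: "P \<subseteq> tiles \<Longrightarrow> sub P \<subseteq> tiles" using D_tiles by (auto simp: sub_def)

lemma sub_pow_tiles: "P \<subseteq> tiles \<Longrightarrow> (sub ^^ n) P \<subseteq> tiles"
  by (induction n) (auto simp: sub_tiles)

lemma sub_countable: "countable P \<Longrightarrow> P \<subseteq> tiles \<Longrightarrow> countable (sub P)"
  unfolding sub_def using D_finite by (intro countable_UN) (auto intro: countable_finite)

lemma sub_pow_countable: "countable P \<Longrightarrow> P \<subseteq> tiles \<Longrightarrow> countable ((sub ^^ n) P)"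
  by (induction n) (auto simp: sub_countable sub_pow_tiles)

lemma sub_cover: "P \<subseteq> tiles \<Longrightarrow> \<Union>(supp ` sub P) = (\<lambda>x. l *\<^sub>R x) ` \<Union>(supp ` P)"
proof -
  assume P: "P \<subseteq> tiles"
  have "\<Union>(supp ` sub P) = (\<Union>U\<in>P. \<Union>(supp ` D U))" by (auto simp: sub_def)
  also have "\<dots> = (\<Union>U\<in>P. (\<lambda>x. l *\<^sub>R x) ` supp U)" by (rule SUP_cong[OF refl]) (use D_cover P in blast)
  finally show ?thesis by (simp add: image_UN)
qed

lemma sub_pow_cover: "P \<subseteq> tiles \<Longrightarrow> \<Union>(supp ` (sub ^^ n) P) = (\<lambda>x. l ^ n *\<^sub>R x) ` \<Union>(supp ` P)"
proof (induction n)
  case (Suc n)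
  have "\<Union>(supp ` (sub ^^ Suc n) P) = (\<lambda>x. l *\<^sub>R x) ` \<Union>(supp ` (sub ^^ n) P)"
    using sub_cover[OF sub_pow_tiles[OF Suc.prems]] by simp
  then show ?case unfolding Suc.IH[OF Suc.prems] by (simp only: image_image scaleR_scaleR power_Suc)
qed simp

lemma sub_nonoverlapping:
  assumes P: "P \<subseteq> tiles" "nonoverlapping supp P" shows "nonoverlapping supp (sub P)"
  unfolding nonoverlapping_def
proof (intro ballI impI)
  fix T T' assume T: "T \<in> sub P" "T' \<in> sub P" "T \<noteq> T'"
  then obtain U U' where U: "U \<in> P" "T \<in> D U" "U' \<in> P" "T' \<in> D U'" by (auto simp: sub_def)
  show "interior (supp T) \<inter> interior (supp T') = {}"
  proof (cases "U = U'")
    case True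
    then show ?thesis using U T D_nonoverlapping P(1) unfolding nonoverlapping_def by blast
  next
    case False
    have i: "interior (supp V) \<subseteq> (\<lambda>x. l *\<^sub>R x) ` interior (supp W)" if "W \<in> P" "V \<in> D W" for V W
    proof -
      have "supp V \<subseteq> (\<lambda>x. l *\<^sub>R x) ` supp W" using D_cover[of W] that P(1) by blast
      then have "interior (supp V) \<subseteq> interior ((\<lambda>x. l *\<^sub>R x) ` supp W)" by (rule interior_mono)
      then show ?thesis using l_gt_1 by (simp add: interior_scale)
    qed
    have "interior (supp U) \<inter> interior (supp U') = {}"
      using P(2) U False unfolding nonoverlapping_def by blast
    moreover have "inj (\<lambda>x::complex. l *\<^sub>R x)" using l_gt_1 by (auto simp: inj_on_def)
    ultimately have "(\<lambda>x. l *\<^sub>R x) ` interior (supp U) \<inter> (\<lambda>x. l *\<^sub>R x) ` interior (supp U') = {}"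
      by (simp flip: image_Int)
    then show ?thesis using i[OF U(1,2)] i[OF U(3,4)] by blast
  qed
qed

lemma sub_pow_nonoverlapping:
  "P \<subseteq> tiles \<Longrightarrow> nonoverlapping supp P \<Longrightarrow> nonoverlapping supp ((sub ^^ n) P)"
  by (induction n) (auto simp: sub_nonoverlapping sub_pow_tiles)

lemma nonoverlapping_act: "f \<in> grp \<Longrightarrow> nonoverlapping supp P \<Longrightarrow> nonoverlapping supp (act f ` P)"
  by (rule nonoverlapping_isometry[of _ supp act, OF grp_isometry supp_act])

lemma iterates_act: "Q \<in> iterates R n T \<Longrightarrow> f \<in> grp \<Longrightarrow> act ((scaled l ^^ n) f) ` Q \<in> iterates R n (act f T)"
proof (induction n arbitrary: Q)
  case (Suc n)
  let ?f = "(scaled l ^^ n) f"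
  have f: "?f \<in> grp" by (induction n) (use Suc.prems grp_scaled in auto)
  obtain P Q' where P: "P \<in> iterates R n T" "\<forall>U\<in>P. Q' U \<in> R U" "Q = (\<Union>U\<in>P. Q' U)" using Suc.prems by auto
  have "act (scaled l ?f) ` Q = (\<Union>V\<in>act ?f ` P. act (scaled l ?f) ` Q' (act (inv ?f) V))"
    unfolding P(3) by (simp add: image_UN act_inv[OF f])
  moreover have "\<forall>V\<in>act ?f ` P. act (scaled l ?f) ` Q' (act (inv ?f) V) \<in> R V"
    using R_act[OF _ f] P(2) by (auto simp: act_inv[OF f])
  ultimately show ?case using Suc.IH[OF P(1) Suc.prems(2)] unfolding iterates.simps funpow.simps o_apply by blast
qed simp

lemma sub_iterates:
  assumes P: "P \<subseteq> tiles" "f \<in> grp" "act f ` P \<in> iterates R n T"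
  shows "act (scaled l f) ` sub P \<in> iterates R (Suc n) T"
proof -
  have "act (scaled l f) ` sub P = (\<Union>V\<in>act f ` P. act (scaled l f) ` D (act (inv f) V))"
    unfolding sub_def by (simp add: image_UN act_inv[OF P(2)])
  moreover have "\<forall>V\<in>act f ` P. act (scaled l f) ` D (act (inv f) V) \<in> R V"
  proof
    fix V assume "V \<in> act f ` P"
    then obtain U where U: "U \<in> P" "V = act f U" by blast
    have "act (scaled l f) ` D U \<in> R V" unfolding U(2) using R_act D_rule P(1,2) U(1) by blast
    then show "act (scaled l f) ` D (act (inv f) V) \<in> R V" by (simp add: U(2) act_inv[OF P(2)])
  qed
  ultimately show ?thesis using P(3) unfolding iterates.simps by blast
qed

text \<open>\<open>D\<close> chooses at the actual place of each tile, while the iterate lives on a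
  moved copy. Equivariance of \<open>R\<close> transports the choices, and the motion is conjugated
  by the inflation once per step.\<close>

lemma sub_pow_iterates:
  assumes P: "P \<subseteq> tiles" "f \<in> grp" "act f ` P \<in> iterates R k T"
  shows "act ((scaled l ^^ n) f) ` (sub ^^ n) P \<in> iterates R (n + k) T"
proof (induction n)
  case (Suc n)
  have "(scaled l ^^ n) f \<in> grp" by (induction n) (use P(2) grp_scaled in auto)
  from sub_iterates[OF sub_pow_tiles[OF P(1)] this Suc.IH] show ?case by simp
qed (use P in simp)

lemma scaled_pow_grp: "f \<in> grp \<Longrightarrow> (scaled l ^^ n) f \<in> grp"
  by (induction n) (auto simp: grp_scaled)

text \<open>A finite part of the increasing union lies in one member; moving the seed
  \<open>U\<close> back to its prototile turns an iterate of \<open>U\<close> into one of that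
  prototile.\<close>

lemma chain_tiling:
  assumes U: "U \<in> tiles" and P: "\<And>k. P k \<subseteq> P (Suc k)" "\<And>k. P k \<subseteq> tiles" "\<And>k. nonoverlapping supp (P k)"
      "\<And>k. countable (P k)" "\<And>k. \<exists>f\<in>grp. \<exists>n. act f ` P k \<in> iterates R n U" "(\<Union>k. \<Union>(supp ` P k)) = UNIV"
  shows "(\<Union>k. P k) \<in> substitution_tilings act supp protos R"
proof -
  have mono: "P i \<subseteq> P j" if "i \<le> j" for i j using that P(1) by (rule lift_Suc_mono_le[rotated])
  have "tiles \<subseteq> copies act protos" using tiles_protos grp_isometry unfolding copies_def by blast
  then have "(\<Union>k. P k) \<subseteq> copies act protos" using P(2) by blast
  moreover have "nonoverlapping supp (\<Union>k. P k)"
    unfolding nonoverlapping_def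
  proof (intro ballI impI)
    fix V W assume "V \<in> (\<Union>k. P k)" "W \<in> (\<Union>k. P k)" "V \<noteq> W"
    then obtain i j where "V \<in> P i" "W \<in> P j" by blast
    then have "V \<in> P (max i j)" "W \<in> P (max i j)" using mono[of i "max i j"] mono[of j "max i j"] by auto
    then show "interior (supp V) \<inter> interior (supp W) = {}" using P(3)[of "max i j"] \<open>V \<noteq> W\<close> unfolding nonoverlapping_def by blast
  qed
  moreover have "countable (\<Union>k. P k)" using P(4) by simp
  moreover have "(\<Union>T\<in>(\<Union>k. P k). supp T) = UNIV" using P(6) by auto
  ultimately have t: "tiling act supp protos (\<Union>k. P k)" by (simp add: tiling_def)
  obtain h U0 where h: "h \<in> grp" "U0 \<in> protos" "U = act h U0" using tiles_protos[OF U] by blast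
  have "\<exists>T\<in>protos. \<exists>n. \<exists>Q\<in>iterates R n T. \<exists>f. isometry f \<and> act f ` A \<subseteq> Q" if A: "A \<subseteq> (\<Union>k. P k)" "finite A" for A
  proof -
    have "\<exists>k. A \<subseteq> P k" using A(2,1)
    proof (induction A rule: finite_induct)
      case (insert a A)
      then obtain k j where "A \<subseteq> P k" "a \<in> P j" by auto
      then have "insert a A \<subseteq> P (max k j)" using mono[of k "max k j"] mono[of j "max k j"] by auto
      then show ?case by blast
    qed simp
    then obtain k where k: "A \<subseteq> P k" by blast
    obtain f n where f: "f \<in> grp" "act f ` P k \<in> iterates R n U" using P(5) by blast
    let ?h = "(scaled l ^^ n) (inv h)"
    have hg: "?h \<in> grp" using h(1) grp_inv scaled_pow_grp by blast
    have "act ?h ` act f ` P k \<in> iterates R n (act (inv h) U)"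
      by (rule iterates_act[OF f(2)]) (use h(1) grp_inv in blast)
    moreover have "act (inv h) U = U0" unfolding h(3) using act_inv[OF h(1)] by simp
    moreover have "act (?h \<circ> f) ` A \<subseteq> act ?h ` act f ` P k" using k by (auto simp: act_comp image_image)
    moreover have "isometry (?h \<circ> f)" using hg f(1) grp_comp grp_isometry by blast
    ultimately show ?thesis using h(2) by metis
  qed
  then show ?thesis unfolding substitution_tilings_def using t by blast
qed

text \<open>A ball inside \<open>T\<close> is inflated until its radius exceeds the diameter bound
  \<open>m\<close>; a tile that covers its centre then stays within the ball.\<close>

lemma interior_tile:
  assumes T: "T \<in> tiles"
  obtains n V where "n > 0" "V \<in> (sub ^^ n) {T}" "supp V \<subseteq> interior ((\<lambda>x. l ^ n *\<^sub>R x) ` supp T)"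
proof -
  obtain x r where x: "r > 0" "ball x r \<subseteq> supp T"
    using supp_interior[OF T] by (metis all_not_in_conv mem_interior)
  obtain n0 where n0: "m / r < l ^ n0" using real_arch_pow[OF l_gt_1] by blast
  define n where "n = Suc n0"
  have "l ^ n0 \<le> l ^ n" unfolding n_def using l_gt_1 by (intro power_increasing) auto
  then have "m / r < l ^ n" using n0 by linarith
  then have n: "m < l ^ n * r" using x(1) by (simp add: pos_divide_less_eq)
  have lp: "l ^ n > 0" using l_gt_1 by simp
  have "x \<in> supp T" using x by force
  then have "l ^ n *\<^sub>R x \<in> \<Union>(supp ` (sub ^^ n) {T})" using sub_pow_cover[of "{T}" n] T by auto
  then obtain V where V: "V \<in> (sub ^^ n) {T}" "l ^ n *\<^sub>R x \<in> supp V" by blast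
  have Vt: "V \<in> tiles" using V(1) sub_pow_tiles[of "{T}" n] T by blast
  have "supp V \<subseteq> (\<lambda>x. l ^ n *\<^sub>R x) ` ball x r"
  proof
    fix y assume "y \<in> supp V"
    then have "dist (l ^ n *\<^sub>R x) y < l ^ n * r" using supp_diam[OF Vt V(2)] n by fastforce
    moreover have "dist (l ^ n *\<^sub>R x) y = l ^ n * dist x (y /\<^sub>R l ^ n)"
    proof -
      have "y = l ^ n *\<^sub>R (y /\<^sub>R l ^ n)" using lp l_gt_1 by simp
      then have "dist (l ^ n *\<^sub>R x) y = dist (l ^ n *\<^sub>R x) (l ^ n *\<^sub>R (y /\<^sub>R l ^ n))" by simp
      also have "\<dots> = l ^ n * dist x (y /\<^sub>R l ^ n)" using lp unfolding dist_scale by simp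
      finally show ?thesis .
    qed
    ultimately have "y /\<^sub>R l ^ n \<in> ball x r" using lp by simp
    then show "y \<in> (\<lambda>x. l ^ n *\<^sub>R x) ` ball x r" using lp l_gt_1 by (intro image_eqI[of _ _ "y /\<^sub>R l ^ n"]) auto
  qed
  also have "\<dots> = (\<lambda>x. l ^ n *\<^sub>R x) ` interior (ball x r)" by (simp add: interior_open)
  also have "\<dots> \<subseteq> (\<lambda>x. l ^ n *\<^sub>R x) ` interior (supp T)" using interior_mono[OF x(2)] by blast
  also have "\<dots> = interior ((\<lambda>x. l ^ n *\<^sub>R x) ` supp T)" by (rule interior_scale[symmetric]) (use l_gt_1 in simp)
  finally show ?thesis using that[OF _ V(1)] by (simp add: n_def)
qed

text \<open>If the interior of an inflated tile \<open>T\<close> contains a copy of \<open>T\<close>, then the iterated patches of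
  \<open>T\<close>, moved so that this copy comes to lie on \<open>T\<close>, increase and exhaust the plane.\<close>

lemma recurrent_tiling:
  assumes T: "T \<in> tiles" and n: "n > 0" and g: "g \<in> grp" "act g T \<in> (sub ^^ n) {T}"
    and i: "supp (act g T) \<subseteq> interior ((\<lambda>x. l ^ n *\<^sub>R x) ` supp T)"
  obtains X where "T \<in> X" "X \<subseteq> tiles" "sub X \<in> substitution_tilings act supp protos R"
proof -
  define nx where "nx Q = act (inv g) ` (sub ^^ n) Q" for Q
  define P where "P k = (nx ^^ k) {T}" for k
  have PS: "P (Suc k) = nx (P k)" "P 0 = {T}" for k by (simp_all add: P_def)
  have nx_mono: "Q \<subseteq> Q' \<Longrightarrow> nx Q \<subseteq> nx Q'" for Q Q' unfolding nx_def using sub_pow_mono by blast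
  have ig: "inv g \<in> grp" using g(1) grp_inv by blast
  have "act (inv g) (act g T) \<in> nx {T}" unfolding nx_def using g(2) by blast
  then have base: "T \<in> nx {T}" by (simp add: act_inv[OF g(1)])
  have mono: "P k \<subseteq> P (Suc k)" for k
  proof (induction k)
    case 0 then show ?case using base by (simp add: PS)
  next
    case (Suc k)
    then show ?case using nx_mono by (simp add: PS(1))
  qed
  have P_tiles: "P k \<subseteq> tiles" for k
  proof (induction k)
    case 0 then show ?case using T by (simp add: PS)
  next
    case (Suc k)
    then show ?case using sub_pow_tiles[OF Suc] tiles_act[OF ig] by (auto simp: PS(1) nx_def)
  qed
  have P_non: "nonoverlapping supp (P k)" for k
  proof (induction k)
    case 0 then show ?case by (simp add: PS nonoverlapping_def)
  next
    case (Suc k)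
    then show ?case unfolding PS(1) nx_def
      using nonoverlapping_act[OF ig] sub_pow_nonoverlapping[OF P_tiles] by blast
  qed
  have P_cnt: "countable (P k)" for k
    by (induction k) (auto simp: PS nx_def intro!: sub_pow_countable P_tiles)
  have P_it: "\<exists>f\<in>grp. \<exists>j. act f ` P k \<in> iterates R j T" for k
  proof (induction k)
    case 0
    have "g \<circ> inv g = id" using isometry_bij[OF grp_isometry[OF g(1)]] by (simp add: bij_is_surj surj_iff[THEN iffD1])
    then have "id \<in> grp" using grp_comp[OF g(1) ig] by simp
    moreover have "act id ` P 0 \<in> iterates R 0 T" by (simp add: PS act_id)
    ultimately show ?case by blast
  next
    case (Suc k)
    then obtain f j where f: "f \<in> grp" "act f ` P k \<in> iterates R j T" by blast
    let ?f = "(scaled l ^^ n) f"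
    have 1: "act ?f ` (sub ^^ n) (P k) \<in> iterates R (n + j) T" by (rule sub_pow_iterates[OF P_tiles f])
    have "act (?f \<circ> g) ` P (Suc k) = act ?f ` (sub ^^ n) (P k)"
      unfolding PS(1) nx_def image_image by (simp add: act_comp act_inv[OF g(1)])
    then show ?case using 1 grp_comp[OF scaled_pow_grp[OF f(1)] g(1)] by metis
  qed
  define A where "A = supp T"
  define L where "L = l ^ n"
  have L: "L > 1" unfolding L_def using l_gt_1 n by (simp add: one_less_power)
  \<comment> \<open>The expansion that \<open>nx\<close> induces on supports; \<open>e'\<close> is
    its inverse and divides distances by \<open>L\<close>.\<close>
  define e where "e x = inv g (L *\<^sub>R x)" for x
  define e' where "e' y = g y /\<^sub>R L" for y
  have bg: "bij g" using isometry_bij[OF grp_isometry[OF g(1)]] .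
  have e': "e (e' y) = y" for y using L bg by (simp add: e_def e'_def bij_is_inj)
  have e'_dist: "dist (e' x) (e' y) = dist x y / L" for x y
  proof -
    have "dist (e' x) (e' y) = dist (g x) (g y) / L"
      using L by (simp add: e'_def dist_scale divide_inverse mult.commute)
    then show ?thesis using grp_isometry[OF g(1)] by (simp add: isometry_def)
  qed
  have cover: "\<Union>(supp ` P k) = (e ^^ k) ` A" for k
  proof (induction k)
    case 0 then show ?case by (simp add: PS A_def)
  next
    case (Suc k)
    have "\<Union>(supp ` P (Suc k)) = inv g ` \<Union>(supp ` (sub ^^ n) (P k))"
      unfolding PS(1) nx_def by (auto simp: supp_act)
    also have "\<dots> = e ` \<Union>(supp ` P k)"
      unfolding sub_pow_cover[OF P_tiles] e_def L_def by (simp add: image_image)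
    finally show ?case unfolding Suc by (simp add: image_image)
  qed
  have "g ` A \<subseteq> interior ((\<lambda>x. L *\<^sub>R x) ` A)" using i by (simp add: supp_act A_def L_def)
  have "compact (g ` A)"
  proof -
    have "continuous_on A g"
      using grp_isometry[OF g(1)] unfolding isometry_def continuous_on_iff by auto
    then show ?thesis using supp_compact[OF T] compact_continuous_image by (simp add: A_def)
  qed
  then obtain \<delta> where \<delta>: "\<delta> > 0" "(\<Union>x\<in>g ` A. ball x \<delta>) \<subseteq> interior ((\<lambda>x. L *\<^sub>R x) ` A)"
    using compact_subset_open_imp_ball_epsilon_subset[OF _ open_interior \<open>g ` A \<subseteq> _\<close>] by blast
  have near: "y \<in> e ` A" if "a \<in> A" "dist a y < \<delta>" for a y
  proof -
    have "g y \<in> ball (g a) \<delta>" using that(2) grp_isometry[OF g(1)] by (simp add: isometry_def)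
    then have "g y \<in> (\<lambda>x. L *\<^sub>R x) ` A" using \<delta>(2) that(1) interior_subset by blast
    then obtain b where "b \<in> A" "g y = L *\<^sub>R b" by blast
    then have "e b = y" using bg by (simp add: e_def bij_is_inj flip: \<open>g y = L *\<^sub>R b\<close>)
    then show ?thesis using \<open>b \<in> A\<close> by blast
  qed
  \<comment> \<open>Pulling back by \<open>e'\<close> shrinks distances by the factor
    \<open>L\<close>, so the margin \<delta> of one step grows to \<open>L ^ k * \<delta>\<close>;
    every point of the plane is eventually reached.\<close>
  have near_k: "y \<in> (e ^^ Suc k) ` A" if "a \<in> A" "dist a y < L ^ k * \<delta>" for a y k
    using that
  proof (induction k arbitrary: a y)
    case 0 then show ?case using near by simp
  next
    case (Suc k)
    have "a \<in> e ` A" using near[OF Suc.prems(1), of a] \<delta>(1) by simp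
    then obtain b where "b \<in> A" "a = e b" by blast
    have "e' a = b" using L bg by (simp add: \<open>a = e b\<close> e_def e'_def bij_is_surj surj_f_inv_f)
    then have "e' a \<in> A" using \<open>b \<in> A\<close> by simp
    moreover have "dist (e' a) (e' y) < L ^ k * \<delta>" unfolding e'_dist using Suc.prems(2) L by (simp add: field_simps)
    ultimately have "e' y \<in> (e ^^ Suc k) ` A" by (rule Suc.IH)
    then have "e (e' y) \<in> e ` (e ^^ Suc k) ` A" by blast
    then show ?case unfolding e' by (simp add: image_image)
  qed
  have all: "(\<Union>k. \<Union>(supp ` P k)) = UNIV"
  proof -
    have "y \<in> (\<Union>k. (e ^^ k) ` A)" for y
    proof -
      obtain a where a: "a \<in> A" using supp_interior[OF T] interior_subset by (auto simp: A_def)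
      obtain k where "dist a y / \<delta> < L ^ k" using real_arch_pow[OF L] by blast
      then have "dist a y < L ^ k * \<delta>" using \<delta>(1) by (simp add: field_simps)
      then show ?thesis using near_k[OF a] by blast
    qed
    then show ?thesis unfolding cover by blast
  qed
  \<comment> \<open>One more inflation is applied to the whole chain, so that the tiling contains
    not just \<open>T\<close> but the entire patch \<open>D T\<close>.\<close>
  have "sub (\<Union>k. P k) = (\<Union>k. sub (P k))" by (auto simp: sub_def)
  moreover have "(\<Union>k. sub (P k)) \<in> substitution_tilings act supp protos R"
  proof (rule chain_tiling[OF T])
    show "sub (P k) \<subseteq> sub (P (Suc k))" for k using mono by (rule sub_mono)
    show "sub (P k) \<subseteq> tiles" for k by (rule sub_tiles[OF P_tiles])
    show "nonoverlapping supp (sub (P k))" for k by (rule sub_nonoverlapping[OF P_tiles P_non])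
    show "countable (sub (P k))" for k by (rule sub_countable[OF P_cnt P_tiles])
    show "\<exists>f\<in>grp. \<exists>n. act f ` sub (P k) \<in> iterates R n T" for k
    proof -
      obtain f j where f: "f \<in> grp" "act f ` P k \<in> iterates R j T" using P_it by blast
      show ?thesis using sub_iterates[OF P_tiles f] grp_scaled[OF f(1)] by blast
    qed
    have "(\<Union>k. \<Union>(supp ` sub (P k))) = (\<lambda>x. l *\<^sub>R x) ` (\<Union>k. \<Union>(supp ` P k))"
      unfolding sub_cover[OF P_tiles] by blast
    also have "\<dots> = UNIV"
    proof -
      have "y = l *\<^sub>R (y /\<^sub>R l)" for y :: complex using l_gt_1 by simp
      then show ?thesis unfolding all by blast
    qed
    finally show "(\<Union>k. \<Union>(supp ` sub (P k))) = UNIV" .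
  qed
  moreover have "T \<in> (\<Union>k. P k)" using PS(2) by blast
  ultimately show ?thesis using that P_tiles by (metis UN_least)
qed

lemma sub_pow_trans:
  assumes "V \<in> (sub ^^ n) {U}" "W \<in> (sub ^^ k) {V}" shows "W \<in> (sub ^^ (k + n)) {U}"
  using sub_pow_mono[of "{V}" "(sub ^^ n) {U}" k] assms by (auto simp: funpow_add)

lemma interior_trans:
  assumes U: "U \<in> tiles" and V: "V \<in> (sub ^^ n) {U}" and W: "W \<in> (sub ^^ k) {V}"
    and i: "supp V \<subseteq> interior ((\<lambda>x. l ^ n *\<^sub>R x) ` supp U)"
  shows "supp W \<subseteq> interior ((\<lambda>x. l ^ (k + n) *\<^sub>R x) ` supp U)"
proof -
  have Vt: "V \<in> tiles" using sub_pow_tiles[of "{U}" n] U V by blast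
  have lp: "l ^ k > 0" using l_gt_1 by simp
  have "supp W \<subseteq> (\<lambda>x. l ^ k *\<^sub>R x) ` supp V" using sub_pow_cover[of "{V}" k] Vt W by auto
  also have "\<dots> \<subseteq> (\<lambda>x. l ^ k *\<^sub>R x) ` interior ((\<lambda>x. l ^ n *\<^sub>R x) ` supp U)" using i by blast
  also have "\<dots> = interior ((\<lambda>x. l ^ k *\<^sub>R x) ` (\<lambda>x. l ^ n *\<^sub>R x) ` supp U)"
    by (rule interior_scale[symmetric]) (use l_gt_1 in simp)
  finally show ?thesis by (simp only: image_image scaleR_scaleR power_add)
qed

text \<open>Each tile of an infinite chain lies strictly inside an iterated patch of its
  predecessor. Two members are copies of the same prototile, and the motion between them exhibits
  the earlier one as recurrent.\<close>

lemma finite_protos_tiling: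
  assumes fin: "finite protos" and ne: "tiles \<noteq> {}"
  shows "substitution_tilings act supp protos R \<noteq> {}"
proof -
  define rel where "rel U V \<longleftrightarrow> V \<in> tiles \<and> (\<exists>n>0. V \<in> (sub ^^ n) {U} \<and> supp V \<subseteq> interior ((\<lambda>x. l ^ n *\<^sub>R x) ` supp U))" for U V
  have ex: "\<exists>V. rel U V" if U: "U \<in> tiles" for U
  proof -
    obtain n V where "n > 0" "V \<in> (sub ^^ n) {U}" "supp V \<subseteq> interior ((\<lambda>x. l ^ n *\<^sub>R x) ` supp U)"
      by (rule interior_tile[OF U])
    moreover have "V \<in> tiles" using calculation(2) sub_pow_tiles[of "{U}" n] that by blast
    ultimately show ?thesis unfolding rel_def by blast
  qed
  obtain U0 where U0: "U0 \<in> tiles" using ne by blast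
  define u where "u k = ((\<lambda>U. SOME V. rel U V) ^^ k) U0" for k
  have uS: "u (Suc k) = (SOME V. rel (u k) V)" for k by (simp add: u_def)
  have ut: "u k \<in> tiles" for k
  proof (induction k)
    case 0 then show ?case using U0 by (simp add: u_def)
  next
    case (Suc k)
    then show ?case using someI_ex[OF ex[OF Suc]] by (simp add: uS rel_def)
  qed
  have ur: "rel (u k) (u (Suc k))" for k unfolding uS using someI_ex[OF ex[OF ut]] .
  have ul: "rel (u i) (u (i + Suc j))" for i j
  proof (induction j)
    case 0 then show ?case using ur by simp
  next
    case (Suc j)
    then obtain n where n: "n > 0" "u (i + Suc j) \<in> (sub ^^ n) {u i}" "supp (u (i + Suc j)) \<subseteq> interior ((\<lambda>x. l ^ n *\<^sub>R x) ` supp (u i))"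
      by (auto simp: rel_def)
    obtain k where k: "k > 0" "u (Suc (i + Suc j)) \<in> (sub ^^ k) {u (i + Suc j)}" using ur[of "i + Suc j"] by (auto simp: rel_def)
    have "k + n > 0" using n by simp
    then show ?case
      using sub_pow_trans[OF n(2) k(2)] interior_trans[OF ut n(2) k(2) n(3)] ut[of "Suc (i + Suc j)"] unfolding rel_def by auto
  qed
  define c where "c U = (SOME V. V \<in> protos \<and> (\<exists>f\<in>grp. U = act f V))" for U
  have c: "c U \<in> protos \<and> (\<exists>f\<in>grp. U = act f (c U))" if "U \<in> tiles" for U
    unfolding c_def by (rule someI_ex) (use tiles_protos[OF that] in blast)
  have "\<not> inj (\<lambda>k. c (u k))"
  proof
    assume "inj (\<lambda>k. c (u k))"
    moreover have "range (\<lambda>k. c (u k)) \<subseteq> protos" using c ut by blast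
    ultimately show False using fin by (meson finite_imageD finite_subset infinite_UNIV_nat)
  qed
  then obtain i' j' where ij': "i' \<noteq> j'" "c (u i') = c (u j')" unfolding inj_on_def by blast
  obtain i j where ij: "i < j" "c (u i) = c (u j)"
    using that[of i' j'] that[of j' i'] ij' by fastforce
  obtain f where f: "f \<in> grp" "u i = act f (c (u i))" using c[OF ut] by blast
  obtain h where h: "h \<in> grp" "u j = act h (c (u j))" using c[OF ut] by blast
  have "act (h \<circ> inv f) (u i) = act h (act (inv f) (act f (c (u i))))" using f(2) act_comp by metis
  also have "\<dots> = u j" unfolding act_inv[OF f(1)] using h(2) ij(2) by simp
  finally have g: "act (h \<circ> inv f) (u i) = u j" .
  have "rel (u i) (u j)" using ul[of i "j - Suc i"] ij(1) by simp
  then obtain n where "n > 0" "u j \<in> (sub ^^ n) {u i}" "supp (u j) \<subseteq> interior ((\<lambda>x. l ^ n *\<^sub>R x) ` supp (u i))" by (auto simp: rel_def)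
  then obtain X where "sub X \<in> substitution_tilings act supp protos R"
    using recurrent_tiling[OF ut[of i], of n "h \<circ> inv f"] grp_comp[OF h(1) grp_inv[OF f(1)]] unfolding g by metis
  then show ?thesis by blast
qed

end

section \<open>Types of tiles\<close>

text \<open>A tile with angles \<open>a\<pi>/d, b\<pi>/d, c\<pi>/d\<close> (anticlockwise) and sign \<open>\<sigma>\<close> has the type
  \<open>(a, b, c, \<sigma>)\<close>; inflation produces from it a frame at level \<open>lev d M \<sigma>\<close>, whose elementary triangles
  have the types given by \<open>next_type\<close>.\<close>

definition lev :: "nat \<Rightarrow> int \<Rightarrow> int \<Rightarrow> int" where
  "lev d M \<sigma> = (if \<sigma> = 1 then M else int d - M)"

definition is_type :: "nat \<Rightarrow> int \<times> int \<times> int \<times> int \<Rightarrow> bool" where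
  "is_type d = (\<lambda>(a, b, c, \<sigma>). 0 < a \<and> 0 < b \<and> 0 < c \<and> a + b + c = int d \<and> (\<sigma> = 1 \<or> \<sigma> = -1))"

definition next_type :: "nat \<Rightarrow> int \<Rightarrow> int \<times> int \<times> int \<times> int \<Rightarrow> int \<times> int \<times> int \<times> int \<Rightarrow> bool" where
  "next_type d M = (\<lambda>(a, b, c, \<sigma>) v. \<exists>i j k \<tau>. child (lev d M \<sigma>) a b c \<tau> i j k \<and> v = (a + j - i, b + k - j, c + i - k, \<tau>))"

lemma next_type_is_type: "is_type d v \<Longrightarrow> next_type d M v v' \<Longrightarrow> is_type d v'"
  by (auto simp: is_type_def next_type_def child_def)

section \<open>A permutation of the arcs of the type graph\<close>

type_synonym arc = "(int \<times> int \<times> int \<times> int) \<times> int \<times> int \<times> int \<times> int"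

definition arc :: "nat \<Rightarrow> int \<Rightarrow> arc \<Rightarrow> bool" where
  "arc d M = (\<lambda>((a, b, c, \<sigma>), i, j, k, \<tau>). is_type d (a, b, c, \<sigma>) \<and> child (lev d M \<sigma>) a b c \<tau> i j k)"

text \<open>The new arc starts at the head of the old one and leads to a child with the sign of the
  old tail. For equal signs the offsets are rotated, which keeps their sum; for opposite signs they
  are complemented, in accordance with the exchange of the levels \<open>M\<close> and
  \<open>d - M\<close>.\<close>

definition succ_arc :: "arc \<Rightarrow> arc" where
  "succ_arc = (\<lambda>((a, b, c, \<sigma>), i, j, k, \<tau>). ((a + j - i, b + k - j, c + i - k, \<tau>),
     if \<sigma> = \<tau> then (j, k, i, \<sigma>) else (a - i - 1, b - j - 1, c - k - 1, \<sigma>)))"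

lemma arc_succ_arc:
  assumes "arc d M e" shows "arc d M (succ_arc e)"
proof -
  obtain a b c \<sigma> i j k \<tau> where e: "e = ((a, b, c, \<sigma>), i, j, k, \<tau>)" by (cases e) auto
  have "is_type d (a, b, c, \<sigma>)" and ch: "child (lev d M \<sigma>) a b c \<tau> i j k"
    using assms by (simp_all add: arc_def e)
  then have t: "a + b + c = int d" "\<sigma> = 1 \<or> \<sigma> = -1" "\<tau> = 1 \<or> \<tau> = -1"
    and bx: "0 \<le> i" "i < a" "0 \<le> j" "j < b" "0 \<le> k" "k < c" by (simp_all add: is_type_def child_def)
  have "is_type d (a + j - i, b + k - j, c + i - k, \<tau>)" using t bx by (simp add: is_type_def)
  moreover have "child (lev d M \<tau>) (a + j - i) (b + k - j) (c + i - k) \<sigma> j k i" if "\<sigma> = \<tau>"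
    using ch that unfolding child_def by (auto split: if_splits)
  \<comment> \<open>The complement has sum \<open>d - 3 - (i + j + k)\<close>: the sum
    \<open>M - 1\<close> at level \<open>M\<close> becomes \<open>d - M - 2\<close>, the sum of a
    child of sign 1 at level \<open>d - M\<close>, and conversely.\<close>
  moreover have "child (lev d M \<tau>) (a + j - i) (b + k - j) (c + i - k) \<sigma> (a - i - 1) (b - j - 1) (c - k - 1)" if "\<sigma> \<noteq> \<tau>"
  proof -
    have "(\<sigma> = 1 \<and> \<tau> = -1) \<or> (\<sigma> = -1 \<and> \<tau> = 1)" using t that by blast
    then show ?thesis using ch t(1) unfolding child_def lev_def by (elim disjE conjE) simp_all
  qed
  ultimately show ?thesis by (simp add: arc_def succ_arc_def e)
qed

lemma inj_succ_arc: "inj succ_arc"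
proof (rule injI)
  fix e e' assume eq: "succ_arc e = succ_arc e'"
  obtain a b c \<sigma> i j k \<tau> where e: "e = ((a, b, c, \<sigma>), i, j, k, \<tau>)" by (cases e) auto
  obtain a' b' c' \<sigma>' i' j' k' \<tau>' where e': "e' = ((a', b', c', \<sigma>'), i', j', k', \<tau>')" by (cases e') auto
  have "\<sigma> = \<sigma>'" "\<tau> = \<tau>'" using eq by (simp_all add: e e' succ_arc_def split: if_splits)
  then show "e = e'" using eq by (cases "\<sigma> = \<tau>") (simp_all add: e e' succ_arc_def)
qed

lemma arc_next_type:
  assumes "arc d M e" shows "next_type d M (fst e) (fst (succ_arc e))"
proof -
  obtain a b c \<sigma> i j k \<tau> where e: "e = ((a, b, c, \<sigma>), i, j, k, \<tau>)" by (cases e) auto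
  have "child (lev d M \<sigma>) a b c \<tau> i j k" using assms by (simp add: arc_def e)
  then show ?thesis unfolding e next_type_def succ_arc_def fst_conv prod.case by blast
qed

lemma finite_arcs: "finite {e. arc d M e}"
proof -
  let ?I = "{0..int d}" and ?S = "{-1, 1 :: int}"
  have "{e. arc d M e} \<subseteq> (?I \<times> ?I \<times> ?I \<times> ?S) \<times> ?I \<times> ?I \<times> ?I \<times> ?S"
    by (auto simp: arc_def is_type_def child_def)
  then show ?thesis by (rule finite_subset) simp
qed

text \<open>Every arc of the type graph is followed by exactly one arc under the injection \<open>succ_arc\<close>, so it lies
  on a closed walk; hence reachability is symmetric.\<close>

lemma next_type_return:
  assumes v: "is_type d v" and vv': "next_type d M v v'"
  shows "(next_type d M)\<^sup>*\<^sup>* v' v"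
proof -
  obtain e where e: "arc d M e" "fst e = v" "fst (succ_arc e) = v'"
    using assms by (auto simp: next_type_def arc_def succ_arc_def split: prod.splits)
  have arcs: "arc d M ((succ_arc ^^ n) e)" for n by (induction n) (auto simp: e arc_succ_arc)
  have "{y. \<exists>n. y = (succ_arc ^^ n) e} \<subseteq> {e. arc d M e}" using arcs by auto
  then have "finite {y. \<exists>n. y = (succ_arc ^^ n) e}" using finite_arcs finite_subset by blast
  then obtain n where n: "n > 0" "(succ_arc ^^ n) e = e" by (rule funpow_inj_finite[OF inj_succ_arc])
  have walk: "(next_type d M)\<^sup>*\<^sup>* v' (fst ((succ_arc ^^ Suc m) e))" for m
  proof (induction m)
    case 0 then show ?case using e by simp
  next
    case (Suc m)
    then show ?case using arc_next_type[OF arcs[of "Suc m"]] by (simp add: rtranclp.rtrancl_into_rtrancl)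
  qed
  obtain m where "n = Suc m" using n(1) gr0_conv_Suc by blast
  then show ?thesis using walk[of m] n(2) e(2) by simp
qed

lemma reachable_return:
  assumes "(next_type d M)\<^sup>*\<^sup>* v v'" "is_type d v"
  shows "(next_type d M)\<^sup>*\<^sup>* v' v \<and> is_type d v'"
  using assms
proof (induction rule: rtranclp_induct)
  case (step y z)
  then show ?case using next_type_return next_type_is_type by (metis rtranclp_trans)
qed simp

section \<open>Patches of the deterministic rules\<close>

text \<open>Centre and factor are left free, so a type is invariant under direct isometries; it
  determines a tile up to these. A tile has its type only up to cyclic rotation of the
  angles.\<close>

definition has_type :: "nat \<Rightarrow> int \<times> int \<times> int \<times> int \<Rightarrow> dtile \<Rightarrow> bool" where
  "has_type d = (\<lambda>(a, b, c, \<sigma>) V. \<exists>z0 w. cmod w = 2 * sin (pi / real d) \<and> V = DT d z0 w \<sigma> (E d ` {0, a, a + b}))"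

lemma typ_direct:
  assumes "has_type d v V" "cmod u = 1" shows "has_type d v (dmap (\<lambda>z. u * z + t) V)"
proof -
  obtain a b c \<sigma> where v: "v = (a, b, c, \<sigma>)" by (cases v)
  obtain z0 w where w: "cmod w = 2 * sin (pi / real d)" "V = DT d z0 w \<sigma> (E d ` {0, a, a + b})"
    using assms(1) unfolding has_type_def v by auto
  have "cmod (u * w) = 2 * sin (pi / real d)" using w(1) assms(2) by (simp add: norm_mult)
  then show ?thesis unfolding has_type_def v prod.case w(2) dmap_DT by blast
qed

lemma typ_DT_rotate:
  assumes "cmod w = 2 * sin (pi / real d)" "l = x" "m = x + a" "n = x + a + b"
  shows "has_type d (a, b, c, \<sigma>) (DT d z0 w \<sigma> (E d ` {l, m, n}))"
proof -
  have "E d ` {l, m, n} = (\<lambda>z. E d x * z) ` E d ` {0, a, a + b}"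
    unfolding E_shift[symmetric] using assms by (simp add: add.assoc)
  then have "DT d z0 w \<sigma> (E d ` {l, m, n}) = DT d z0 (w * E d x) \<sigma> (E d ` {0, a, a + b})"
    by (simp only: DT_rotate E_nonzero not_False_eq_True)
  moreover have "cmod (w * E d x) = 2 * sin (pi / real d)" using assms(1) by (simp add: norm_mult)
  ultimately show ?thesis unfolding has_type_def by blast
qed

lemma typ_unique_direct:
  assumes "has_type d v V" "has_type d v W" "d > 2"
  obtains u t where "cmod u = 1" "W = dmap (\<lambda>z. u * z + t) V"
proof -
  obtain a b c \<sigma> where v: "v = (a, b, c, \<sigma>)" by (cases v)
  obtain z0 w z1 w1 where 1: "cmod w = 2 * sin (pi / real d)" "V = DT d z0 w \<sigma> (E d ` {0, a, a + b})"
    "cmod w1 = 2 * sin (pi / real d)" "W = DT d z1 w1 \<sigma> (E d ` {0, a, a + b})"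
    using assms(1,2) unfolding has_type_def v by auto
  have "0 < sin (pi / real d)" using assms(3) by (intro sin_gt_zero) (auto simp: field_simps)
  then have "w \<noteq> 0" "w1 \<noteq> 0" using 1(1,3) by auto
  then have "cmod (w1 / w) = 1" using 1(1,3) \<open>0 < sin _\<close> by (simp add: norm_divide)
  moreover have "W = dmap (\<lambda>z. (w1 / w) * z + (z1 - (w1 / w) * z0)) V"
    unfolding 1 dmap_DT using \<open>w \<noteq> 0\<close> by simp
  ultimately show ?thesis using that by blast
qed

lemma scaled_direct: "l \<noteq> 0 \<Longrightarrow> scaled l (\<lambda>z. u * z + t) = (\<lambda>z. u * z + of_real l * t)"
  by (simp add: scaled_def fun_eq_iff scaleR_conv_of_real field_simps)

text \<open>Ties the gaps of the frame to the angles \<open>a, b\<close> of the tile, so that the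
  cells of the frame realise the successors in \<open>next_type\<close>.\<close>

definition framed :: "nat \<Rightarrow> nat \<Rightarrow> int \<Rightarrow> int \<Rightarrow> int \<Rightarrow> dtile \<Rightarrow> int \<Rightarrow> int \<Rightarrow> int \<Rightarrow> int \<Rightarrow> complex \<Rightarrow> complex \<Rightarrow> bool" where
  "framed d p M a b V \<kappa> \<alpha> \<beta> \<gamma> u t \<longleftrightarrow> \<kappa> \<in> K d \<and> frame d \<kappa> M \<alpha> \<beta> \<gamma> \<and> \<beta> = \<alpha> + a \<and> \<gamma> = \<alpha> + a + b \<and> cmod u = 1 \<and>
     (\<lambda>z. u * z + t) ` Tri d \<kappa> \<alpha> \<beta> \<gamma> = (\<lambda>z. iota d p *\<^sub>R z) ` fst V"

context
  fixes d :: nat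
  assumes d2: "d > 2"
begin

lemma s1_pos: "0 < sin (pi / real d)"
  using d2 by (intro sin_gt_zero) (auto simp: field_simps)

text \<open>Although the indices range over all integers, a decorated cell depends only on its sign
  and its set of roots of unity, by \<open>decorated_DT\<close>.\<close>

lemma finite_cells: "finite (cells d \<kappa> B)"
proof -
  let ?Z = "Pow (E d ` {0..<int d})"
  let ?f = "\<lambda>(\<sigma>, Z). DT d (rot d \<kappa> * \<Sum>Z) (rot d \<kappa> * (cis (2 * (of_int \<sigma> * pi / real d)) - 1)) \<sigma> Z"
  have "cells d \<kappa> B \<subseteq> ?f ` ({1, -1} \<times> ?Z)"
  proof
    fix T assume "T \<in> cells d \<kappa> B"
    then obtain \<sigma> l m n where T: "T = decorated d \<sigma> (ang d \<kappa> l) (ang d \<kappa> m) (ang d \<kappa> n)" "elementary d \<kappa> \<sigma> l m n"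
      unfolding cells_def by blast
    have "E d j \<in> E d ` {0..<int d}" for j
    proof (rule image_eqI)
      show "E d j = E d (j mod int d)" by (rule E_dvd[OF d2]) (simp add: mod_eq_dvd_iff[symmetric])
      show "j mod int d \<in> {0..<int d}" using d2 by simp
    qed
    then have "E d ` {l, m, n} \<in> ?Z" by simp
    moreover have "\<sigma> \<in> {1, -1}" using T(2) by (simp add: elementary_def)
    ultimately show "T \<in> ?f ` ({1, -1} \<times> ?Z)"
      unfolding T(1) decorated_DT[OF d2 T(2)] by (intro image_eqI[of _ _ "(\<sigma>, E d ` {l, m, n})"]) auto
  qed
  then show ?thesis by (rule finite_subset) simp
qed

lemma decorated_eq:
  assumes "elementary d \<kappa> \<sigma> l m n" "elementary d \<kappa> \<sigma>' l' m' n'"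
    and "interior (Tri d \<kappa> l m n) \<inter> interior (Tri d \<kappa> l' m' n') \<noteq> {}"
  shows "decorated d \<sigma> (ang d \<kappa> l) (ang d \<kappa> m) (ang d \<kappa> n) = decorated d \<sigma>' (ang d \<kappa> l') (ang d \<kappa> m') (ang d \<kappa> n')"
proof -
  note o = elementary_overlap[OF d2 assms]
  have "E d (j mod int d) = E d j" for j by (rule E_dvd[OF d2]) (simp add: mod_eq_dvd_iff[symmetric])
  then have "E d ` J = E d ` (\<lambda>j. j mod int d) ` J" for J by (simp add: image_image)
  then have Z: "E d ` {l, m, n} = E d ` {l', m', n'}" using o(3) by metis
  show ?thesis unfolding decorated_DT[OF d2 assms(1)] decorated_DT[OF d2 assms(2)] unfolding o(2) Z ..
qed

lemma cells_nonoverlapping: "nonoverlapping fst (cells d \<kappa> B)"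
  unfolding nonoverlapping_def
proof (intro ballI impI)
  fix T U assume TU: "T \<in> cells d \<kappa> B" "U \<in> cells d \<kappa> B" "T \<noteq> U"
  obtain \<sigma> l m n where T: "T = decorated d \<sigma> (ang d \<kappa> l) (ang d \<kappa> m) (ang d \<kappa> n)" "elementary d \<kappa> \<sigma> l m n"
    using TU(1) unfolding cells_def by blast
  obtain \<sigma>' l' m' n' where U: "U = decorated d \<sigma>' (ang d \<kappa> l') (ang d \<kappa> m') (ang d \<kappa> n')" "elementary d \<kappa> \<sigma>' l' m' n'"
    using TU(2) unfolding cells_def by blast
  show "interior (fst T) \<inter> interior (fst U) = {}"
    using decorated_eq[OF T(2) U(2)] TU(3) unfolding T(1) U(1) fst_decorated[OF d2] by blast
qed

lemma child_in_cells:
  assumes f: "frame d \<kappa> M \<alpha> \<beta> \<gamma>" and c: "child M (\<beta> - \<alpha>) (\<gamma> - \<beta>) (\<alpha> + int d - \<gamma>) \<tau> i j k"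
  shows "decorated d \<tau> (ang d \<kappa> (\<alpha> + i + up \<tau>)) (ang d \<kappa> (\<beta> + j + up \<tau>)) (ang d \<kappa> (\<gamma> + k + up \<tau>)) \<in> cells d \<kappa> (Tri d \<kappa> \<alpha> \<beta> \<gamma>)"
  unfolding cells_def Tri_def[symmetric]
  using child_elementary[OF d2 f c] child_subset_frame[OF d2 f c] by blast

text \<open>An interior point of the cell lies in some child, as the children cover the frame. The
  child is the closure of its interior, so the two interiors meet, and overlapping elementary
  triangles agree together with their decorations.\<close>

lemma cells_child:
  assumes f: "frame d \<kappa> M \<alpha> \<beta> \<gamma>" and T: "T \<in> cells d \<kappa> (Tri d \<kappa> \<alpha> \<beta> \<gamma>)"
  obtains \<tau> i j k where "child M (\<beta> - \<alpha>) (\<gamma> - \<beta>) (\<alpha> + int d - \<gamma>) \<tau> i j k"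
    "T = decorated d \<tau> (ang d \<kappa> (\<alpha> + i + up \<tau>)) (ang d \<kappa> (\<beta> + j + up \<tau>)) (ang d \<kappa> (\<gamma> + k + up \<tau>))"
proof -
  obtain \<sigma> l m n where T: "T = decorated d \<sigma> (ang d \<kappa> l) (ang d \<kappa> m) (ang d \<kappa> n)" "elementary d \<kappa> \<sigma> l m n"
     "Tri d \<kappa> l m n \<subseteq> Tri d \<kappa> \<alpha> \<beta> \<gamma>"
    using T unfolding cells_def Tri_def by blast
  note R = regular_triangle[OF Tri_iff(1)[OF d2 elementary_Tri[OF d2 T(2)]], folded Tri_iff(2)[OF d2 elementary_Tri[OF d2 T(2)]]]
  obtain x where x: "x \<in> interior (Tri d \<kappa> l m n)" using R(1) by blast
  then have "x \<in> Tri d \<kappa> \<alpha> \<beta> \<gamma>" using T(3) interior_subset by blast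
  then obtain \<tau> i j k where c: "child M (\<beta> - \<alpha>) (\<gamma> - \<beta>) (\<alpha> + int d - \<gamma>) \<tau> i j k"
     "x \<in> Tri d \<kappa> (\<alpha> + i + up \<tau>) (\<beta> + j + up \<tau>) (\<gamma> + k + up \<tau>)"
    unfolding frame_union[OF d2 f, symmetric] by auto
  let ?U = "Tri d \<kappa> (\<alpha> + i + up \<tau>) (\<beta> + j + up \<tau>) (\<gamma> + k + up \<tau>)"
  note e = child_elementary[OF d2 f c(1)]
  note R' = regular_triangle[OF Tri_iff(1)[OF d2 elementary_Tri[OF d2 e]], folded Tri_iff(2)[OF d2 elementary_Tri[OF d2 e]]]
  have "interior (Tri d \<kappa> l m n) \<inter> closure (interior ?U) \<noteq> {}" using x c(2) unfolding R'(2) by blast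
  then have "interior (Tri d \<kappa> l m n) \<inter> interior ?U \<noteq> {}"
    using open_Int_closure_eq_empty[OF open_interior] by blast
  from decorated_eq[OF T(2) e this] show ?thesis using that[OF c(1)] T(1) by simp
qed

lemma cells_union:
  assumes f: "frame d \<kappa> M \<alpha> \<beta> \<gamma>"
  shows "\<Union>(fst ` cells d \<kappa> (Tri d \<kappa> \<alpha> \<beta> \<gamma>)) = Tri d \<kappa> \<alpha> \<beta> \<gamma>"
proof
  show "\<Union>(fst ` cells d \<kappa> (Tri d \<kappa> \<alpha> \<beta> \<gamma>)) \<subseteq> Tri d \<kappa> \<alpha> \<beta> \<gamma>"
    by (auto simp: cells_def fst_decorated[OF d2] simp flip: Tri_def)
  show "Tri d \<kappa> \<alpha> \<beta> \<gamma> \<subseteq> \<Union>(fst ` cells d \<kappa> (Tri d \<kappa> \<alpha> \<beta> \<gamma>))"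
  proof
    fix x assume "x \<in> Tri d \<kappa> \<alpha> \<beta> \<gamma>"
    then obtain \<tau> i j k where c: "child M (\<beta> - \<alpha>) (\<gamma> - \<beta>) (\<alpha> + int d - \<gamma>) \<tau> i j k"
       "x \<in> Tri d \<kappa> (\<alpha> + i + up \<tau>) (\<beta> + j + up \<tau>) (\<gamma> + k + up \<tau>)"
      unfolding frame_union[OF d2 f, symmetric] by auto
    show "x \<in> \<Union>(fst ` cells d \<kappa> (Tri d \<kappa> \<alpha> \<beta> \<gamma>))"
      by (rule UnionI[OF imageI[OF child_in_cells[OF f c(1)]]]) (simp only: fst_decorated[OF d2] c(2))
  qed
qed

lemma typ_child:
  assumes f: "frame d \<kappa> M \<alpha> \<beta> \<gamma>" and c: "child M (\<beta> - \<alpha>) (\<gamma> - \<beta>) (\<alpha> + int d - \<gamma>) \<tau> i j k" and u: "cmod u = 1"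
  shows "has_type d (\<beta> - \<alpha> + j - i, \<gamma> - \<beta> + k - j, \<alpha> + int d - \<gamma> + i - k, \<tau>) (dmap (\<lambda>z. u * z + t)
    (decorated d \<tau> (ang d \<kappa> (\<alpha> + i + up \<tau>)) (ang d \<kappa> (\<beta> + j + up \<tau>)) (ang d \<kappa> (\<gamma> + k + up \<tau>))))"
proof (rule typ_direct[OF _ u])
  have \<tau>: "\<tau> = 1 \<or> \<tau> = -1" using c by (simp add: child_def)
  show "has_type d (\<beta> - \<alpha> + j - i, \<gamma> - \<beta> + k - j, \<alpha> + int d - \<gamma> + i - k, \<tau>)
    (decorated d \<tau> (ang d \<kappa> (\<alpha> + i + up \<tau>)) (ang d \<kappa> (\<beta> + j + up \<tau>)) (ang d \<kappa> (\<gamma> + k + up \<tau>)))"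
    unfolding decorated_DT[OF d2 child_elementary[OF d2 f c]]
  proof (rule typ_DT_rotate[where x = "\<alpha> + i + up \<tau>"])
    show "cmod (rot d \<kappa> * (cis (2 * (of_int \<tau> * pi / real d)) - 1)) = 2 * sin (pi / real d)"
      unfolding norm_mult norm_cis_minus_1[OF d2] norm_rot[OF d2] using \<tau> s1_pos by auto
  qed simp_all
qed

lemma typ_copy_F:
  assumes v: "is_type d (a, b, c, \<sigma>)" and V: "has_type d (a, b, c, \<sigma>) V"
  obtains \<kappa> x u t where "\<kappa> \<in> K d" "elementary d \<kappa> \<sigma> x (x + a) (x + a + b)" "cmod u = 1"
    "V = dmap (\<lambda>z. u * z + t) (decorated d \<sigma> (ang d \<kappa> x) (ang d \<kappa> (x + a)) (ang d \<kappa> (x + a + b)))"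
proof -
  obtain z0 w where w: "cmod w = 2 * sin (pi / real d)" "V = DT d z0 w \<sigma> (E d ` {0, a, a + b})"
    using V by (auto simp: has_type_def)
  have \<sigma>: "\<sigma> = 1 \<or> \<sigma> = -1" using v by (auto simp: is_type_def)
  have "\<not> int d dvd 0 - a" "\<not> int d dvd a - (a + b)" "\<not> int d dvd 0 - (a + b)"
    using v by (intro not_dvd_diff[OF d2]; auto simp: is_type_def)+
  from DT_copy_F[OF d2 \<sigma> this w(1), of z0] obtain \<kappa> x u v where "\<kappa> \<in> K d"
      "elementary d \<kappa> \<sigma> (x + 0) (x + a) (x + (a + b))" "cmod u = 1"
      "DT d z0 w \<sigma> (E d ` {0, a, a + b}) =
         dmap (\<lambda>z. u * z + v) (decorated d \<sigma> (ang d \<kappa> (x + 0)) (ang d \<kappa> (x + a)) (ang d \<kappa> (x + (a + b))))" .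
  then show ?thesis using that[of \<kappa> x u v] w(2) by (simp only: add.assoc add_0_right)
qed

lemma decorated_in_F: "\<kappa> \<in> K d \<Longrightarrow> elementary d \<kappa> \<sigma> l m n \<Longrightarrow> decorated d \<sigma> (ang d \<kappa> l) (ang d \<kappa> m) (ang d \<kappa> n) \<in> F d"
  unfolding F_def by blast

lemma iota_pos: "0 < p \<Longrightarrow> p < d \<Longrightarrow> iota d p > 0"
  using s1_pos d2 unfolding iota_def s_def by (auto intro!: divide_pos_pos sin_gt_zero simp: field_simps)

lemma dmap_direct_comp: "dmap (\<lambda>z. u * z + t) (dmap (\<lambda>z. u' * z + t') T) = dmap (\<lambda>z. (u * u') * z + (u * t' + t)) T"
  by (simp add: dmap_def image_image algebra_simps)

lemma framed_direct:
  assumes f: "framed d p M a b T \<kappa> \<alpha> \<beta> \<gamma> u t" and u': "cmod u' = 1" and p: "0 < p" "p < d"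
  shows "framed d p M a b (dmap (\<lambda>z. u' * z + t') T) \<kappa> \<alpha> \<beta> \<gamma> (u' * u) (u' * t + of_real (iota d p) * t')"
proof -
  let ?l = "iota d p"
  have "(\<lambda>z. (u' * u) * z + (u' * t + of_real ?l * t')) ` B = (\<lambda>z. u' * z + of_real ?l * t') ` (\<lambda>z. u * z + t) ` B" for B
    by (simp add: image_image algebra_simps)
  note comp = this
  have h: "(\<lambda>z. u * z + t) ` Tri d \<kappa> \<alpha> \<beta> \<gamma> = (\<lambda>z. ?l *\<^sub>R z) ` fst T" using f unfolding framed_def by blast
  have "(\<lambda>z. (u' * u) * z + (u' * t + of_real ?l * t')) ` Tri d \<kappa> \<alpha> \<beta> \<gamma> = (\<lambda>z. u' * z + of_real ?l * t') ` (\<lambda>z. ?l *\<^sub>R z) ` fst T"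
    unfolding comp h ..
  also have "\<dots> = (\<lambda>z. ?l *\<^sub>R z) ` fst (dmap (\<lambda>z. u' * z + t') T)"
    by (simp add: image_image scaleR_conv_of_real algebra_simps)
  finally show ?thesis using f u' unfolding framed_def by (auto simp: norm_mult)
qed

lemma extend_rule_direct:
  assumes P: "P \<in> R T" "T \<in> F d" and u': "cmod u' = 1" and p: "0 < p" "p < d"
    and PP: "P = dmap (\<lambda>z. u * z + t) ` C"
  shows "dmap (\<lambda>z. (u' * u) * z + (u' * t + of_real (iota d p) * t')) ` C \<in> extend_rule dmap (iota d p) (F d) R (dmap (\<lambda>z. u' * z + t') T)"
proof -
  have l: "iota d p \<noteq> 0" using iota_pos[OF p] by simp
  have "(\<lambda>x. iota d p *\<^sub>R (u' * (x /\<^sub>R iota d p) + t')) = (\<lambda>z. u' * z + of_real (iota d p) * t')"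
    using scaled_direct[OF l] by (simp add: scaled_def)
  then have "dmap (\<lambda>z. (u' * u) * z + (u' * t + of_real (iota d p) * t')) ` C = dmap (\<lambda>x. iota d p *\<^sub>R (u' * (x /\<^sub>R iota d p) + t')) ` P"
    unfolding PP by (simp only: image_image dmap_direct_comp)
  note eq = this
  show ?thesis unfolding extend_rule_def
    by (rule CollectI, rule exI[of _ "\<lambda>z. u' * z + t'"], rule exI[of _ T], rule exI[of _ P])
      (intro conjI eq isometry_direct[OF u'] P refl)
qed

lemma plus_patch:
  assumes v: "is_type d (a, b, c, \<sigma>)" and V: "has_type d (a, b, c, \<sigma>) V" and p: "0 < p" "p < d"
  obtains \<kappa> \<alpha> \<beta> \<gamma> u t where "framed d p (lev d (int p) \<sigma>) a b V \<kappa> \<alpha> \<beta> \<gamma> u t"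
    "dmap (\<lambda>z. u * z + t) ` cells d \<kappa> (Tri d \<kappa> \<alpha> \<beta> \<gamma>) \<in> extend_rule dmap (iota d p) (F d) (Phi_plus d p) V"
proof -
  obtain \<kappa> x u t where k: "\<kappa> \<in> K d" "elementary d \<kappa> \<sigma> x (x + a) (x + a + b)" "cmod u = 1"
    "V = dmap (\<lambda>z. u * z + t) (decorated d \<sigma> (ang d \<kappa> x) (ang d \<kappa> (x + a)) (ang d \<kappa> (x + a + b)))"
    using typ_copy_F[OF v V] .
  define T where "T = decorated d \<sigma> (ang d \<kappa> x) (ang d \<kappa> (x + a)) (ang d \<kappa> (x + a + b))"
  have o: "x < x + a" "x + a < x + a + b" "x + a + b < x + int d" using v by (auto simp: is_type_def)
  obtain \<kappa>' x' u' t' where i: "\<kappa>' \<in> K d" "frame d \<kappa>' (lev d (int p) \<sigma>) (x' + x) (x' + (x + a)) (x' + (x + a + b))" "cmod u' = 1"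
    "inflation_data d p T \<kappa>' (Tri d \<kappa>' (x' + x) (x' + (x + a)) (x' + (x + a + b))) (\<lambda>z. u' * z + t')"
    "(\<lambda>z. u' * z + t') ` Tri d \<kappa>' (x' + x) (x' + (x + a)) (x' + (x + a + b)) = (\<lambda>z. iota d p *\<^sub>R z) ` Tri d \<kappa> x (x + a) (x + a + b)"
    unfolding T_def using inflation_exists[OF d2 k(1,2) o p, of "lev d (int p) \<sigma>"] unfolding lev_def by blast
  let ?B = "Tri d \<kappa>' (x' + x) (x' + (x + a)) (x' + (x + a + b))"
  have fT: "framed d p (lev d (int p) \<sigma>) a b T \<kappa>' (x' + x) (x' + (x + a)) (x' + (x + a + b)) u' t'"
    using i by (simp add: framed_def T_def fst_decorated[OF d2] add.assoc)
  have "dmap (\<lambda>z. u' * z + t') ` cells d \<kappa>' ?B \<in> Phi_plus d p T" unfolding Phi_plus_def using i(4) by blast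
  moreover have "T \<in> F d" unfolding T_def by (rule decorated_in_F[OF k(1,2)])
  ultimately show ?thesis
    by (intro that[of \<kappa>' "x' + x" "x' + (x + a)" "x' + (x + a + b)" "u * u'" "u * t' + of_real (iota d p) * t"])
      (simp_all only: k(4) T_def[symmetric] framed_direct[OF fT k(3) p] extend_rule_direct[OF _ _ k(3) p refl])
qed

text \<open>Conjugation inverts \<open>cis (\<sigma> * pi / d)\<close> in the decoration and thereby
  reverses the sign. The coefficient \<open>w * q / cnj w\<close> is the one that keeps centre and
  \<open>w\<close> fixed.\<close>

lemma dmap_reflect_DT:
  assumes Z: "finite Z" "\<And>e. e \<in> Z \<Longrightarrow> cmod e = 1" and q: "q \<noteq> 0" and w: "w \<noteq> 0"
  shows "dmap (\<lambda>x. (w * q / cnj w) * cnj x + (z0 - (w * q / cnj w) * cnj z0)) (DT d z0 w \<sigma> Z) =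
     DT d z0 w (- \<sigma>) ((\<lambda>e. q * cnj e) ` Z)"
proof -
  let ?f = "\<lambda>x. (w * q / cnj w) * cnj x + (z0 - (w * q / cnj w) * cnj z0)"
  have hull: "?f ` (convex hull A) = convex hull (?f ` A)" for A
  proof -
    have "linear cnj" by (simp add: bounded_linear.linear bounded_linear_cnj)
    then have "cnj ` (convex hull A) = convex hull (cnj ` A)" by (rule convex_hull_linear_image)
    then have "(\<lambda>x. (w * q / cnj w) * x + (z0 - (w * q / cnj w) * cnj z0)) ` cnj ` (convex hull A) =
       convex hull ((\<lambda>x. (w * q / cnj w) * x + (z0 - (w * q / cnj w) * cnj z0)) ` cnj ` A)"
      by (simp only: convex_hull_complex_affine)
    then show ?thesis by (simp only: image_image)
  qed
  have f: "?f (z0 + w * g) = z0 + w * (q * cnj g)" for g using w by (simp add: field_simps)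
  have S: "\<Sum>((\<lambda>e. q * cnj e) ` Z) = q * cnj (\<Sum>Z)"
    using q by (subst sum.reindex) (auto simp: inj_on_def sum_distrib_left)
  have c: "cnj (cis x) = cis (- x)" for x by (simp add: cis_cnj)
  have g: "q * cnj ((\<Sum>Z - e) / (1 + cis (of_int \<sigma> * pi / real d))) =
     (q * cnj (\<Sum>Z) - q * cnj e) / (1 + cis (of_int (- \<sigma>) * pi / real d))" for e
    by (simp add: c right_diff_distrib)
  show ?thesis unfolding dmap_def DT_def fst_conv snd_conv hull image_image f g S by simp
qed

end

text \<open>The vertex of the decoration on a chord, in barycentric coordinates. Changing the sign
  of \<open>t\<close> swaps the two weights, that is, it reverses the subdivision of the
  chord.\<close>

lemma division_point:
  assumes "sin (B - A) \<noteq> 0" "cos t \<noteq> 0"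
  shows "(cis (2 * A) + cis (2 * B)) / (1 + cis (2 * t)) =
    of_real (sin (B - A + t) / (2 * cos t * sin (B - A))) * cis (2 * A) + of_real (sin (B - A - t) / (2 * cos t * sin (B - A))) * cis (2 * B)"
proof -
  define y where "y = B - A"
  have e: "cis (2 * A) = cis (A + B) * cis (- y)" "cis (2 * B) = cis (A + B) * cis y" by (simp_all add: cis_mult y_def)
  have c: "1 + cis (2 * t) = cis t * (2 * of_real (cos t))"
  proof -
    have "cis t * (cis t + cis (- t)) = cis (2 * t) + 1" unfolding distrib_left cis_mult by simp
    then show ?thesis using cis_add_cis_minus[of t] by (simp add: add.commute)
  qed
  have n: "of_real (cos t) \<noteq> (0::complex)" "of_real (sin y) \<noteq> (0::complex)" using assms by (simp_all add: y_def)
  have k: "(cis (- y) + cis y) * of_real (sin y) = cis t * (of_real (sin (y + t)) * cis (- y) + of_real (sin (y - t)) * cis y)"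
  proof -
    have x: "of_real (sin (y + t)) * cis (- y) + of_real (sin (y - t)) * cis y = of_real (2 * sin y * cos y) * cis (- t)"
      by (simp add: complex_eq_iff sin_add sin_diff algebra_simps)
    have "cis t * (of_real (2 * sin y * cos y) * cis (- t)) = of_real (2 * sin y * cos y) * (cis t * cis (- t))"
      by (simp only: mult_ac)
    also have "\<dots> = of_real (2 * cos y) * of_real (sin y)" unfolding cis_mult by simp
    also have "of_real (2 * cos y) = cis (- y) + cis y" using cis_add_cis_minus[of y] by (simp add: add.commute)
    finally show ?thesis unfolding x by (rule sym)
  qed
  have "(cis (2 * A) + cis (2 * B)) / (1 + cis (2 * t)) = cis (A + B) * ((cis (- y) + cis y) * of_real (sin y)) / (cis t * (2 * of_real (cos t)) * of_real (sin y))"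
    unfolding e c using n by (simp add: field_simps)
  also have "\<dots> = cis (A + B) * ((of_real (sin (y + t)) * cis (- y) + of_real (sin (y - t)) * cis y)) / (2 * of_real (cos t) * of_real (sin y))"
    unfolding k using n by (simp add: field_simps)
  also have "\<dots> = of_real (sin (y + t) / (2 * cos t * sin y)) * cis (2 * A) + of_real (sin (y - t) / (2 * cos t * sin y)) * cis (2 * B)"
    unfolding e using n by (simp add: field_simps)
  finally show ?thesis unfolding y_def .
qed

text \<open>After division by the apex \<open>e1\<close> the other two points are complex conjugates
  on the unit circle, with product 1. Hence \<open>e1\<^sup>2 * cnj x\<close> is the reflection of
  \<open>x\<close> in the axis of the triangle.\<close>

lemma unit_isosceles:
  fixes e1 e2 e3 :: complex
  assumes "cmod e1 = 1" "cmod e2 = 1" "cmod e3 = 1" "cmod (e1 - e2) = cmod (e1 - e3)" "e2 \<noteq> e3"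
  shows "e1\<^sup>2 = e2 * e3"
proof -
  have ne: "e1 \<noteq> 0" using assms(1) by auto
  define b c where "b = e2 / e1" "c = e3 / e1"
  have u: "cmod b = 1" "cmod c = 1" using assms by (simp_all add: b_c_def norm_divide)
  have "cmod (1 - b) = cmod (1 - c)"
  proof -
    have "1 - b = (e1 - e2) / e1" "1 - c = (e1 - e3) / e1" using ne by (simp_all add: b_c_def diff_divide_distrib)
    then show ?thesis using assms by (simp add: norm_divide)
  qed
  then have "(cmod (1 - b))\<^sup>2 = (cmod (1 - c))\<^sup>2" by simp
  moreover have sq: "(Re b)\<^sup>2 + (Im b)\<^sup>2 = 1" "(Re c)\<^sup>2 + (Im c)\<^sup>2 = 1"
    using u by (metis cmod_power2 one_power2)+
  ultimately have "Re b = Re c" by (simp add: cmod_power2 power2_diff)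
  moreover have "b \<noteq> c" using assms(5) ne by (simp add: b_c_def)
  moreover have "(Im b)\<^sup>2 = (Im c)\<^sup>2" using sq calculation(1) by simp
  ultimately have "Re c = Re b" "Im c = - Im b" by (auto simp: power2_eq_iff complex_eq_iff)
  then have "b * c = 1" using sq(1) by (simp add: complex_eq_iff power2_eq_square)
  then show ?thesis using ne by (simp add: b_c_def power2_eq_square field_simps)
qed

lemma triangle_vertices:
  fixes A B C A' B' C' :: complex
  assumes "\<not> collinear {A, B, C}" "\<not> collinear {A', B', C'}" "convex hull {A, B, C} = convex hull {A', B', C'}"
  shows "{A, B, C} = {A', B', C'}"
proof -
  have "\<not> affine_dependent {A, B, C}" "\<not> affine_dependent {A', B', C'}"
    using assms(1,2) by (simp_all add: collinear_3_eq_affine_dependent)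
  then have "x \<in> {A, B, C} \<longleftrightarrow> x \<in> {A', B', C'}" for x
    using extreme_point_of_convex_hull_affine_independent[of "{A, B, C}" x]
      extreme_point_of_convex_hull_affine_independent[of "{A', B', C'}" x] assms(3) by simp
  then show ?thesis by blast
qed

lemma reflection_cnj: "reflection cnj"
  unfolding reflection_def by (rule exI[of _ 1], rule exI[of _ 0]) (simp add: fun_eq_iff)

lemma cnj_convex_hull: "cnj ` (convex hull A) = convex hull (cnj ` A)"
proof -
  have "linear cnj" by (simp add: bounded_linear.linear bounded_linear_cnj)
  then show ?thesis by (rule convex_hull_linear_image)
qed

section \<open>Reversing the subdivision of the edges\<close>

context
  fixes d :: nat
  assumes d2: "d > 2"
begin

text \<open>\<open>hats\<close> asks for division points on the edges. The arguments of the weights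
  differ from the integer \<open>m - n\<close> by one half, so by \<open>sg_same\<close> both
  weights are nonnegative.\<close>

lemma E_division:
  assumes "\<sigma> = 1 \<or> \<sigma> = - 1" "\<not> int d dvd m - n"
  obtains r where "0 \<le> r" "r \<le> 1" "(E d m + E d n) / (1 + cis (of_int \<sigma> * pi / real d)) = (1 - r) *\<^sub>R E d m + r *\<^sub>R E d n"
proof -
  define A where "A = - (pi * of_int m / real d)"
  define B where "B = - (pi * of_int n / real d)"
  define t where "t = of_int \<sigma> * pi / (2 * real d)"
  have e: "E d m = cis (2 * A)" "E d n = cis (2 * B)" by (simp_all add: E_def A_def B_def mult.assoc)
  have t2: "of_int \<sigma> * pi / real d = 2 * t" by (simp add: t_def)
  have y: "sin (B - A) = sg d (of_int (m - n))" "sin (B - A + t) = sg d (of_int (m - n) + of_int \<sigma> / 2)"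
     "sin (B - A - t) = sg d (of_int (m - n) + - of_int \<sigma> / 2)"
  proof -
    have BA: "B - A = of_int (m - n) * pi / real d" by (simp add: A_def B_def diff_divide_distrib algebra_simps)
    have t: "t = (of_int \<sigma> / 2) * pi / real d" by (simp add: t_def)
    show "sin (B - A) = sg d (of_int (m - n))" "sin (B - A + t) = sg d (of_int (m - n) + of_int \<sigma> / 2)"
     "sin (B - A - t) = sg d (of_int (m - n) + - of_int \<sigma> / 2)"
      unfolding sg_def BA t by (simp_all add: distrib_right left_diff_distrib add_divide_distrib diff_divide_distrib)
  qed
  have nz: "sin (B - A) \<noteq> 0" unfolding y sg_zero_iff[OF d2] using assms(2) .
  have pd: "0 < pi / (2 * real d)" "pi / (2 * real d) < pi / 2" using d2 by (auto simp: field_simps)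
  have ct: "cos t > 0"
  proof -
    have "cos t = cos (pi / (2 * real d))" using assms(1) by (auto simp: t_def)
    then show ?thesis using pd by (simp add: cos_gt_zero)
  qed
  define r where "r = sin (B - A - t) / (2 * cos t * sin (B - A))"
  define r' where "r' = sin (B - A + t) / (2 * cos t * sin (B - A))"
  have "sin (B - A + t) + sin (B - A - t) = 2 * cos t * sin (B - A)" by (simp add: sin_add sin_diff)
  then have rr: "r' + r = 1" unfolding r_def r'_def using nz ct by (simp flip: add_divide_distrib)
  have half: "\<bar>of_int \<sigma> / 2 :: real\<bar> \<le> 1" "\<bar>- of_int \<sigma> / 2 :: real\<bar> \<le> 1" using assms(1) by auto
  have pos: "0 \<le> a / (2 * cos t * b)" if "b * a \<ge> 0" for a b :: real
    using that ct by (auto simp: zero_le_divide_iff zero_le_mult_iff mult_le_0_iff)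
  have "0 \<le> r" "0 \<le> r'" unfolding r_def r'_def y by (intro pos sg_same(1)[OF d2] assms(2) half)+
  moreover have "r' = 1 - r" "cos t \<noteq> 0" using rr ct by simp_all
  ultimately have "0 \<le> r" "r \<le> 1" "(E d m + E d n) / (1 + cis (of_int \<sigma> * pi / real d)) = (1 - r) *\<^sub>R E d m + r *\<^sub>R E d n"
    using division_point[OF nz, of t] unfolding e t2 r_def[symmetric] r'_def[symmetric] by (simp_all only: scaleR_conv_of_real, simp_all)
  then show ?thesis by (rule that)
qed

text \<open>\<open>Phi_minus\<close> amounts to using the tile with the same vertices and the
  opposite sign. For an isosceles triangle the reflection in its axis produces it. Otherwise the hat
  and the mirror image both reflect the triangle; together they restore it, and only the reversal of
  the subdivisions remains.\<close>

lemma reversed_in_minus: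
  assumes \<kappa>: "elementary d \<kappa> \<sigma> l m n" and T: "T = decorated d \<sigma> (ang d \<kappa> l) (ang d \<kappa> m) (ang d \<kappa> n)"
    and TD: "T = DT d z0 w \<sigma> (E d ` {l, m, n})"
  shows "DT d z0 w (- \<sigma>) (E d ` {l, m, n}) \<in> (if isosceles (fst T) then mirror_images T else \<Union> (mirror_images ` hats T))"
proof -
  note el = elementary_Tri[OF d2 \<kappa>]
  have \<sigma>: "\<sigma> = 1 \<or> \<sigma> = - 1" using \<kappa> by (simp add: elementary_iff[OF d2])
  define c where "c = cis (of_int \<sigma> * pi / real d)"
  have c': "cis (of_int (- \<sigma>) * pi / real d) = inverse c" by (simp add: c_def cis_inverse)
  have c0: "c \<noteq> 0" by (simp add: c_def)
  have c1: "1 + c \<noteq> 0" using one_plus_cis_nonzero[OF d2 \<sigma>] by (simp add: c_def)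
  then have c2: "1 + inverse c \<noteq> 0" using c0 by (simp add: field_simps)
  define e1 e2 e3 where "e1 = E d l" "e2 = E d m" "e3 = E d n"
  note ed = e1_e2_e3_def
  have ne: "e1 \<noteq> e2" "e2 \<noteq> e3" "e1 \<noteq> e3" unfolding ed using el by (simp_all add: E_eq_iff[OF d2])
  have Z: "E d ` {l, m, n} = {e1, e2, e3}" by (simp add: ed)
  have S: "\<Sum>{e1, e2, e3} = e1 + e2 + e3" using ne by simp
  have fT: "fst T = Tri d \<kappa> l m n" unfolding T by (rule fst_decorated[OF d2])
  define A B C where "A = z0 + w * e1" "B = z0 + w * e2" "C = z0 + w * e3"
  note ABC = A_B_C_def
  have f1: "fst T = convex hull {A, B, C}" unfolding TD DT_def Z ABC by simp
  have nc: "\<not> collinear {A, B, C}"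
  proof
    assume "collinear {A, B, C}"
    then have "aff_dim (convex hull {A, B, C}) \<le> 1" by (simp add: collinear_aff_dim aff_dim_convex_hull)
    moreover have "interior (convex hull {A, B, C}) \<noteq> {}"
      using regular_triangle(1)[OF Tri_iff(1)[OF d2 el]] f1 fT Tri_iff(2)[OF d2 el] by simp
    ultimately show False using aff_dim_nonempty_interior[of "convex hull {A, B, C}"] by simp
  qed
  have w0: "w \<noteq> 0" using nc by (auto simp: ABC)
  show ?thesis
  proof (cases "isosceles (fst T)")
    case True
    then obtain A' B' C' where A': "\<not> collinear {A', B', C'}" "fst T = convex hull {A', B', C'}" "dist A' B' = dist A' C'"
      unfolding isosceles_def by blast
    have V: "{A', B', C'} = {A, B, C}" using triangle_vertices[OF A'(1) nc] A'(2) f1 by simp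
    define g where "g x = (x - z0) / w" for x
    have gV: "g ` {A', B', C'} = {e1, e2, e3}" unfolding V using w0 by (simp add: g_def ABC)
    have un: "cmod (g x) = 1" if "x \<in> {A', B', C'}" for x
    proof -
      have "g x \<in> {e1, e2, e3}" using gV that by blast
      then show ?thesis by (auto simp: ed)
    qed
    have gd: "cmod (g x - g y) = dist x y / cmod w" for x y
      by (simp add: g_def dist_norm norm_divide flip: diff_divide_distrib)
    have "B' \<noteq> C'" using A'(1) by auto
    then have "g B' \<noteq> g C'" using w0 by (simp add: g_def)
    then have q: "(g A')\<^sup>2 = g B' * g C'" using un A'(3) by (intro unit_isosceles) (simp_all add: gd)
    have cn: "cnj (g x) = inverse (g x)" if "x \<in> {A', B', C'}" for x
    proof -
      have "g x * cnj (g x) = 1" using un[OF that] by (simp add: complex_norm_square[symmetric])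
      then show ?thesis by (rule inverse_unique[symmetric])
    qed
    have nz: "g A' \<noteq> 0" "g B' \<noteq> 0" "g C' \<noteq> 0" using un[of A'] un[of B'] un[of C'] by auto
    have "(g A')\<^sup>2 * cnj (g A') = g A'" using cn[of A'] nz by (simp add: power2_eq_square)
    moreover have "(g A')\<^sup>2 * cnj (g B') = g C'" "(g A')\<^sup>2 * cnj (g C') = g B'" unfolding q using cn nz by simp_all
    ultimately have "(\<lambda>e. (g A')\<^sup>2 * cnj e) ` {e1, e2, e3} = {e1, e2, e3}"
      unfolding gV[symmetric] image_image by (simp add: insert_commute)
    moreover have "dmap (\<lambda>x. (w * (g A')\<^sup>2 / cnj w) * cnj x + (z0 - (w * (g A')\<^sup>2 / cnj w) * cnj z0)) (DT d z0 w \<sigma> {e1, e2, e3})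
      = DT d z0 w (- \<sigma>) ((\<lambda>e. (g A')\<^sup>2 * cnj e) ` {e1, e2, e3})"
      by (rule dmap_reflect_DT[OF d2]) (use nz w0 in \<open>auto simp: ed\<close>)
    moreover have "reflection (\<lambda>x. (w * (g A')\<^sup>2 / cnj w) * cnj x + (z0 - (w * (g A')\<^sup>2 / cnj w) * cnj z0))"
    proof -
      have "cmod (w * (g A')\<^sup>2 / cnj w) = 1" using un[of A'] w0 by (simp add: norm_mult norm_divide norm_power)
      then show ?thesis unfolding reflection_def by blast
    qed
    ultimately have "DT d z0 w (- \<sigma>) {e1, e2, e3} \<in> mirror_images T"
      unfolding mirror_images_def TD Z by (metis (mono_tags, lifting) mem_Collect_eq)
    then show ?thesis unfolding Z using True by (simp only: if_True)
  next
    case False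
    define D E1 H where "D = z0 + w * ((e2 + e3) / (1 + c))" "E1 = z0 + w * ((e1 + e3) / (1 + c))" "H = z0 + w * ((e1 + e2) / (1 + c))"
    note DEH = D_E1_H_def
    have s1: "snd T = convex hull {D, E1, H}"
      unfolding TD DT_def Z S DEH c_def[symmetric] snd_conv by (simp add: add.commute)
    have seg: "z0 + w * ((E d i + E d j) / (1 + c)) \<in> closed_segment (z0 + w * E d i) (z0 + w * E d j)"
      if ij: "\<not> int d dvd i - j" for i j
    proof -
      obtain r where r: "0 \<le> r" "r \<le> 1" "(E d i + E d j) / (1 + c) = (1 - r) *\<^sub>R E d i + r *\<^sub>R E d j"
        unfolding c_def by (rule E_division[OF \<sigma> ij])
      have "z0 + w * ((E d i + E d j) / (1 + c)) = (1 - r) *\<^sub>R (z0 + w * E d i) + r *\<^sub>R (z0 + w * E d j)"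
        unfolding r(3) by (simp add: scaleR_conv_of_real algebra_simps)
      then show ?thesis using r(1,2) unfolding in_segment by blast
    qed
    have sD: "D \<in> closed_segment B C" "E1 \<in> closed_segment C A" "H \<in> closed_segment A B"
      using seg[OF el(2)] seg[OF el(3)] seg[OF el(1)] unfolding DEH ABC ed closed_segment_commute[of "z0 + w * E d n"] by simp_all
    define U where "U = (cnj ` fst T, convex hull {cnj (B + C - D), cnj (C + A - E1), cnj (A + B - H)})"
    have "U \<in> hats T" unfolding hats_def
      by (rule CollectI, rule exI[of _ A], rule exI[of _ B], rule exI[of _ C], rule exI[of _ D], rule exI[of _ E1],
          rule exI[of _ H], rule exI[of _ cnj]) (intro conjI nc f1 s1 sD reflection_cnj U_def)
    moreover have "dmap cnj U = DT d z0 w (- \<sigma>) {e1, e2, e3}"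
    proof -
      have rev: "(z0 + w * x) + (z0 + w * y) - (z0 + w * ((x + y) / (1 + c))) = z0 + w * ((x + y) / (1 + inverse c))" for x y
      proof -
        \<comment> \<open>Reversing an edge replaces \<open>c\<close> by its inverse, which is the
          value of \<open>c\<close> for the sign \<open>- \<sigma>\<close>.\<close>
        have "(x + y) - (x + y) / (1 + c) = (x + y) / (1 + inverse c)" using c0 c1 c2 by (simp add: field_simps)
        then have "w * (x + y) - w * ((x + y) / (1 + c)) = w * ((x + y) / (1 + inverse c))" by (metis right_diff_distrib)
        then show ?thesis by (simp add: algebra_simps)
      qed
      have "dmap cnj U = (fst T, convex hull {B + C - D, C + A - E1, A + B - H})"
        unfolding U_def dmap_def fst_conv snd_conv cnj_convex_hull by (simp add: image_image)
      also have "{B + C - D, C + A - E1, A + B - H} = (\<lambda>z. z0 + w * ((\<Sum>{e1, e2, e3} - z) / (1 + inverse c))) ` {e1, e2, e3}"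
        using rev[of e2 e3] rev[of e1 e3] rev[of e1 e2] unfolding S ABC DEH by (simp add: add.commute)
      finally show ?thesis unfolding DT_def c' Z[symmetric] TD fst_conv .
    qed
    ultimately have "DT d z0 w (- \<sigma>) {e1, e2, e3} \<in> \<Union> (mirror_images ` hats T)"
      unfolding mirror_images_def by (intro UN_I[of U] CollectI exI[of _ cnj] conjI reflection_cnj) auto
    then show ?thesis unfolding Z using False by (simp only: if_False)
  qed
qed

lemma minus_patch:
  assumes v: "is_type d (a, b, c, \<sigma>)" and V: "has_type d (a, b, c, \<sigma>) V" and p: "0 < p" "p < d"
  obtains \<kappa> \<alpha> \<beta> \<gamma> u t where "framed d p (lev d (int p) (- \<sigma>)) a b V \<kappa> \<alpha> \<beta> \<gamma> u t"
    "dmap (\<lambda>z. u * z + t) ` cells d \<kappa> (Tri d \<kappa> \<alpha> \<beta> \<gamma>) \<in> extend_rule dmap (iota d p) (F d) (Phi_minus d p) V"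
proof -
  obtain \<kappa> x u t where k: "\<kappa> \<in> K d" "elementary d \<kappa> \<sigma> x (x + a) (x + a + b)" "cmod u = 1"
    "V = dmap (\<lambda>z. u * z + t) (decorated d \<sigma> (ang d \<kappa> x) (ang d \<kappa> (x + a)) (ang d \<kappa> (x + a + b)))"
    using typ_copy_F[OF d2 v V] .
  define T where "T = decorated d \<sigma> (ang d \<kappa> x) (ang d \<kappa> (x + a)) (ang d \<kappa> (x + a + b))"
  have TF: "T \<in> F d" unfolding T_def by (rule decorated_in_F[OF d2 k(1,2)])
  have \<sigma>: "\<sigma> = 1 \<or> \<sigma> = -1" using v by (auto simp: is_type_def)
  define w where "w = rot d \<kappa> * (cis (2 * (of_int \<sigma> * pi / real d)) - 1)"
  define z0 where "z0 = rot d \<kappa> * \<Sum>(E d ` {x, x + a, x + a + b})"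
  have TD: "T = DT d z0 w \<sigma> (E d ` {x, x + a, x + a + b})"
    unfolding T_def z0_def w_def by (rule decorated_DT[OF d2 k(2)])
  define U where "U = DT d z0 w (- \<sigma>) (E d ` {x, x + a, x + a + b})"
  have nw: "cmod w = 2 * sin (pi / real d)"
    unfolding w_def norm_mult norm_cis_minus_1[OF d2] norm_rot[OF d2] using \<sigma> s1_pos[OF d2] by auto
  have Ut: "has_type d (a, b, c, - \<sigma>) U" unfolding U_def by (rule typ_DT_rotate[OF nw]) simp_all
  have "is_type d (a, b, c, - \<sigma>)" using v by (auto simp: is_type_def)
  from plus_patch[OF d2 this Ut p] obtain \<kappa>' \<alpha> \<beta> \<gamma> u' t' where
    P: "framed d p (lev d (int p) (- \<sigma>)) a b U \<kappa>' \<alpha> \<beta> \<gamma> u' t'"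
      "dmap (\<lambda>z. u' * z + t') ` cells d \<kappa>' (Tri d \<kappa>' \<alpha> \<beta> \<gamma>) \<in> extend_rule dmap (iota d p) (F d) (Phi_plus d p) U" .
  have UT: "fst U = fst T" unfolding U_def TD DT_def by simp
  have fT: "framed d p (lev d (int p) (- \<sigma>)) a b T \<kappa>' \<alpha> \<beta> \<gamma> u' t'" using P(1)[unfolded framed_def UT] unfolding framed_def .
  have "U \<in> (if isosceles (fst T) then mirror_images T else \<Union> (mirror_images ` hats T))"
    unfolding U_def by (rule reversed_in_minus[OF k(2) T_def TD])
  then have "dmap (\<lambda>z. u' * z + t') ` cells d \<kappa>' (Tri d \<kappa>' \<alpha> \<beta> \<gamma>) \<in> Phi_minus d p T"
    unfolding Phi_minus_def using UT P(2) by blast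
  then show ?thesis
    by (intro that[of \<kappa>' \<alpha> \<beta> \<gamma> "u * u'" "u * t' + of_real (iota d p) * t"])
      (simp_all only: k(4) T_def[symmetric] framed_direct[OF d2 fT k(3) p] extend_rule_direct[OF d2 _ TF k(3) p refl])
qed

text \<open>The two applications of \<open>lev\<close> multiply the signs: the level is
  \<open>p\<close> if \<epsilon> = \<sigma> and \<open>d - p\<close> otherwise, which treats both
  kinds of rules by one type graph.\<close>

lemma Phi_patch:
  assumes v: "is_type d (a, b, c, \<sigma>)" and V: "has_type d (a, b, c, \<sigma>) V" and p: "0 < p" "p < d" and \<epsilon>: "\<epsilon> = 1 \<or> \<epsilon> = - 1"
  obtains \<kappa> \<alpha> \<beta> \<gamma> u t where "framed d p (lev d (lev d (int p) \<epsilon>) \<sigma>) a b V \<kappa> \<alpha> \<beta> \<gamma> u t"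
    "dmap (\<lambda>z. u * z + t) ` cells d \<kappa> (Tri d \<kappa> \<alpha> \<beta> \<gamma>) \<in> Phi d p \<epsilon> V"
  using \<epsilon>
proof
  assume e: "\<epsilon> = 1"
  have "lev d (lev d (int p) \<epsilon>) \<sigma> = lev d (int p) \<sigma>" by (simp add: e lev_def)
  then show ?thesis using that by (rule_tac plus_patch[OF d2 v V p]) (simp add: Phi_def e)
next
  assume e: "\<epsilon> = - 1"
  have "\<sigma> = 1 \<or> \<sigma> = -1" using v by (auto simp: is_type_def)
  then have "lev d (lev d (int p) \<epsilon>) \<sigma> = lev d (int p) (- \<sigma>)" by (auto simp add: e lev_def)
  then show ?thesis using that by (rule_tac minus_patch[OF v V p]) (simp add: Phi_def e)
qed

end

section \<open>Uniqueness of types\<close>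

text \<open>On a chord the squared distance from the centre drops by \<open>u * (1 - u)\<close>
  times the squared length of the chord, so a third point at distance \<open>r\<close> must be an
  endpoint.\<close>

lemma circle_not_collinear:
  fixes A B C z :: complex
  assumes "cmod (A - z) = r" "cmod (B - z) = r" "cmod (C - z) = r" "A \<noteq> B" "A \<noteq> C" "B \<noteq> C"
  shows "\<not> collinear {A, B, C}"
proof
  assume "collinear {A, B, C}"
  then obtain u where u: "B = u *\<^sub>R A + (1 - u) *\<^sub>R C"
    using assms(5) unfolding collinear_3_expand by blast
  have id: "(cmod (u *\<^sub>R p + (1 - u) *\<^sub>R q))\<^sup>2 = u * (cmod p)\<^sup>2 + (1 - u) * (cmod q)\<^sup>2 - u * (1 - u) * (cmod (p - q))\<^sup>2" for p q
    unfolding cmod_power2 by (simp add: power2_eq_square algebra_simps)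
  have "B - z = u *\<^sub>R (A - z) + (1 - u) *\<^sub>R (C - z)" unfolding u by (simp add: algebra_simps)
  then have "r\<^sup>2 = u * r\<^sup>2 + (1 - u) * r\<^sup>2 - u * (1 - u) * (cmod (A - C))\<^sup>2"
    using id[of "A - z" "C - z"] assms(1-3) by simp
  then have "u * (1 - u) * (cmod (A - C))\<^sup>2 = 0" by (simp add: algebra_simps)
  then have "u = 0 \<or> u = 1" using assms(5) by auto
  then show False using u assms(4,6) by auto
qed

text \<open>With two centres of equal radius the three points would lie on the perpendicular
  bisector of these centres.\<close>

lemma circumcentre_unique:
  fixes A B C z z' :: complex
  assumes "\<not> collinear {A, B, C}" "\<And>x. x \<in> {A, B, C} \<Longrightarrow> cmod (x - z) = r" "\<And>x. x \<in> {A, B, C} \<Longrightarrow> cmod (x - z') = r"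
  shows "z = z'"
proof (rule ccontr)
  assume ne: "z \<noteq> z'"
  have "x \<bullet> (2 *\<^sub>R (z' - z)) = z' \<bullet> z' - z \<bullet> z" if "x \<in> {A, B, C}" for x
  proof -
    have "(norm (x - z))\<^sup>2 = (norm (x - z'))\<^sup>2" using assms(2,3)[OF that] by simp
    then show ?thesis by (simp add: power2_norm_eq_inner inner_diff_left inner_diff_right inner_commute algebra_simps)
  qed
  then have "{A, B, C} \<subseteq> {x. (2 *\<^sub>R (z' - z)) \<bullet> x = z' \<bullet> z' - z \<bullet> z}" by (auto simp: inner_commute)
  then have "aff_dim {A, B, C} \<le> aff_dim {x. (2 *\<^sub>R (z' - z)) \<bullet> x = z' \<bullet> z' - z \<bullet> z}" by (rule aff_dim_subset)
  also have "\<dots> = 1" using ne by (subst aff_dim_hyperplane) auto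
  finally show False using assms(1) by (simp add: collinear_aff_dim)
qed

definition rotate_type :: "int \<times> int \<times> int \<times> int \<Rightarrow> int \<times> int \<times> int \<times> int" where
  "rotate_type = (\<lambda>(a, b, c, \<sigma>). (b, c, a, \<sigma>))"

lemma child_rotate: "child M a b c \<tau> i j k \<Longrightarrow> child M b c a \<tau> j k i"
  by (auto simp: child_def split: if_splits)

lemma next_type_rotate: "next_type d M v v' \<Longrightarrow> next_type d M (rotate_type v) (rotate_type v')"
proof -
  assume "next_type d M v v'"
  obtain a b c \<sigma> where v: "v = (a, b, c, \<sigma>)" by (cases v)
  obtain i j k \<tau> where c: "child (lev d M \<sigma>) a b c \<tau> i j k" "v' = (a + j - i, b + k - j, c + i - k, \<tau>)"
    using \<open>next_type d M v v'\<close> unfolding v next_type_def by auto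
  show ?thesis unfolding v c(2) rotate_type_def next_type_def prod.case using child_rotate[OF c(1)] by blast
qed

lemma is_type_rotate: "is_type d v \<Longrightarrow> is_type d (rotate_type v)"
  by (cases v) (auto simp: is_type_def rotate_type_def)

lemma rotate_type_3: "rotate_type (rotate_type (rotate_type v)) = v"
  by (cases v) (simp add: rotate_type_def)

lemma DT_rotate_subst:
  assumes "\<zeta> \<noteq> 0" "Z = (\<lambda>x. \<zeta> * x) ` Z'" "w' = w * \<zeta>" shows "DT d z w' \<sigma> Z' = DT d z w \<sigma> Z"
  unfolding assms(2,3) by (rule DT_rotate[OF assms(1), symmetric])

context
  fixes d :: nat
  assumes d2: "d > 2"
begin

lemma E_period: "E d (int d + j) = E d j" by (rule E_dvd[OF d2]) simp

lemma has_type_rotate: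
  assumes "is_type d v" "has_type d v V" shows "has_type d (rotate_type v) V"
proof -
  obtain a b c \<sigma> where v: "v = (a, b, c, \<sigma>)" by (cases v)
  obtain z0 w where w: "cmod w = 2 * sin (pi / real d)" "V = DT d z0 w \<sigma> (E d ` {0, a, a + b})"
    using assms(2) unfolding has_type_def v by auto
  have "a + b + c = int d" using assms(1) by (simp add: v is_type_def)
  then have "E d ` {0, a, a + b} = E d ` {a, a + b, a + b + c}"
    using E_period[of 0] by (simp add: insert_commute)
  then show ?thesis unfolding w(2) v rotate_type_def prod.case using typ_DT_rotate[OF w(1), of a a "a + b" b "a + b + c" c] by simp
qed

lemma E_inj: "0 \<le> x \<Longrightarrow> x < int d \<Longrightarrow> 0 \<le> y \<Longrightarrow> y < int d \<Longrightarrow> E d x = E d y \<Longrightarrow> x = y"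
proof (rule ccontr)
  assume a: "0 \<le> x" "x < int d" "0 \<le> y" "y < int d" "E d x = E d y" "x \<noteq> y"
  then have "int d \<le> \<bar>x - y\<bar>" using dvd_imp_le_int[of "x - y" "int d"] unfolding E_eq_iff[OF d2] by simp
  then show False using a by linarith
qed

lemma E_triple_eq:
  assumes "0 < a" "0 < b" "a + b < int d" "0 < a'" "0 < b'" "a' + b' < int d" "E d ` {0, a, a + b} = E d ` {0, a', a' + b'}"
  shows "a' = a \<and> b' = b"
proof -
  have "inj_on (E d) {0..<int d}" unfolding inj_on_def using E_inj by auto
  then have "{0, a, a + b} = {0, a', a' + b'}"
    using assms by (subst (asm) inj_on_image_eq_iff[of "E d" "{0..<int d}"]) auto
  moreover have "Max {0, a, a + b} = a + b" "Max {0, a', a' + b'} = a' + b'" using assms by auto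
  ultimately have "a + b = a' + b'" by simp
  moreover have "a \<in> {0, a', a' + b'}" using \<open>{0, a, a + b} = {0, a', a' + b'}\<close> by blast
  ultimately show ?thesis using assms by auto
qed

lemma E_pow: "E d j ^ d = 1"
proof -
  have "E d j ^ d = cis (real d * (- (2 * pi * of_int j / real d)))" unfolding E_def Complex.DeMoivre ..
  also have "real d * (- (2 * pi * of_int j / real d)) = 0 + 2 * pi * of_int (- j)" using d2 by simp
  finally show ?thesis unfolding cis_add_2pi_int by simp
qed

lemma sum_affine_image:
  fixes k t :: complex
  assumes "finite Z" "k \<noteq> 0" shows "\<Sum>((\<lambda>x. t + k * x) ` Z) = of_nat (card Z) * t + k * \<Sum>Z"
  using assms by (subst sum.reindex) (auto simp: inj_on_def sum.distrib sum_distrib_left)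

text \<open>Equal decorations have equal vertex sums, which forces the roots in \<open>Z\<close> to
  add up to 0. Then \<open>c'\<close> is a quotient of two \<open>d\<close>-th roots of unity,
  whereas its \<open>d\<close>-th power is -1.\<close>

lemma DT_sign_unique:
  assumes Z: "Z = E d ` {l, m, n}" "E d l \<noteq> E d m" "E d m \<noteq> E d n" "E d l \<noteq> E d n" and w: "w \<noteq> 0"
    and \<sigma>: "\<sigma> = 1 \<or> \<sigma> = -1" and eq: "DT d z w \<sigma> Z = DT d z w (- \<sigma>) Z"
  shows False
proof -
  define c where "c = cis (of_int \<sigma> * pi / real d)"
  define c' where "c' = cis (of_int (- \<sigma>) * pi / real d)"
  have cc: "c * c' = 1" by (simp add: c_def c'_def cis_mult)
  have c1: "1 + c \<noteq> 0" "1 + c' \<noteq> 0" unfolding c_def c'_def using \<sigma> one_plus_cis_nonzero[OF d2, of \<sigma>] one_plus_cis_nonzero[OF d2, of "- \<sigma>"] by auto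
  have ne: "c \<noteq> c'"
  proof
    assume "c = c'"
    then have "Im c = Im c'" by simp
    moreover have "Im c = of_int \<sigma> * sin (pi / real d)" "Im c' = - of_int \<sigma> * sin (pi / real d)"
      using \<sigma> by (auto simp: c_def c'_def)
    ultimately show False using s1_pos[OF d2] \<sigma> by auto
  qed
  have fin: "finite Z" using Z(1) by simp
  have pts: "convex hull ((\<lambda>x. (z + w * \<Sum>Z / (1 + g)) + (- w / (1 + g)) * x) ` Z) = snd (DT d z w \<tau> Z)"
    if "g = cis (of_int \<tau> * pi / real d)" for g \<tau>
  proof -
    have e: "(z + w * \<Sum>Z / (1 + g)) + (- w / (1 + g)) * x = z + w * ((\<Sum>Z - x) / (1 + g))" for x
      by (simp add: diff_divide_distrib right_diff_distrib)
    show ?thesis unfolding DT_def that[symmetric] snd_conv e ..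
  qed
  have nc: "\<not> collinear ((\<lambda>x. t + k * x) ` Z)" if "k \<noteq> 0" for t k
  proof -
    have "\<not> collinear {t + k * E d l, t + k * E d m, t + k * E d n}"
      by (rule circle_not_collinear[of _ t "cmod k"]) (use Z that in \<open>auto simp: norm_mult\<close>)
    then show ?thesis by (simp add: Z(1))
  qed
  have k0: "- w / (1 + c) \<noteq> 0" "- w / (1 + c') \<noteq> 0" using w c1 by auto
  have V: "(\<lambda>x. (z + w * \<Sum>Z / (1 + c)) + (- w / (1 + c)) * x) ` Z = (\<lambda>x. (z + w * \<Sum>Z / (1 + c')) + (- w / (1 + c')) * x) ` Z"
  proof -
    have fZ: "f ` Z = {f (E d l), f (E d m), f (E d n)}" for f :: "complex \<Rightarrow> complex" by (simp add: Z(1))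
    have H: "convex hull ((\<lambda>x. (z + w * \<Sum>Z / (1 + c)) + (- w / (1 + c)) * x) ` Z) =
        convex hull ((\<lambda>x. (z + w * \<Sum>Z / (1 + c')) + (- w / (1 + c')) * x) ` Z)"
      unfolding pts[OF c_def] pts[OF c'_def] eq ..
    show ?thesis unfolding fZ
      by (rule triangle_vertices[OF nc[OF k0(1), unfolded fZ] nc[OF k0(2), unfolded fZ] H[unfolded fZ]])
  qed
  have S0: "\<Sum>Z = 0"
  proof -
    have card: "card Z = 3" using Z by simp
    have "of_nat (card Z) * (z + w * \<Sum>Z / (1 + c)) + (- w / (1 + c)) * \<Sum>Z = of_nat (card Z) * (z + w * \<Sum>Z / (1 + c')) + (- w / (1 + c')) * \<Sum>Z"
      using arg_cong[OF V, of "\<lambda>A. \<Sum>A"] unfolding sum_affine_image[OF fin k0(1)] sum_affine_image[OF fin k0(2)] .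
    then have "w * \<Sum>Z / (1 + c) = w * \<Sum>Z / (1 + c')" unfolding card by (simp add: distrib_left)
    then have "w * \<Sum>Z * (1 + c') = w * \<Sum>Z * (1 + c)" using c1 by (auto simp: frac_eq_eq)
    then show ?thesis using w ne by auto
  qed
  have "(z + w * \<Sum>Z / (1 + c)) + (- w / (1 + c)) * E d l \<in> (\<lambda>x. (z + w * \<Sum>Z / (1 + c')) + (- w / (1 + c')) * x) ` Z"
    unfolding V[symmetric] by (simp add: Z(1))
  then obtain x where x: "(z + w * \<Sum>Z / (1 + c)) + (- w / (1 + c)) * E d l = (z + w * \<Sum>Z / (1 + c')) + (- w / (1 + c')) * x" "x \<in> Z"
    by (rule imageE)
  obtain j where xj: "x = E d j" using x(2) unfolding Z(1) by (rule imageE)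
  have j: "- w / (1 + c) * E d l = - w / (1 + c') * E d j" using x(1) unfolding S0 xj by simp
  then have "E d l * (1 + c') = E d j * (1 + c)" using w c1 by (simp add: frac_eq_eq)
  moreover have "1 + c' = c' * (1 + c)" using cc by (simp add: distrib_left mult.commute)
  ultimately have "E d l * c' = E d j" using c1 by simp
  then have "(E d l * c') ^ d = 1" by (simp add: E_pow)
  then have "c' ^ d = 1" by (simp add: power_mult_distrib E_pow)
  moreover have "c' ^ d = - 1"
  proof -
    have "c' ^ d = cis (real d * (of_int (- \<sigma>) * pi / real d))" unfolding c'_def Complex.DeMoivre ..
    also have "real d * (of_int (- \<sigma>) * pi / real d) = of_int (- \<sigma>) * pi" using d2 by simp
    finally show ?thesis using \<sigma> by (auto simp: complex_eq_iff)
  qed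
  ultimately show False by simp
qed

text \<open>The point set determines the vertices and the circumcentre, so two presentations differ
  by the unit factor \<open>w' / w\<close>, and \<open>DT_sign_unique\<close> settles the
  sign.\<close>

lemma has_type_unique:
  assumes v: "is_type d v" "has_type d v U" and v': "is_type d v'" "has_type d v' U"
  shows "v' = v \<or> v' = rotate_type v \<or> v' = rotate_type (rotate_type v)"
proof -
  obtain a b c \<sigma> where ve: "v = (a, b, c, \<sigma>)" by (cases v)
  obtain a' b' c' \<sigma>' where ve': "v' = (a', b', c', \<sigma>')" by (cases v')
  have t: "0 < a" "0 < b" "0 < c" "a + b + c = int d" "\<sigma> = 1 \<or> \<sigma> = -1"
    "0 < a'" "0 < b'" "0 < c'" "a' + b' + c' = int d" "\<sigma>' = 1 \<or> \<sigma>' = -1"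
    using v(1) v'(1) by (simp_all add: is_type_def ve ve')
  obtain z w where w: "cmod w = 2 * sin (pi / real d)" "U = DT d z w \<sigma> (E d ` {0, a, a + b})"
    using v(2) unfolding has_type_def ve by auto
  obtain z' w' where w': "cmod w' = 2 * sin (pi / real d)" "U = DT d z' w' \<sigma>' (E d ` {0, a', a' + b'})"
    using v'(2) unfolding has_type_def ve' by auto
  have w0: "w \<noteq> 0" "w' \<noteq> 0" using w(1) w'(1) s1_pos[OF d2] by auto
  have neq: "E d 0 \<noteq> E d x" "E d x \<noteq> E d (x + y)" "E d 0 \<noteq> E d (x + y)" if "0 < x" "0 < y" "x + y < int d" for x y
    using that E_inj[of 0 x] E_inj[of x "x + y"] E_inj[of 0 "x + y"] by auto
  have nc: "\<not> collinear {t + k * E d 0, t + k * E d x, t + k * E d (x + y)}" if "0 < x" "0 < y" "x + y < int d" "k \<noteq> 0" for t k x y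
    by (rule circle_not_collinear[of _ t "cmod k"]) (use neq[OF that(1-3)] that(4) in \<open>auto simp: norm_mult\<close>)
  have "fst U = convex hull {z + w * E d 0, z + w * E d a, z + w * E d (a + b)}"
     "fst U = convex hull {z' + w' * E d 0, z' + w' * E d a', z' + w' * E d (a' + b')}"
    by (simp add: w(2) DT_def) (simp add: w'(2) DT_def)
  then have V: "{z + w * E d 0, z + w * E d a, z + w * E d (a + b)} = {z' + w' * E d 0, z' + w' * E d a', z' + w' * E d (a' + b')}"
    using t w0 by (intro triangle_vertices nc) auto
  have zz: "z = z'"
  proof (rule circumcentre_unique)
    show "\<not> collinear {z + w * E d 0, z + w * E d a, z + w * E d (a + b)}" using t w0 by (intro nc) auto
    show "cmod (x - z) = 2 * sin (pi / real d)" if "x \<in> {z + w * E d 0, z + w * E d a, z + w * E d (a + b)}" for x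
      using that by (auto simp: norm_mult w(1))
    show "cmod (x - z') = 2 * sin (pi / real d)" if "x \<in> {z + w * E d 0, z + w * E d a, z + w * E d (a + b)}" for x
      using that unfolding V by (auto simp: norm_mult w'(1))
  qed
  have Zs: "E d ` {0, a, a + b} = (\<lambda>x. (w' / w) * x) ` E d ` {0, a', a' + b'}"
  proof -
    have "(\<lambda>x. (x - z) / w) ` {z + w * E d 0, z + w * E d a, z + w * E d (a + b)} = (\<lambda>x. (x - z) / w) ` {z' + w' * E d 0, z' + w' * E d a', z' + w' * E d (a' + b')}"
      unfolding V ..
    then show ?thesis using w0 by (simp add: zz)
  qed
  \<comment> \<open>Since 1 is a root of the second presentation, the ratio \<open>w' / w\<close> is
    one of the three roots of the first; each of them leads to one cyclic rotation of the
    angles.\<close>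
  then have "(w' / w) * E d 0 \<in> E d ` {0, a, a + b}" by simp
  moreover have "E d 0 = 1" by (simp add: E_def)
  ultimately have "w' / w \<in> E d ` {0, a, a + b}" by simp
  then obtain j where j: "w' / w = E d j" "j \<in> {0, a, a + b}" by (rule imageE)
  note j = j(2,1)
  have "w' = w * E d j" using j(2) w0 by (simp add: field_simps)
  then have U': "U = DT d z w \<sigma>' (E d ` {0, a, a + b})"
    unfolding w'(2) zz[symmetric] using DT_rotate_subst[OF _ Zs[unfolded j(2)]] by simp
  have "\<sigma>' = \<sigma>"
  proof (rule ccontr)
    assume "\<sigma>' \<noteq> \<sigma>"
    then have "\<sigma>' = - \<sigma>" using t by auto
    then show False using DT_sign_unique[OF refl _ _ _ w0(1) t(5), of 0 a "a + b" z] neq[of a b] t w(2) U' by auto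
  qed
  moreover have "(a' = a \<and> b' = b) \<or> (a' = b \<and> b' = c) \<or> (a' = c \<and> b' = a)"
  proof -
    have bk: "E d ` {0, a', a' + b'} = (\<lambda>x. E d (- j) * x) ` E d ` {0, a, a + b}"
      unfolding Zs j(2) image_image by (simp flip: E_add mult.assoc)
    show ?thesis
    proof (cases "j = 0")
      case True
      then have "E d ` {0, a, a + b} = E d ` {0, a', a' + b'}" using bk by (simp add: E_def)
      then show ?thesis using E_triple_eq t by auto
    next
      case False
      then have "j = a \<or> j = a + b" using j(1) by auto
      then show ?thesis
      proof
        assume "j = a"
        then have "E d ` {0, a', a' + b'} = {E d (- a), E d 0, E d b}" unfolding bk by (simp flip: E_add)
        also have "E d (- a) = E d (b + c)"
        proof -
          have "b + c = int d + (- a)" using t by simp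
          then show ?thesis by (simp only: E_period)
        qed
        finally have "E d ` {0, b, b + c} = E d ` {0, a', a' + b'}" by (simp add: insert_commute)
        then show ?thesis using E_triple_eq[of b c a' b'] t by auto
      next
        assume "j = a + b"
        then have "E d ` {0, a', a' + b'} = {E d (- a - b), E d (- b), E d 0}" unfolding bk by (simp flip: E_add)
        also have "E d (- a - b) = E d c"
        proof -
          have "c = int d + (- a - b)" using t by simp
          then show ?thesis by (simp only: E_period)
        qed
        also have "E d (- b) = E d (c + a)"
        proof -
          have "c + a = int d + (- b)" using t by simp
          then show ?thesis by (simp only: E_period)
        qed
        finally have "E d ` {0, c, c + a} = E d ` {0, a', a' + b'}" by (simp add: insert_commute)
        then show ?thesis using E_triple_eq[of c a a' b'] t by auto
      qed
    qed
  qed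
  ultimately show ?thesis using t unfolding ve ve' rotate_type_def by auto
qed

end

section \<open>Edge flips\<close>

lemma split_triangle:
  fixes A B C X :: complex
  assumes "X \<in> closed_segment A B"
  shows "convex hull {A, B, C} = convex hull {A, X, C} \<union> convex hull {X, B, C}"
proof
  obtain t where t: "0 \<le> t" "t \<le> 1" "X = (1 - t) *\<^sub>R A + t *\<^sub>R B" using assms unfolding in_segment by blast
  have "closed_segment A B \<subseteq> convex hull {A, B, C}"
    unfolding segment_convex_hull by (rule hull_mono) auto
  then have "X \<in> convex hull {A, B, C}" using assms by blast
  then show "convex hull {A, X, C} \<union> convex hull {X, B, C} \<subseteq> convex hull {A, B, C}"
    by (intro Un_least hull_minimal) (auto intro: hull_inc convex_convex_hull)
  show "convex hull {A, B, C} \<subseteq> convex hull {A, X, C} \<union> convex hull {X, B, C}"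
  proof
    fix p assume "p \<in> convex hull {A, B, C}"
    then obtain a b c where p: "0 \<le> a" "0 \<le> b" "0 \<le> c" "a + b + c = 1" "p = a *\<^sub>R A + b *\<^sub>R B + c *\<^sub>R C"
      unfolding convex_hull_3 by blast
    show "p \<in> convex hull {A, X, C} \<union> convex hull {X, B, C}"
    \<comment> \<open>Equality describes the line through \<open>C\<close> and \<open>X\<close>; the
      comparison tells on which side of it the point lies.\<close>
    proof (cases "b * (1 - t) \<le> a * t")
      case True
      show ?thesis
      proof (cases "t = 0")
        case True
        then have "b = 0" using p \<open>b * (1 - t) \<le> a * t\<close> by simp
        then have "p = a *\<^sub>R A + 0 *\<^sub>R X + c *\<^sub>R C" "a + 0 + c = 1" using p by simp_all
        then show ?thesis using p(1,3) unfolding convex_hull_3 by blast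
      next
        case False
        then have t0: "t > 0" using t by simp
        have "(a - b * (1 - t) / t) *\<^sub>R A + (b / t) *\<^sub>R X + c *\<^sub>R C = p"
        proof -
          have "(b / t) *\<^sub>R X = (b * (1 - t) / t) *\<^sub>R A + b *\<^sub>R B"
            using t0 unfolding t(3) scaleR_right_distrib by simp
          then show ?thesis unfolding p(5) scaleR_left_diff_distrib by simp
        qed
        moreover have "b * (1 - t) / t = b / t - b" using t0 by (simp add: field_simps)
        then have "(a - b * (1 - t) / t) + b / t + c = 1" using p(4) by simp
        moreover have "0 \<le> a - b * (1 - t) / t" using True t0 by (simp add: field_simps)
        moreover have "0 \<le> b / t" using p t0 by simp
        ultimately have "p \<in> convex hull {A, X, C}" using p(3) unfolding convex_hull_3 by blast
        then show ?thesis by blast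
      qed
    next
      case False
      have t1: "1 - t > 0"
      proof (rule ccontr)
        assume "\<not> 1 - t > 0"
        then have "t = 1" using t by simp
        then show False using False p(1) by simp
      qed
      have "(a / (1 - t)) *\<^sub>R X + (b - a * t / (1 - t)) *\<^sub>R B + c *\<^sub>R C = p"
      proof -
        have "(a / (1 - t)) *\<^sub>R X = a *\<^sub>R A + (a * t / (1 - t)) *\<^sub>R B"
          using t1 unfolding t(3) scaleR_right_distrib by simp
        then show ?thesis unfolding p(5) scaleR_left_diff_distrib by simp
      qed
      moreover have "a * t / (1 - t) = a / (1 - t) - a" using t1 by (simp add: field_simps)
      then have "a / (1 - t) + (b - a * t / (1 - t)) + c = 1" using p(4) by simp
      moreover have "0 \<le> b - a * t / (1 - t)" using False t1 by (simp add: field_simps)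
      moreover have "0 \<le> a / (1 - t)" using p t1 by simp
      ultimately have "p \<in> convex hull {X, B, C}" using p(3) unfolding convex_hull_3 by blast
      then show ?thesis by blast
    qed
  qed
qed

text \<open>Both sides are the union of the same four triangles around the crossing point
  \<open>X\<close>.\<close>

lemma quadrilateral_union:
  fixes A B C D X :: complex
  assumes "X \<in> closed_segment A B" "X \<in> closed_segment C D"
  shows "convex hull {A, B, C} \<union> convex hull {A, B, D} = convex hull {C, D, A} \<union> convex hull {C, D, B}"
  unfolding split_triangle[OF assms(1)] split_triangle[OF assms(2)]
  by (auto simp: insert_commute)

text \<open>The line through \<open>C\<close> and \<open>D\<close> contains a point strictly between
  \<open>A\<close> and \<open>B\<close> and therefore separates them.\<close>

lemma quadrilateral_interiors:
  fixes A B C D X :: complex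
  assumes "X \<in> open_segment A B" "X \<in> closed_segment C D" "C \<noteq> D"
  shows "interior (convex hull {C, D, A}) \<inter> interior (convex hull {C, D, B}) = {}"
proof -
  define n where "n = \<i> * (D - C)"
  have n0: "n \<noteq> 0" using assms(3) by (simp add: n_def)
  define b where "b = n \<bullet> C"
  have D: "n \<bullet> D = b" unfolding b_def n_def by (simp add: inner_complex_def algebra_simps)
  obtain s where s: "X = (1 - s) *\<^sub>R C + s *\<^sub>R D" using assms(2) unfolding in_segment by blast
  have "n \<bullet> X = b" unfolding s inner_add_right inner_scaleR_right D b_def[symmetric] by (simp add: algebra_simps)
  obtain t where t: "0 < t" "t < 1" "X = (1 - t) *\<^sub>R A + t *\<^sub>R B" using assms(1) unfolding in_segment by blast
  have "(1 - t) * (n \<bullet> A) + t * (n \<bullet> B) = b" using \<open>n \<bullet> X = b\<close> unfolding t(3) inner_add_right inner_scaleR_right .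
  then have *: "(1 - t) * (n \<bullet> A - b) + t * (n \<bullet> B - b) = 0" by (simp add: algebra_simps)
  have le: "interior (convex hull {C, D, Y}) \<subseteq> {x. n \<bullet> x < b}" if "n \<bullet> Y \<le> b" for Y
  proof -
    have "convex hull {C, D, Y} \<subseteq> {x. n \<bullet> x \<le> b}"
      by (rule hull_minimal) (use that D in \<open>auto simp: b_def convex_halfspace_le\<close>)
    then show ?thesis using interior_mono interior_halfspace_le[OF n0] by metis
  qed
  have ge: "interior (convex hull {C, D, Y}) \<subseteq> {x. n \<bullet> x > b}" if "n \<bullet> Y \<ge> b" for Y
  proof -
    have "convex hull {C, D, Y} \<subseteq> {x. n \<bullet> x \<ge> b}"
      by (rule hull_minimal) (use that D in \<open>auto simp: b_def convex_halfspace_ge\<close>)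
    then show ?thesis using interior_mono interior_halfspace_ge[OF n0] by metis
  qed
  show ?thesis
  proof (cases "n \<bullet> A \<le> b")
    case True
    then have "(1 - t) * (n \<bullet> A - b) \<le> 0" using t by (intro mult_nonneg_nonpos) auto
    then have "t * (n \<bullet> B - b) \<ge> 0" using * by linarith
    then have "n \<bullet> B \<ge> b" using t by (simp add: zero_le_mult_iff)
    then show ?thesis using le[OF True] ge by force
  next
    case False
    then have "(1 - t) * (n \<bullet> A - b) \<ge> 0" using t by (intro mult_nonneg_nonneg) auto
    then have "t * (n \<bullet> B - b) \<le> 0" using * by linarith
    then have "n \<bullet> B \<le> b" using t by (simp add: mult_le_0_iff)
    then show ?thesis using le[of B] ge[of A] False by force
  qed
qed

lemma open_meets_interior:
  fixes O' :: "complex set"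
  assumes "finite \<V>" "\<And>V. V \<in> \<V> \<Longrightarrow> closed V" "open O'" "O' \<noteq> {}" "O' \<subseteq> \<Union>\<V>"
  shows "\<exists>V\<in>\<V>. O' \<inter> interior V \<noteq> {}"
  using assms
proof (induction \<V> arbitrary: O' rule: finite_induct)
  case (insert V \<V>)
  show ?case
  proof (cases "O' \<inter> interior V = {}")
    case True
    have "O' - V \<noteq> {}"
    proof
      assume "O' - V = {}"
      then have "O' \<subseteq> interior V" using insert.prems(2) by (simp add: interior_maximal)
      then show False using True insert.prems(3) by blast
    qed
    moreover have "open (O' - V)" using insert.prems by (simp add: open_Diff)
    moreover have "O' - V \<subseteq> \<Union>\<V>" using insert.prems(4) by blast
    ultimately obtain W where "W \<in> \<V>" "(O' - V) \<inter> interior W \<noteq> {}" using insert.IH[of "O' - V"] insert.prems(1) by auto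
    then show ?thesis by blast
  qed blast
qed simp

text \<open>An overlap of new tiles would be an open set covered by old tiles, so it would meet the
  interior of an old tile. The overlap thus exists already among the old tiles, which do not
  overlap.\<close>

lemma replace_patches:
  fixes X :: "complex set set" and old new :: "'i \<Rightarrow> complex set set"
  assumes X: "nonoverlapping id X" "\<And>T. T \<in> X \<Longrightarrow> closed T"
    and i: "\<And>i. i \<in> I \<Longrightarrow> old i \<subseteq> X" "\<And>i. i \<in> I \<Longrightarrow> finite (old i)" "\<And>i. i \<in> I \<Longrightarrow> nonoverlapping id (new i)"
      "\<And>i. i \<in> I \<Longrightarrow> \<Union>(old i) = \<Union>(new i)"
    and dj: "\<And>i j. i \<in> I \<Longrightarrow> j \<in> I \<Longrightarrow> i \<noteq> j \<Longrightarrow> old i \<inter> old j = {}"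
  shows "nonoverlapping id ((X - (\<Union>i\<in>I. old i)) \<union> (\<Union>i\<in>I. new i))"
    and "\<Union>((X - (\<Union>i\<in>I. old i)) \<union> (\<Union>i\<in>I. new i)) = \<Union>X"
proof -
  let ?old = "\<Union>i\<in>I. old i"
  let ?new = "\<Union>i\<in>I. new i"
  have sub: "T \<subseteq> \<Union>(old i)" if "i \<in> I" "T \<in> new i" for i T using that i(4) by blast
  have meets: "\<exists>V\<in>old i. O' \<inter> interior V \<noteq> {}" if "i \<in> I" "T \<in> new i" "open O'" "O' \<noteq> {}" "O' \<subseteq> T" for i T O'
  proof (rule open_meets_interior[OF i(2)[OF that(1)] _ that(3,4)])
    show "closed V" if "V \<in> old i" for V using X(2) i(1)[OF \<open>i \<in> I\<close>] that by blast
    show "O' \<subseteq> \<Union>(old i)" using that(5) sub[OF that(1,2)] by blast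
  qed
  have non: "interior T \<inter> interior U = {}" if "T \<in> X" "U \<in> X" "T \<noteq> U" for T U
    using X(1) that by (auto simp: nonoverlapping_def)
  have a: "interior T \<inter> interior U = {}" if T: "i \<in> I" "T \<in> new i" and U: "U \<in> X - ?old" for i T U
  proof (rule ccontr)
    assume "interior T \<inter> interior U \<noteq> {}"
    then obtain V where V: "V \<in> old i" "(interior T \<inter> interior U) \<inter> interior V \<noteq> {}"
      using meets[OF T, of "interior T \<inter> interior U"] interior_subset by blast
    have "V \<noteq> U" "V \<in> X" using V(1) U T(1) i(1) by auto
    then show False using non[of V U] V(2) U by blast
  qed
  have b: "interior T \<inter> interior U = {}" if T: "i \<in> I" "T \<in> new i" and U: "j \<in> I" "U \<in> new j" "i \<noteq> j" for i j T U
  proof (rule ccontr)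
    assume "interior T \<inter> interior U \<noteq> {}"
    then obtain V where V: "V \<in> old i" "(interior T \<inter> interior U) \<inter> interior V \<noteq> {}"
      using meets[OF T, of "interior T \<inter> interior U"] interior_subset by blast
    then obtain W where W: "W \<in> old j" "(interior T \<inter> interior U \<inter> interior V) \<inter> interior W \<noteq> {}"
      using meets[OF U(1,2), of "interior T \<inter> interior U \<inter> interior V"] interior_subset by blast
    have "V \<noteq> W" using dj[OF T(1) U(1,3)] V(1) W(1) by blast
    then show False using non[of V W] V(1) W i(1) T(1) U(1) by blast
  qed
  show "nonoverlapping id ((X - ?old) \<union> ?new)"
    unfolding nonoverlapping_def id_apply
  proof (intro ballI impI)
    fix T U assume TU: "T \<in> (X - ?old) \<union> ?new" "U \<in> (X - ?old) \<union> ?new" "T \<noteq> U"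
    show "interior T \<inter> interior U = {}"
    proof (cases "T \<in> X - ?old")
      case True
      show ?thesis
      proof (cases "U \<in> X - ?old")
        case True
        then show ?thesis using \<open>T \<in> X - ?old\<close> non TU(3) by blast
      next
        case False
        then obtain j where "j \<in> I" "U \<in> new j" using TU by blast
        from a[OF this True] show ?thesis by blast
      qed
    next
      case False
      then obtain i where i': "i \<in> I" "T \<in> new i" using TU by blast
      show ?thesis
      proof (cases "U \<in> X - ?old")
        case True
        from a[OF i' this] show ?thesis .
      next
        case False
        then obtain j where j: "j \<in> I" "U \<in> new j" using TU by blast
        show ?thesis
        proof (cases "i = j")
          case True
          then show ?thesis using i(3)[OF i'(1)] i' j TU(3) unfolding nonoverlapping_def id_apply by blast
        next
          case False
          from b[OF i' j this] show ?thesis .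
        qed
      qed
    qed
  qed
  show "\<Union>((X - ?old) \<union> ?new) = \<Union>X"
  proof
    show "\<Union>((X - ?old) \<union> ?new) \<subseteq> \<Union>X" using sub i(1) by blast
    show "\<Union>X \<subseteq> \<Union>((X - ?old) \<union> ?new)"
    proof
      fix x assume "x \<in> \<Union>X"
      then obtain T where T: "T \<in> X" "x \<in> T" by blast
      show "x \<in> \<Union>((X - ?old) \<union> ?new)"
      proof (cases "T \<in> ?old")
        case True
        then obtain j where "j \<in> I" "T \<in> old j" by blast
        then have "x \<in> \<Union>(new j)" using i(4)[of j] T(2) by blast
        then show ?thesis using \<open>j \<in> I\<close> by blast
      next
        case False
        then show ?thesis using T by blast
      qed
    qed
  qed
qed

section \<open>Right-angled triangles on a common diameter\<close>

context
  fixes d q :: nat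
  assumes dq: "d = 2 * q" and q2: "q > 2"
begin

lemma d_gt_2: "d > 2" using dq q2 by simp

lemma E_antipode: "E d (int q + j) = - E d j" "E d (j + int q) = - E d j"
proof -
  have "- (2 * pi * of_int (int q + j) / real d) = - (2 * pi * of_int j / real d) + - pi"
    using dq q2 by (simp add: field_simps)
  then have "E d (int q + j) = cis (- (2 * pi * of_int j / real d)) * cis (- pi)" unfolding E_def cis_mult by simp
  then show 1: "E d (int q + j) = - E d j" by (simp add: E_def complex_eq_iff)
  then show "E d (j + int q) = - E d j" by (simp add: add.commute)
qed

lemma not_dvd_half: "\<not> int q dvd k \<Longrightarrow> \<not> int d dvd k"
  unfolding dq by (metis dvd_mult_right of_nat_mult dvd_mult_left)

text \<open>The imaginary parts of \<open>E d k\<close> and \<open>E d (k - 1)\<close> are, up to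
  sign, sines at consecutive multiples of \<open>\<pi> / q\<close> and have equal signs, so the
  second diagonal crosses the real axis; \<open>t\<close> is the place where its imaginary part
  vanishes.\<close>

lemma crossing:
  assumes k: "\<not> int q dvd k" "\<not> int q dvd k - 1"
  obtains s t where "0 < s" "s < 1" "0 < t" "t < 1"
    "(1 - s) *\<^sub>R (1::complex) + s *\<^sub>R (- 1) = (1 - t) *\<^sub>R E d k + t *\<^sub>R (- E d (k - 1))"
proof -
  define a b where "a = sg q (of_int k)" "b = sg q (of_int (k - 1))"
  have E1: "Re (E d j) = cos (of_int j * pi / real q)" "Im (E d j) = - sg q (of_int j)" for j
    using q2 by (simp_all add: E_def sg_def dq field_simps)
  have nz: "a \<noteq> 0" "b \<noteq> 0" unfolding a_b_def sg_zero_iff[OF q2] using k by auto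
  have "a * b \<ge> 0" using sg_same(1)[OF q2 k(1), of "-1"] by (simp add: a_b_def)
  then have ab: "(a > 0 \<and> b > 0) \<or> (a < 0 \<and> b < 0)" using nz by (auto simp: zero_le_mult_iff)
  define t where "t = a / (a + b)"
  have t: "0 < t" "t < 1" unfolding t_def using ab by (auto simp: field_simps zero_less_divide_iff)
  have "a + b \<noteq> 0" using ab by auto
  then have t1: "1 - t = b / (a + b)" unfolding t_def by (simp add: field_simps)
  have tab: "(1 - t) * a = t * b" unfolding t1 by (simp add: t_def mult.commute)
  define x where "x = (1 - t) * cos (of_int k * pi / real q) - t * cos (of_int (k - 1) * pi / real q)"
  have c1: "\<bar>cos (of_int j * pi / real q)\<bar> < 1" if "sg q (of_int j) \<noteq> 0" for j
  proof -
    have "(sin (of_int j * pi / real q))\<^sup>2 > 0" using that by (simp add: sg_def)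
    then have "(cos (of_int j * pi / real q))\<^sup>2 < 1" using sin_cos_squared_add[of "of_int j * pi / real q"] by linarith
    then show ?thesis by (simp add: abs_square_less_1)
  qed
  have cc: "\<bar>cos (of_int k * pi / real q)\<bar> < 1" "\<bar>cos (of_int (k - 1) * pi / real q)\<bar> < 1"
    by (rule c1[OF nz(1)[unfolded a_b_def]]) (rule c1[OF nz(2)[unfolded a_b_def]])
  have "\<bar>x\<bar> \<le> (1 - t) * \<bar>cos (of_int k * pi / real q)\<bar> + t * \<bar>cos (of_int (k - 1) * pi / real q)\<bar>"
    unfolding x_def using abs_triangle_ineq4[of "(1 - t) * cos (of_int k * pi / real q)" "t * cos (of_int (k - 1) * pi / real q)"] t
    by (simp add: abs_mult)
  also have "\<dots> < (1 - t) * 1 + t * 1"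
    using cc t by (intro add_strict_mono mult_strict_left_mono) auto
  finally have x1: "\<bar>x\<bar> < 1" by simp
  show ?thesis
  proof (rule that[of "(1 - x) / 2" t])
    have re: "Re ((1 - t) *\<^sub>R E d k + t *\<^sub>R (- E d (k - 1))) = x" unfolding x_def by (simp add: E1)
    have im: "Im ((1 - t) *\<^sub>R E d k + t *\<^sub>R (- E d (k - 1))) = 0"
      unfolding plus_complex.simps scaleR_complex.simps uminus_complex.simps E1 a_b_def[symmetric] using tab by simp
    show "(1 - (1 - x) / 2) *\<^sub>R (1::complex) + ((1 - x) / 2) *\<^sub>R (- 1) = (1 - t) *\<^sub>R E d k + t *\<^sub>R (- E d (k - 1))"
      by (rule complex_eqI) (unfold re im, simp_all add: field_simps)
  qed (use x1 t in auto)
qed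

lemma copy_Fbar:
  assumes "\<not> int d dvd l - m" "\<not> int d dvd m - n" "\<not> int d dvd l - n" "cmod w = 2 * sin (pi / real d)"
  shows "convex hull {z + w * E d l, z + w * E d m, z + w * E d n} \<in> copies image (Fbar d)"
proof -
  obtain \<kappa> x u v where k: "\<kappa> \<in> K d" "elementary d \<kappa> 1 (x + l) (x + m) (x + n)" "cmod u = 1"
    "DT d z w 1 (E d ` {l, m, n}) =
      dmap (\<lambda>z. u * z + v) (decorated d 1 (ang d \<kappa> (x + l)) (ang d \<kappa> (x + m)) (ang d \<kappa> (x + n)))"
    by (rule DT_copy_F[OF d_gt_2 _ assms, of 1 z]) auto
  let ?T = "decorated d 1 (ang d \<kappa> (x + l)) (ang d \<kappa> (x + m)) (ang d \<kappa> (x + n))"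
  have "convex hull {z + w * E d l, z + w * E d m, z + w * E d n} = fst (DT d z w 1 (E d ` {l, m, n}))" by (simp add: DT_def)
  also have "\<dots> = (\<lambda>z. u * z + v) ` fst ?T" unfolding k(4) by simp
  finally show ?thesis
    unfolding copies_def Fbar_def using isometry_direct[OF k(3)] decorated_in_F[OF d_gt_2 k(1,2)] by blast
qed

lemma norm_diff_less_2:
  fixes a b :: complex
  assumes "cmod a = 1" "cmod b = 1" "b \<noteq> - a" shows "cmod (a - b) < 2"
proof -
  have "(cmod (a - b))\<^sup>2 + (cmod (a + b))\<^sup>2 = 2 * (cmod a)\<^sup>2 + 2 * (cmod b)\<^sup>2"
    unfolding cmod_power2 by (simp add: power2_eq_square algebra_simps)
  moreover have "(cmod (a + b))\<^sup>2 > 0" using assms(3) by (simp add: add_eq_0_iff)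
  moreover have "2 * (cmod a)\<^sup>2 + 2 * (cmod b)\<^sup>2 = 4" using assms(1,2) by simp
  ultimately have "(cmod (a - b))\<^sup>2 < 4" by linarith
  then have "(cmod (a - b))\<^sup>2 < 2\<^sup>2" by simp
  then show ?thesis by (rule power_less_imp_less_base) simp
qed

text \<open>\<open>A\<close> and \<open>B\<close> are antipodal, \<open>C\<close> and
  \<open>D\<close> are \<open>q - 1\<close> steps apart on the same circle; this gives the diagonals
  \<open>S_q\<close> and \<open>S_(q-1)\<close>. Congruence is excluded by size: each old triangle
  contains a diameter of the circle, while any two points of a new one are closer than that.\<close>

lemma flip_quad:
  assumes w: "cmod w = 2 * sin (pi / real d)" and k: "\<not> int q dvd \<nu> - c" "\<not> int q dvd \<nu> - c - 1"
    and P: "A = z + w * E d c" "B = z - w * E d c" "C = z + w * E d \<nu>" "D = z - w * E d (\<nu> - 1)"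
  shows "flip d {convex hull {A, B, C}, convex hull {A, B, D}} {convex hull {C, D, A}, convex hull {C, D, B}}"
    and "convex hull {A, B, C} \<union> convex hull {A, B, D} = convex hull {C, D, A} \<union> convex hull {C, D, B}"
    and "nonoverlapping id {convex hull {C, D, A}, convex hull {C, D, B}}"
    and "{convex hull {C, D, A}, convex hull {C, D, B}} \<subseteq> copies image (Fbar d)"
proof -
  note d2 = d_gt_2
  have sp: "0 < sin (pi / real d)" by (rule s1_pos[OF d2])
  have w0: "w \<noteq> 0" using w sp by auto
  obtain s' t where st: "0 < s'" "s' < 1" "0 < t" "t < 1"
    "(1 - s') *\<^sub>R (1::complex) + s' *\<^sub>R (- 1) = (1 - t) *\<^sub>R E d (\<nu> - c) + t *\<^sub>R (- E d (\<nu> - c - 1))"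
    by (rule crossing[OF k])
  define X where "X = z + w * E d c * ((1 - s') *\<^sub>R 1 + s' *\<^sub>R (- 1))"
  have X1: "X = (1 - s') *\<^sub>R A + s' *\<^sub>R B"
    unfolding X_def P by (simp add: scaleR_conv_of_real algebra_simps)
  have Ek: "E d c * E d (\<nu> - c) = E d \<nu>" "E d c * E d (\<nu> - c - 1) = E d (\<nu> - 1)" by (simp_all flip: E_add)
  have X2: "X = (1 - t) *\<^sub>R C + t *\<^sub>R D"
    unfolding X_def st(5) P Ek[symmetric] by (simp add: scaleR_conv_of_real algebra_simps)
  have EB: "B = z + w * E d (int q + c)" and ED: "D = z + w * E d (int q + (\<nu> - 1))"
    unfolding P E_antipode by simp_all
  have nd0: "\<not> int d dvd y" if "y = \<nu> - c + int q * r \<or> y = \<nu> - c - 1 + int q * r" for y r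
  proof
    assume "int d dvd y"
    then have "int q dvd y" using not_dvd_half by blast
    then show False using that k by (elim disjE) (simp_all only: dvd_add_left_iff[OF dvd_triv_left])
  qed
  have nd: "\<not> int d dvd \<nu> - c" "\<not> int d dvd \<nu> - c - 1"
    by (rule nd0[of _ 0], simp)+
  have nd': "\<not> int d dvd \<nu> - (int q + c)" "\<not> int d dvd \<nu> - 1 - (int q + c)" "\<not> int d dvd \<nu> - 1 - c"
      "\<not> int d dvd int q + (\<nu> - 1) - c" "\<not> int d dvd int q + (\<nu> - 1) - (int q + c)"
    by (rule nd0[of _ "-1"], simp) (rule nd0[of _ "-1"], simp, rule nd0[of _ 0], simp, rule nd0[of _ 1], simp, rule nd0[of _ 0], simp)
  have sub: "\<not> int d dvd i - j \<Longrightarrow> \<not> int d dvd j - i" for i j by (metis dvd_minus_iff minus_diff_eq)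
  have q0: "\<not> int d dvd c - (int q + c)" "\<not> int d dvd int q + (\<nu> - 1) - \<nu>" "\<not> int d dvd \<nu> - (\<nu> - 1)"
    using q2 dq by (auto dest!: zdvd_imp_le simp: dvd_minus_iff zdvd_not_zless)
  have neAB: "A \<noteq> B" using w0 unfolding P by (simp add: eq_neg_iff_add_eq_0 flip: mult_2)
  have neCD: "C \<noteq> D" unfolding P(3) ED using w0 q0(2) E_eq_iff[OF d2] by (metis add_left_cancel mult_left_cancel)
  have XA: "X \<in> open_segment A B" unfolding in_segment using neAB st X1 by blast
  have XC: "X \<in> open_segment C D" unfolding in_segment using neCD st X2 by blast
  have Xc: "X \<in> closed_segment A B" "X \<in> closed_segment C D" using XA XC by (simp_all add: open_segment_def)
  show un: "convex hull {A, B, C} \<union> convex hull {A, B, D} = convex hull {C, D, A} \<union> convex hull {C, D, B}"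
    by (rule quadrilateral_union[OF Xc])
  show "nonoverlapping id {convex hull {C, D, A}, convex hull {C, D, B}}"
    using quadrilateral_interiors[OF XA Xc(2) neCD] unfolding nonoverlapping_def by auto
  have t12: "convex hull {A, B, C} \<in> copies image (Fbar d)" "convex hull {A, B, D} \<in> copies image (Fbar d)"
    unfolding EB ED P(1,3) by (rule copy_Fbar[OF _ _ _ w]; use nd nd' q0 sub in blast)+
  have u12: "convex hull {C, D, A} \<in> copies image (Fbar d)" "convex hull {C, D, B} \<in> copies image (Fbar d)"
    unfolding EB ED P(1,3) by (rule copy_Fbar[OF _ _ _ w]; use nd nd' q0 sub in blast)+
  then show "{convex hull {C, D, A}, convex hull {C, D, B}} \<subseteq> copies image (Fbar d)" by blast
  have AB: "dist A B = 2 * cmod w" unfolding P dist_norm by (simp add: norm_mult flip: mult_2)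
  have short: "dist (z + w * E d i) (z + w * E d j) < 2 * cmod w" if "\<not> int d dvd j - (int q + i)" for i j
  proof -
    have "E d j \<noteq> - E d i" using that E_eq_iff[OF d2, of j "int q + i"] by (simp add: E_antipode)
    then have "cmod (E d i - E d j) < 2" by (intro norm_diff_less_2) auto
    then have "cmod w * cmod (E d i - E d j) < cmod w * 2" using w0 by simp
    then show ?thesis by (simp add: dist_norm norm_mult mult.commute flip: right_diff_distrib)
  qed
  have small: "dist x y < 2 * cmod w" if x: "x \<in> convex hull {U, V, W}" "y \<in> convex hull {U, V, W}"
    and UVW: "dist U V < 2 * cmod w" "dist V W < 2 * cmod w" "dist U W < 2 * cmod w" for x y U V W :: complex
  proof -
    obtain u v where "u \<in> {U, V, W}" "v \<in> {U, V, W}" "norm (x - y) \<le> norm (u - v)"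
      using simplex_extremal_le[of "{U, V, W}"] x by blast
    moreover have "norm (u - v) < 2 * cmod w" if "u \<in> {U, V, W}" "v \<in> {U, V, W}"
      using that UVW w0 by (auto simp: dist_norm norm_minus_commute)
    ultimately show ?thesis by (metis dist_norm le_less_trans)
  qed
  have nq: "int q + (int q + j) = int d + j" for j by (simp add: dq)
  have dd: "int d dvd i - (int d + j) \<longleftrightarrow> int d dvd i - j" for i j
  proof -
    have "i - (int d + j) = (i - j) - int d" by simp
    then show ?thesis by (metis dvd_diff_left_iff dvd_refl)
  qed
  have alg: "int q + (\<nu> - 1) - (int q + (int q + c)) = \<nu> - 1 - (int q + c)" "int q + (\<nu> - 1) - (int q + \<nu>) = - 1" by simp_all
  have sCD: "dist C D < 2 * cmod w" unfolding P(3) ED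
    by (rule short) (use d2 in \<open>simp add: alg(2)\<close>)
  have sCA: "dist C A < 2 * cmod w" unfolding P(1,3)
    by (subst dist_commute, rule short) (rule nd'(1))
  have sCB: "dist C B < 2 * cmod w" unfolding P(3) EB
    by (subst dist_commute, rule short) (simp only: nq dd nd not_False_eq_True)
  have sDA: "dist D A < 2 * cmod w" unfolding P(1) ED
    by (subst dist_commute, rule short) (rule nd'(5))
  have sDB: "dist D B < 2 * cmod w" unfolding EB ED
    by (subst dist_commute, rule short) (unfold alg, rule nd'(2))
  have nc: "\<not> congruent_sets (convex hull {A, B, Y}) (convex hull {C, D, Y'})"
    if "dist C Y' < 2 * cmod w" "dist D Y' < 2 * cmod w" for Y Y'
  proof
    assume "congruent_sets (convex hull {A, B, Y}) (convex hull {C, D, Y'})"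
    then obtain f where f: "isometry f" "convex hull {C, D, Y'} = f ` (convex hull {A, B, Y})" unfolding congruent_sets_def by blast
    have "f A \<in> convex hull {C, D, Y'}" "f B \<in> convex hull {C, D, Y'}" unfolding f(2) by (auto intro!: imageI hull_inc)
    then have "dist (f A) (f B) < 2 * cmod w" using small sCD that by blast
    then show False using f(1) AB by (simp add: isometry_def)
  qed
  have CD: "dist C D = 4 * s d 1 * s d (q - 1)"
  proof -
    have "E d \<nu> = E d (\<nu> - 1) * E d 1" by (simp flip: E_add)
    then have "C - D = w * (E d (\<nu> - 1) * (1 + E d 1))" unfolding P by (simp add: algebra_simps)
    moreover have "1 + E d 1 = cis (- (pi / real d)) * of_real (2 * cos (pi / real d))"
      unfolding cis_add_cis_minus[symmetric] distrib_left cis_mult by (simp add: E_def flip: mult_2 distrib_left add_divide_distrib)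
    moreover have "cos (pi / real d) > 0" using d2 by (intro cos_gt_zero_pi) (auto simp: field_simps intro: less_trans[of _ 0])
    ultimately have "dist C D = cmod w * (2 * cos (pi / real d))" by (simp add: dist_norm norm_mult)
    moreover have "s d (q - 1) = cos (pi / real d)"
    proof -
      have "real (q - 1) * pi / real d = pi / 2 - pi / real d" using dq q2 by (simp add: field_simps of_nat_diff)
      then show ?thesis by (simp add: s_def cos_sin_eq)
    qed
    ultimately show ?thesis by (simp add: w s_def)
  qed
  have AB': "dist A B = 4 * s d 1 * s d q"
  proof -
    have "real q * pi / real d = pi / 2" using dq q2 by simp
    then have "s d q = 1" unfolding s_def by (simp only: sin_pi_half)
    then show ?thesis by (simp add: AB w s_def)
  qed
  show "flip d {convex hull {A, B, C}, convex hull {A, B, D}} {convex hull {C, D, A}, convex hull {C, D, B}}"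
    unfolding flip_def
    by (rule exI[of _ A], rule exI[of _ B], rule exI[of _ C], rule exI[of _ D], rule exI[of _ q], rule exI[of _ "q - 1"],
      rule exI[of _ "convex hull {A, B, C}"], rule exI[of _ "convex hull {A, B, D}"],
      rule exI[of _ "convex hull {C, D, A}"], rule exI[of _ "convex hull {C, D, B}"])
     (use dq q2 AB' CD XA XC t12 u12 nc sCA sCB sDA sDB in auto)
qed

end

section \<open>The random rules\<close>

lemma copies_image:
  assumes h: "isometry h" and V: "V \<in> copies image \<F>" shows "h ` V \<in> copies image \<F>"
proof -
  obtain g W where W: "isometry g" "W \<in> \<F>" "V = g ` W" using V unfolding copies_def by blast
  then have "h ` V = (h \<circ> g) ` W" "isometry (h \<circ> g)" using isometry_comp[OF h] by (simp_all add: image_comp)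
  then show ?thesis unfolding copies_def using W(2) by blast
qed

lemma copies_self: "V \<in> \<F> \<Longrightarrow> V \<in> copies image \<F>"
  unfolding copies_def using isometry_id by (intro CollectI exI[of _ id] exI[of _ V]) simp

context
  fixes d :: nat
  assumes d2: "d > 2"
begin

lemma Tri_E:
  assumes s: "int d dvd l + m + n - (\<kappa> + t)" and nd: "\<not> int d dvd l - m" "\<not> int d dvd m - n" "\<not> int d dvd l - n"
    and t: "\<not> int d dvd t"
  shows "Tri d \<kappa> l m n = convex hull ((\<lambda>x. rot d \<kappa> * \<Sum>(E d ` {l, m, n}) + rot d \<kappa> * (cis (2 * (of_int t * pi / real d)) - 1) * x) ` E d ` {l, m, n})"
proof -
  have s': "int d dvd m + l + n - (\<kappa> + t)" "int d dvd n + l + m - (\<kappa> + t)" using s by (simp_all add: algebra_simps)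
  have nk: "\<not> int d dvd l + m + n - \<kappa>"
  proof
    assume "int d dvd l + m + n - \<kappa>"
    then have "int d dvd (l + m + n - \<kappa>) - (l + m + n - (\<kappa> + t))" using s by (rule dvd_diff)
    then show False using t by simp
  qed
  have "E d l \<noteq> E d m" "E d m \<noteq> E d n" "E d l \<noteq> E d n" using nd by (simp_all add: E_eq_iff[OF d2])
  then have S: "\<Sum>(E d ` {l, m, n}) = E d l + E d m + E d n" by simp
  show ?thesis
    unfolding Tri_iff(2)[OF d2 nd nk] S using ptf_E[OF d2 s] ptf_E[OF d2 s'(1)] ptf_E[OF d2 s'(2)]
    by (simp add: add_ac)
qed

text \<open>Converse of \<open>inflation_exists\<close>. \<open>variants\<close> admits every choice
  of \<theta>, family and motion, so each choice has to be shown to come from a frame; the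
  differences and the sum of the angles determine the indices.\<close>

lemma inflation_data_frame:
  assumes i: "inflation_data d p T \<kappa>' B h" and p: "0 < p" "p < d"
  obtains M \<alpha> \<beta> \<gamma> where "frame d \<kappa>' M \<alpha> \<beta> \<gamma>" "B = Tri d \<kappa>' \<alpha> \<beta> \<gamma>" "\<kappa>' \<in> K d" "isometry h"
    "h ` B = (\<lambda>x. iota d p *\<^sub>R x) ` fst T"
proof -
  obtain \<kappa> \<sigma> l m n \<theta> \<phi>1 \<phi>2 \<phi>3 k where D: "\<kappa> \<in> K d" "elementary d \<kappa> \<sigma> l m n"
     "\<phi>1 = ang d \<kappa> l" "\<phi>2 = ang d \<kappa> m" "\<phi>3 = ang d \<kappa> n" "T = decorated d \<sigma> \<phi>1 \<phi>2 \<phi>3"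
     "3 * \<theta> = - real_of_int \<sigma> * (real p + 1) * pi / real d + real_of_int k * pi"
     "\<kappa>' \<in> K d" "{\<phi>1 + \<theta>, \<phi>2 + \<theta>, \<phi>3 + \<theta>} \<subseteq> range (ang d \<kappa>')" "B = triangle (\<phi>1 + \<theta>) (\<phi>2 + \<theta>) (\<phi>3 + \<theta>)"
     "isometry h" "h (meet (\<phi>1 + \<theta>) (\<phi>2 + \<theta>)) = iota d p *\<^sub>R meet \<phi>1 \<phi>2"
     "h (meet (\<phi>2 + \<theta>) (\<phi>3 + \<theta>)) = iota d p *\<^sub>R meet \<phi>2 \<phi>3"
     "h (meet (\<phi>1 + \<theta>) (\<phi>3 + \<theta>)) = iota d p *\<^sub>R meet \<phi>1 \<phi>3"
    using i unfolding inflation_data_def by (elim exE conjE) (rule that, assumption+)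
  note k = D(7)
  obtain x y z where xyz: "\<phi>1 + \<theta> = ang d \<kappa>' x" "\<phi>2 + \<theta> = ang d \<kappa>' y" "\<phi>3 + \<theta> = ang d \<kappa>' z"
    using D(9) by auto
  note el = elementary_Tri[OF d2 D(2)]
  have \<sigma>: "\<sigma> = 1 \<or> \<sigma> = - 1" "int d dvd l + m + n - (\<kappa> + \<sigma>)" using D(2) by (auto simp: elementary_iff[OF d2])
  have df: "a - b = a' - b'" if "ang d \<kappa> a + \<theta> = ang d \<kappa>' a'" "ang d \<kappa> b + \<theta> = ang d \<kappa>' b'" for a b a' b'
  proof -
    have "ang d \<kappa> a - ang d \<kappa> b = ang d \<kappa>' a' - ang d \<kappa>' b'" using that by linarith
    then have "(real_of_int a - b) * pi / real d = (real_of_int a' - b') * pi / real d"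
      using d2 by (simp add: ang_def field_simps)
    then have "real_of_int (a - b) = real_of_int (a' - b')" using d2 by simp
    then show ?thesis unfolding of_int_eq_iff .
  qed
  have dxyz: "l - m = x - y" "m - n = y - z" "l - n = x - z"
    using df xyz unfolding D(3-5) by blast+
  have sum: "(x + y + z) - \<kappa>' = (l + m + n - \<kappa>) - \<sigma> * (int p + 1) + k * int d"
  proof -
    have "ang d \<kappa>' x + ang d \<kappa>' y + ang d \<kappa>' z = ang d \<kappa> l + ang d \<kappa> m + ang d \<kappa> n + 3 * \<theta>"
      using xyz unfolding D(3-5) by linarith
    moreover define C where "C = pi / (3 * real d)"
    ultimately have "(3 * real_of_int x - \<kappa>') * C + (3 * real_of_int y - \<kappa>') * C + (3 * real_of_int z - \<kappa>') * C
        = (3 * real_of_int l - \<kappa>) * C + (3 * real_of_int m - \<kappa>) * C + (3 * real_of_int n - \<kappa>) * C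
          - 3 * real_of_int \<sigma> * (real p + 1) * C + 3 * real_of_int k * real d * C"
      unfolding k using d2 by (simp add: ang_def)
    then have "(3 * C) * ((real_of_int (x + y + z) - \<kappa>') - (real_of_int (l + m + n) - \<kappa> - \<sigma> * (real p + 1) + k * real d)) = 0"
      by (simp add: algebra_simps)
    moreover have "3 * C \<noteq> 0" using d2 by (simp add: C_def)
    ultimately have "real_of_int (x + y + z) - \<kappa>' = real_of_int (l + m + n) - \<kappa> - \<sigma> * (real p + 1) + k * real d" by simp
    then have "real_of_int ((x + y + z) - \<kappa>') = real_of_int ((l + m + n - \<kappa>) - \<sigma> * (int p + 1) + k * int d)" by simp
    then show ?thesis unfolding of_int_eq_iff .
  qed
  define t where "t = - \<sigma> * int p"
  have st: "int d dvd x + y + z - (\<kappa>' + t)"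
  proof -
    have "x + y + z - (\<kappa>' + t) = (l + m + n - (\<kappa> + \<sigma>)) + k * int d" using sum by (simp add: t_def algebra_simps)
    then show ?thesis using \<sigma>(2) by simp
  qed
  have ndt: "\<not> int d dvd t" using nat_dvd_not_less[OF p] \<sigma>(1) by (auto simp: t_def)
  have nd: "\<not> int d dvd x - y" "\<not> int d dvd y - z" "\<not> int d dvd x - z" using el dxyz by simp_all
  obtain \<alpha> \<beta> \<gamma> where s: "\<alpha> < \<beta>" "\<beta> < \<gamma>" "\<gamma> < \<alpha> + int d" "E d ` {\<alpha>, \<beta>, \<gamma>} = E d ` {x, y, z}"
    "int d dvd (x + y + z) - (\<alpha> + \<beta> + \<gamma>)" by (rule sorted_residues[OF d2 nd])
  have st': "int d dvd \<alpha> + \<beta> + \<gamma> - (\<kappa>' + t)" using dvd_diff[OF st s(5)] by (simp add: algebra_simps)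
  define M where "M = (if \<sigma> = 1 then int p else int d - int p)"
  have f: "frame d \<kappa>' M \<alpha> \<beta> \<gamma>"
  proof -
    have eq: "\<alpha> + \<beta> + \<gamma> + M - \<kappa>' = (\<alpha> + \<beta> + \<gamma> - (\<kappa>' + t)) + (if \<sigma> = 1 then 0 else int d)"
      using \<sigma>(1) by (auto simp: M_def t_def)
    have "int d dvd \<alpha> + \<beta> + \<gamma> + M - \<kappa>'" unfolding eq by (rule dvd_add[OF st']) simp
    then show ?thesis using s p by (simp add: frame_def M_def)
  qed
  have B: "B = Tri d \<kappa>' x y z" unfolding D(10) xyz Tri_def ..
  also have "\<dots> = Tri d \<kappa>' \<alpha> \<beta> \<gamma>"
    unfolding Tri_E[OF st nd ndt] Tri_E[OF st' frame_Tri(1-3)[OF d2 f] ndt] s(4) ..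
  finally have B': "B = Tri d \<kappa>' \<alpha> \<beta> \<gamma>" .
  have "h ` B = convex hull {iota d p *\<^sub>R meet \<phi>1 \<phi>2, iota d p *\<^sub>R meet \<phi>2 \<phi>3, iota d p *\<^sub>R meet \<phi>1 \<phi>3}"
    unfolding D(10) triangle_def isometry_convex_hull[OF D(11)] by (simp only: image_insert image_empty D(12-14))
  also have "\<dots> = (\<lambda>x. iota d p *\<^sub>R x) ` fst T"
    unfolding D(6) decorated_def Let_def fst_conv triangle_def
    using convex_hull_scaling[of "iota d p" "{meet \<phi>1 \<phi>2, meet \<phi>2 \<phi>3, meet \<phi>1 \<phi>3}"] by simp
  finally show ?thesis using that[OF f B' D(8,11)] by blast
qed

lemma ptf_in_Gfam:
  assumes "int d dvd a + b + e - \<kappa>" shows "ptf d \<kappa> a b \<in> Gfam d \<kappa> e"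
proof -
  obtain k where "a + b + e - \<kappa> = int d * k" using assms by blast
  then have "real_of_int (a + b + e - \<kappa>) = real_of_int (int d * k)" by (simp only:)
  then have e: "real_of_int e = real_of_int \<kappa> + real d * real_of_int k - real_of_int a - real_of_int b" by simp
  have "ang d \<kappa> a + ang d \<kappa> b + ang d \<kappa> e = pi * of_int k"
    using d2 unfolding ang_def of_int_diff of_int_mult e by (simp add: field_simps)
  then have "pt (ang d \<kappa> a) (ang d \<kappa> b) = pt (ang d \<kappa> e) (ang d \<kappa> a)" using pt_third pt_commute by metis
  then show ?thesis using pt_in_G by (simp add: ptf_def Gfam_def flip: ang_angr)
qed

lemma meet_ptf: "\<not> int d dvd a - b \<Longrightarrow> meet (ang d \<kappa> a) (ang d \<kappa> b) = ptf d \<kappa> a b"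
  using meet_eq_pt sin_angr_diff[OF d2, of \<kappa> a b] sg_zero_iff[OF d2, of "a - b"] by (simp add: ang_angr ptf_def)

end

section \<open>The quadrilaterals along the regular polygon\<close>

context
  fixes d q :: nat
  assumes dq: "d = 2 * q" and q2: "q > 2"
begin

text \<open>The roots of the perpendicular lines \<open>c\<close> and \<open>q + c\<close> cancel in
  the circumcentre, so both triangles are inscribed in the circle around
  \<open>rot d \<kappa> * E d \<nu>\<close> and share the diameter on the line \<nu>.\<close>

lemma quad_family:
  fixes \<kappa> c \<nu> :: int
  defines "z \<equiv> rot d \<kappa> * E d \<nu>" and "w \<equiv> rot d \<kappa> * (cis (2 * (of_int (- 1) * pi / real d)) - 1)"
  assumes s: "int d dvd 2 * c + int q + \<nu> - (\<kappa> - 1)" and k: "\<not> int q dvd \<nu> - c" "\<not> int q dvd \<nu> - c - 1"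
  shows "cmod w = 2 * sin (pi / real d)"
    "elementary d \<kappa> (- 1) c (int q + c) \<nu>" "elementary d \<kappa> 1 (c + 1) (int q + (c + 1)) \<nu>"
    "ptf d \<kappa> c (int q + c) = z + w * E d \<nu>" "ptf d \<kappa> (c + 1) (int q + (c + 1)) = z - w * E d (\<nu> - 1)"
    "ptf d \<kappa> (int q + c) \<nu> = z + w * E d c" "ptf d \<kappa> c \<nu> = z - w * E d c"
    "Tri d \<kappa> c (int q + c) \<nu> = convex hull {z + w * E d c, z - w * E d c, z + w * E d \<nu>}"
    "Tri d \<kappa> (c + 1) (int q + (c + 1)) \<nu> = convex hull {z + w * E d c, z - w * E d c, z - w * E d (\<nu> - 1)}"
proof -
  have d2: "d > 2" using dq q2 by simp
  note ant = E_antipode[OF dq q2]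
  show "cmod w = 2 * sin (pi / real d)"
    unfolding w_def norm_mult norm_cis_minus_1[OF d2] norm_rot[OF d2] using s1_pos[OF d2] by simp
  define w2 where "w2 = rot d \<kappa> * (cis (2 * (of_int 1 * pi / real d)) - 1)"
  \<comment> \<open>Passing from \<open>c\<close> to \<open>c + 1\<close> compensates the change of
    sign, so that both triangles can be expressed by the same \<open>w\<close>.\<close>
  have w2: "w2 * E d (j + 1) = - (w * E d j)" for j
  proof -
    have "(cis (2 * (of_int 1 * pi / real d)) - 1) * E d 1 = 1 - cis (2 * (of_int (- 1) * pi / real d))"
      unfolding left_diff_distrib E_def cis_mult by simp
    note e = this
    have "w2 * E d (j + 1) = rot d \<kappa> * ((cis (2 * (of_int 1 * pi / real d)) - 1) * E d 1) * E d j"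
      unfolding w2_def E_add by (simp only: mult_ac)
    also have "\<dots> = - (w * E d j)" unfolding e w_def by (simp add: algebra_simps)
    finally show ?thesis .
  qed
  have nd: "\<not> int d dvd c - (int q + c)" "\<not> int d dvd (c + 1) - (int q + (c + 1))"
    using q2 dq zdvd_imp_le[of "int d" "int q"] by auto
  have hf: "\<not> int d dvd y" if "\<nu> - c - y = int q * r \<or> \<nu> - c - 1 - y = int q * r" for y r
  proof
    assume "int d dvd y"
    then have "int q dvd y" using not_dvd_half[OF dq q2] by blast
    then have "int q dvd y + int q * r" by simp
    moreover have "\<nu> - c = y + int q * r \<or> \<nu> - c - 1 = y + int q * r" using that by linarith
    ultimately show False using k by auto
  qed
  have neg: "\<not> int d dvd i - j" if "\<not> int d dvd j - i" for i j
    using that by (metis dvd_minus_iff minus_diff_eq)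
  have nd1: "\<not> int d dvd int q + c - \<nu>" "\<not> int d dvd c - \<nu>"
    by (rule neg, rule hf[of _ 1], simp) (rule neg, rule hf[of _ 0], simp)
  have nd2: "\<not> int d dvd int q + (c + 1) - \<nu>" "\<not> int d dvd c + 1 - \<nu>"
    by (rule neg, rule hf[of _ 1], simp) (rule neg, rule hf[of _ 0], simp)
  have s1: "int d dvd c + (int q + c) + \<nu> - (\<kappa> + - 1)" "int d dvd \<nu> + c + (int q + c) - (\<kappa> + - 1)"
      "int d dvd (int q + c) + c + \<nu> - (\<kappa> + - 1)"
    using s by (simp_all add: algebra_simps)
  have s2: "int d dvd (c + 1) + (int q + (c + 1)) + \<nu> - (\<kappa> + 1)" "int d dvd \<nu> + (c + 1) + (int q + (c + 1)) - (\<kappa> + 1)"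
      "int d dvd (int q + (c + 1)) + (c + 1) + \<nu> - (\<kappa> + 1)"
    using s by (simp_all add: algebra_simps)
  show e1: "elementary d \<kappa> (- 1) c (int q + c) \<nu>" unfolding elementary_iff[OF d2] using nd(1) nd1 s1(1) by simp
  show e2: "elementary d \<kappa> 1 (c + 1) (int q + (c + 1)) \<nu>" unfolding elementary_iff[OF d2] using nd(2) nd2 s2(1) by simp
  show C: "ptf d \<kappa> c (int q + c) = z + w * E d \<nu>"
    unfolding ptf_E[OF d2 s1(2)] z_def w_def ant by simp
  show A: "ptf d \<kappa> (int q + c) \<nu> = z + w * E d c"
    unfolding ptf_E[OF d2 s1(1)] z_def w_def ant by simp
  show B: "ptf d \<kappa> c \<nu> = z - w * E d c"
    unfolding ptf_E[OF d2 s1(3)] z_def w_def ant by simp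
  have D0: "ptf d \<kappa> (c + 1) (int q + (c + 1)) = z + w2 * E d (\<nu> - 1 + 1)"
    unfolding ptf_E[OF d2 s2(2)] z_def w2_def ant by simp
  then show D: "ptf d \<kappa> (c + 1) (int q + (c + 1)) = z - w * E d (\<nu> - 1)" unfolding w2 by simp
  have "ptf d \<kappa> (int q + (c + 1)) \<nu> = z + w2 * E d (c + 1)"
    unfolding ptf_E[OF d2 s2(1)] z_def w2_def ant by simp
  then have B2: "ptf d \<kappa> (int q + (c + 1)) \<nu> = z - w * E d c" unfolding w2 by simp
  have "ptf d \<kappa> (c + 1) \<nu> = z - w2 * E d (c + 1)"
    unfolding ptf_E[OF d2 s2(3)] z_def w2_def ant by simp
  then have A2: "ptf d \<kappa> (c + 1) \<nu> = z + w * E d c" unfolding w2 by simp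
  show "Tri d \<kappa> c (int q + c) \<nu> = convex hull {z + w * E d c, z - w * E d c, z + w * E d \<nu>}"
    unfolding Tri_iff(2)[OF d2 elementary_Tri[OF d2 e1]] A B C ..
  show "Tri d \<kappa> (c + 1) (int q + (c + 1)) \<nu> = convex hull {z + w * E d c, z - w * E d c, z - w * E d (\<nu> - 1)}"
    unfolding Tri_iff(2)[OF d2 elementary_Tri[OF d2 e2]] A2 B2 D by (simp only: insert_commute)
qed

lemma half_cases: "int q dvd x \<Longrightarrow> int d dvd x \<or> int d dvd x - int q"
proof -
  assume "int q dvd x"
  then obtain r where r: "x = int q * r" by blast
  show ?thesis
  proof (cases "even r")
    case True
    then obtain r' where "r = 2 * r'" by blast
    then have "x = int d * r'" by (simp add: r dq)
    then show ?thesis by simp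
  next
    case False
    then obtain r' where "r = 2 * r' + 1" by (rule oddE)
    then have "x - int q = int d * r'" by (simp add: r dq algebra_simps)
    then show ?thesis by simp
  qed
qed

lemma P_vertex_ptf: "P_vertex d \<kappa> c = ptf d \<kappa> c (int q + c)"
proof -
  have d2: "d > 2" using dq q2 by simp
  have "\<not> int d dvd c - (int q + c)" using q2 dq zdvd_imp_le[of "int d" "int q"] by auto
  then show ?thesis using meet_ptf[OF d2] dq by (simp add: P_vertex_def)
qed

text \<open>In the degenerate cases a line through one end of the polygon side has exactly the index
  of the third line through the other end. The side then lies on a segment of the family, which
  \<open>flippable\<close> rules out.\<close>

lemma flippable_nondegenerate:
  assumes "c \<in> flippable d \<kappa> B"
  shows "\<not> int q dvd quad_index d \<kappa> c - c" "\<not> int q dvd quad_index d \<kappa> c - c - 1"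
proof -
  have d2: "d > 2" using dq q2 by simp
  have no: "\<not> closed_segment (P_vertex d \<kappa> c) (P_vertex d \<kappa> (c + 1)) \<subseteq> Gfam d \<kappa> e" for e
    using assms unfolding flippable_def by blast
  have cl: False if "P_vertex d \<kappa> c \<in> Gfam d \<kappa> e" "P_vertex d \<kappa> (c + 1) \<in> Gfam d \<kappa> e" for e
    using no[of e] closed_segment_subset[OF that] by (simp add: Gfam_def G_def)
  have l1: "P_vertex d \<kappa> c \<in> Gfam d \<kappa> c" "P_vertex d \<kappa> c \<in> Gfam d \<kappa> (int q + c)"
     "P_vertex d \<kappa> (c + 1) \<in> Gfam d \<kappa> (c + 1)" "P_vertex d \<kappa> (c + 1) \<in> Gfam d \<kappa> (int q + (c + 1))"
    unfolding P_vertex_ptf ptf_def ang_angr[symmetric] Gfam_def using pt_in_G pt_commute by metis+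
  have l2: "P_vertex d \<kappa> c \<in> Gfam d \<kappa> e" if "int d dvd c + (int q + c) + e - \<kappa>" for e
    unfolding P_vertex_ptf by (rule ptf_in_Gfam[OF d2 that])
  have l3: "P_vertex d \<kappa> (c + 1) \<in> Gfam d \<kappa> e" if "int d dvd (c + 1) + (int q + (c + 1)) + e - \<kappa>" for e
    unfolding P_vertex_ptf by (rule ptf_in_Gfam[OF d2 that])
  have per: "int d dvd x" if "int d dvd y" "x = - y \<or> x = int d - y \<or> x = - int d - y" for x y
    using that by auto
  show "\<not> int q dvd quad_index d \<kappa> c - c"
  proof
    assume "int q dvd quad_index d \<kappa> c - c"
    then have "int d dvd quad_index d \<kappa> c - c \<or> int d dvd quad_index d \<kappa> c - c - int q" by (rule half_cases)
    then show False
    proof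
      assume h: "int d dvd quad_index d \<kappa> c - c"
      show False by (rule cl[OF l2 l1(3)]) (rule per[OF h], simp add: quad_index_def dq)
    next
      assume h: "int d dvd quad_index d \<kappa> c - c - int q"
      show False by (rule cl[OF l2 l1(4)]) (rule per[OF h], simp add: quad_index_def dq)
    qed
  qed
  show "\<not> int q dvd quad_index d \<kappa> c - c - 1"
  proof
    assume "int q dvd quad_index d \<kappa> c - c - 1"
    then have "int d dvd quad_index d \<kappa> c - c - 1 \<or> int d dvd quad_index d \<kappa> c - c - 1 - int q" by (rule half_cases)
    then show False
    proof
      assume h: "int d dvd quad_index d \<kappa> c - c - 1"
      show False by (rule cl[OF l1(1) l3]) (rule per[OF h], simp add: quad_index_def dq)
    next
      assume h: "int d dvd quad_index d \<kappa> c - c - 1 - int q"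
      show False by (rule cl[OF l1(2) l3]) (rule per[OF h], simp add: quad_index_def dq)
    qed
  qed
qed

lemma quad_index_sum: "int d dvd 2 * c + int q + quad_index d \<kappa> c - (\<kappa> - 1)"
  by (simp add: quad_index_def dq)

lemma flippable_quads:
  assumes c: "c \<in> flippable d \<kappa> B"
  shows "quad_old d \<kappa> c = {Tri d \<kappa> c (int q + c) (quad_index d \<kappa> c), Tri d \<kappa> (c + 1) (int q + (c + 1)) (quad_index d \<kappa> c)}"
    and "\<Union>(quad_old d \<kappa> c) = \<Union>(quad_new d \<kappa> c)" and "nonoverlapping id (quad_new d \<kappa> c)"
    and "quad_new d \<kappa> c \<subseteq> copies image (Fbar d)" and "finite (quad_new d \<kappa> c)"
proof -
  have d2: "d > 2" using dq q2 by simp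
  let ?\<nu> = "quad_index d \<kappa> c"
  note Q = quad_family[OF quad_index_sum flippable_nondegenerate[OF c]]
  note fq = flip_quad[OF dq q2 Q(1) flippable_nondegenerate[OF c] refl refl refl refl, of "rot d \<kappa> * E d ?\<nu>"]
  have nd: "\<not> int d dvd c - ?\<nu>" "\<not> int d dvd int q + c - ?\<nu>" using elementary_Tri[OF d2 Q(2)] by simp_all
  show old: "quad_old d \<kappa> c = {Tri d \<kappa> c (int q + c) ?\<nu>, Tri d \<kappa> (c + 1) (int q + (c + 1)) ?\<nu>}"
    by (simp add: quad_old_def Tri_def dq)
  define A1 B1 C1 D1 where ABCD: "A1 = rot d \<kappa> * E d ?\<nu> + rot d \<kappa> * (cis (2 * (of_int (- 1) * pi / real d)) - 1) * E d c"
     "B1 = rot d \<kappa> * E d ?\<nu> - rot d \<kappa> * (cis (2 * (of_int (- 1) * pi / real d)) - 1) * E d c"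
     "C1 = rot d \<kappa> * E d ?\<nu> + rot d \<kappa> * (cis (2 * (of_int (- 1) * pi / real d)) - 1) * E d ?\<nu>"
     "D1 = rot d \<kappa> * E d ?\<nu> - rot d \<kappa> * (cis (2 * (of_int (- 1) * pi / real d)) - 1) * E d (?\<nu> - 1)"
  note fq' = fq[folded ABCD]
  have "quad_new d \<kappa> c = (\<lambda>e. convex hull {C1, D1, ptf d \<kappa> e ?\<nu>}) ` {c, int q + c}"
    unfolding quad_new_def P_vertex_ptf Q(4,5) ABCD(3,4)[symmetric] using meet_ptf[OF d2 nd(1)] meet_ptf[OF d2 nd(2)] dq by simp
  also have "\<dots> = {convex hull {C1, D1, A1}, convex hull {C1, D1, B1}}"
    unfolding image_insert image_empty Q(6,7) ABCD(1,2)[symmetric] by (rule insert_commute)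
  finally have new: "quad_new d \<kappa> c = {convex hull {C1, D1, A1}, convex hull {C1, D1, B1}}" .
  show "\<Union>(quad_old d \<kappa> c) = \<Union>(quad_new d \<kappa> c)"
    unfolding old new Q(8,9) ABCD[symmetric] using fq'(2) by simp
  show "nonoverlapping id (quad_new d \<kappa> c)" "quad_new d \<kappa> c \<subseteq> copies image (Fbar d)" "finite (quad_new d \<kappa> c)"
    unfolding new using fq'(3,4) by simp_all
qed

text \<open>The indices of an elementary triangle are distinct modulo \<open>d\<close>, so only one
  pair of them differs by \<open>q\<close>, corresponding to the right angle.\<close>

lemma right_angle_unique:
  assumes "elementary d \<kappa> \<sigma> e (int q + e) \<nu>" "elementary d \<kappa> \<sigma>' e' (int q + e') \<nu>'"
    and "Tri d \<kappa> e (int q + e) \<nu> = Tri d \<kappa> e' (int q + e') \<nu>'"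
  shows "\<sigma> = \<sigma>'" "int q dvd e - e'"
proof -
  have d2: "d > 2" using dq q2 by simp
  have "interior (Tri d \<kappa> e (int q + e) \<nu>) \<noteq> {}"
    using regular_triangle(1)[OF Tri_iff(1)[OF d2 elementary_Tri[OF d2 assms(1)]]] Tri_iff(2)[OF d2 elementary_Tri[OF d2 assms(1)]] by simp
  then have "interior (Tri d \<kappa> e (int q + e) \<nu>) \<inter> interior (Tri d \<kappa> e' (int q + e') \<nu>') \<noteq> {}" using assms(3) by simp
  note o = elementary_overlap[OF d2 assms(1,2) this]
  show "\<sigma> = \<sigma>'" by (rule o(2))
  have mem: "int d dvd x - e \<or> int d dvd x - (int q + e) \<or> int d dvd x - \<nu>" if "x \<in> {e', int q + e', \<nu>'}" for x
  proof -
    have "x mod int d \<in> (\<lambda>j. j mod int d) ` {e, int q + e, \<nu>}" unfolding o(3) using that by blast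
    then show ?thesis by (auto simp: mod_eq_dvd_iff)
  qed
  have hq: "int d dvd y \<Longrightarrow> int q dvd y" for y using not_dvd_half[OF dq q2] by blast
  have "int q dvd e' - e \<or> int d dvd e' - \<nu>"
  proof -
    have "int q dvd e' - e" if "int d dvd e' - (int q + e)"
    proof -
      have "int q dvd (e' - (int q + e)) + int q" using hq[OF that] by (rule dvd_add) simp
      then show ?thesis by simp
    qed
    then show ?thesis using mem[of e'] hq[of "e' - e"] by blast
  qed
  moreover have "int q dvd e' - e" if \<nu>: "int d dvd e' - \<nu>"
  proof -
    note nd = elementary_Tri[OF d2 assms(1)]
    have "int d dvd int q + e' - e \<or> int d dvd int q + e' - (int q + e) \<or> int d dvd int q + e' - \<nu>" using mem[of "int q + e'"] by simp
    then show ?thesis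
    proof (elim disjE)
      assume h: "int d dvd int q + e' - e"
      have "int q dvd (int q + e' - e) - int q" by (rule dvd_diff[OF hq[OF h] dvd_refl])
      then show ?thesis by simp
    next
      assume "int d dvd int q + e' - (int q + e)"
      then show ?thesis using hq by simp
    next
      assume "int d dvd int q + e' - \<nu>"
      then have "int d dvd (int q + e' - \<nu>) - (e' - \<nu>)" using \<nu> by (rule dvd_diff)
      then show ?thesis using q2 dq zdvd_imp_le[of "int d" "int q"] by simp
    qed
  qed
  ultimately have "int q dvd e' - e" by blast
  then show "int q dvd e - e'" by (metis dvd_minus_iff minus_diff_eq)
qed

text \<open>The two tiles of a quadrilateral have different signs, so a common tile plays the same
  part in both quadrilaterals, and its right angle fixes the index modulo \<open>q\<close>.\<close>

lemma flippable_disjoint: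
  assumes c: "c \<in> flippable d \<kappa> B" and c': "c' \<in> flippable d \<kappa> B" and ne: "c \<noteq> c'"
  shows "quad_old d \<kappa> c \<inter> quad_old d \<kappa> c' = {}"
proof (rule ccontr)
  assume "quad_old d \<kappa> c \<inter> quad_old d \<kappa> c' \<noteq> {}"
  then obtain T where T: "T \<in> quad_old d \<kappa> c" "T \<in> quad_old d \<kappa> c'" by blast
  note Q = quad_family(2,3)[OF quad_index_sum flippable_nondegenerate[OF c]]
  note Q' = quad_family(2,3)[OF quad_index_sum flippable_nondegenerate[OF c']]
  have "int q dvd c - c'"
    using T right_angle_unique[OF Q(1) Q'(1)] right_angle_unique(1)[OF Q(1) Q'(2)] right_angle_unique(1)[OF Q(2) Q'(1)]
      right_angle_unique[OF Q(2) Q'(2)]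
    unfolding flippable_quads(1)[OF c] flippable_quads(1)[OF c'] by auto
  moreover have "0 \<le> c" "c < int q" "0 \<le> c'" "c' < int q" using c c' by (auto simp: flippable_def dq)
  ultimately show False using dvd_imp_le_int[of "c - c'" "int q"] ne by auto
qed

lemma flippable_in_cells:
  assumes c: "c \<in> flippable d \<kappa> B" shows "quad_old d \<kappa> c \<subseteq> fst ` cells d \<kappa> B"
proof -
  have d2: "d > 2" using dq q2 by simp
  note Q = quad_family(2,3)[OF quad_index_sum flippable_nondegenerate[OF c]]
  have "T \<in> fst ` cells d \<kappa> B" if "elementary d \<kappa> \<sigma> l m n" "T = Tri d \<kappa> l m n" "T \<subseteq> B" for T \<sigma> l m n
  proof (rule image_eqI)
    show "T = fst (decorated d \<sigma> (ang d \<kappa> l) (ang d \<kappa> m) (ang d \<kappa> n))" unfolding fst_decorated[OF d2] that(2) ..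
    show "decorated d \<sigma> (ang d \<kappa> l) (ang d \<kappa> m) (ang d \<kappa> n) \<in> cells d \<kappa> B"
      unfolding cells_def Tri_def[symmetric] using that by blast
  qed
  moreover have "T \<subseteq> B" if "T \<in> quad_old d \<kappa> c" for T using c that unfolding flippable_def by blast
  ultimately show ?thesis using Q flippable_quads(1)[OF c] by auto
qed

lemma variants_valid:
  assumes "P \<in> variants d t"
  shows "finite P" "P \<subseteq> copies image (Fbar d)" "nonoverlapping id P" "\<Union>P = (\<lambda>x. iota d q *\<^sub>R x) ` t"
proof -
  have d2: "d > 2" using dq q2 by simp
  obtain T \<kappa> B h C where P: "P = image h ` ((fst ` cells d \<kappa> B - (\<Union>c\<in>C. quad_old d \<kappa> c)) \<union> (\<Union>c\<in>C. quad_new d \<kappa> c))"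
    and T: "T \<in> F d" "fst T = t" "inflation_data d (d div 2) T \<kappa> B h" and C: "C \<subseteq> flippable d \<kappa> B"
    using assms unfolding variants_def by blast
  have "d div 2 = q" "0 < q" "q < d" using dq q2 by simp_all
  note dq' = this
  obtain M \<alpha> \<beta> \<gamma> where f: "frame d \<kappa> M \<alpha> \<beta> \<gamma>" "B = Tri d \<kappa> \<alpha> \<beta> \<gamma>" "\<kappa> \<in> K d" "isometry h"
    "h ` B = (\<lambda>x. iota d q *\<^sub>R x) ` fst T"
    by (rule inflation_data_frame[OF d2 T(3)[unfolded dq'(1)] dq'(2,3)])
  define X where "X = fst ` cells d \<kappa> B"
  define Y where "Y = (X - (\<Union>c\<in>C. quad_old d \<kappa> c)) \<union> (\<Union>c\<in>C. quad_new d \<kappa> c)"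
  have PY: "P = image h ` Y" unfolding P Y_def X_def ..
  have Xn: "nonoverlapping id X" unfolding X_def nonoverlapping_def id_apply
  proof (intro ballI impI, elim imageE)
    fix V W T U assume "V \<noteq> W" "V = fst T" "T \<in> cells d \<kappa> B" "W = fst U" "U \<in> cells d \<kappa> B"
    then show "interior V \<inter> interior W = {}"
      using cells_nonoverlapping[OF d2, of \<kappa> B] unfolding nonoverlapping_def by metis
  qed
  have Xc: "closed V" if "V \<in> X" for V
    using that unfolding X_def cells_def
    by (auto simp: decorated_def Let_def triangle_def intro!: compact_imp_closed finite_imp_compact_convex_hull)
  have XF: "X \<subseteq> Fbar d" unfolding X_def Fbar_def F_def cells_def using f(3) by blast
  have fo: "finite (quad_old d \<kappa> c)" for c by (simp add: quad_old_def)
  have Cc: "quad_old d \<kappa> c \<subseteq> X" "nonoverlapping id (quad_new d \<kappa> c)" "\<Union>(quad_old d \<kappa> c) = \<Union>(quad_new d \<kappa> c)"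
      "finite (quad_new d \<kappa> c)" "quad_new d \<kappa> c \<subseteq> copies image (Fbar d)" if "c \<in> C" for c
    by (fact flippable_in_cells[OF subsetD[OF C that], folded X_def] flippable_quads(3)[OF subsetD[OF C that]]
       flippable_quads(2)[OF subsetD[OF C that]] flippable_quads(5)[OF subsetD[OF C that]]
       flippable_quads(4)[OF subsetD[OF C that]])+
  have dj: "quad_old d \<kappa> c \<inter> quad_old d \<kappa> c' = {}" if "c \<in> C" "c' \<in> C" "c \<noteq> c'" for c c'
    by (rule flippable_disjoint[OF subsetD[OF C that(1)] subsetD[OF C that(2)] that(3)])
  note rp = replace_patches[OF Xn Xc Cc(1) fo Cc(2,3) dj]
  have Yn: "nonoverlapping id Y" and YU: "\<Union>Y = \<Union>X" unfolding Y_def by (rule rp, assumption+)+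
  have "C \<subseteq> {0..<int q}" using C by (auto simp: flippable_def dq)
  then have Cf: "finite C" by (rule finite_subset) simp
  have "finite X" unfolding X_def using finite_cells[OF d2] by simp
  then have "finite Y" unfolding Y_def using Cf Cc(4) by simp
  then show "finite P" unfolding PY by simp
  have "Y \<subseteq> copies image (Fbar d)" unfolding Y_def using XF copies_self[of _ "Fbar d"] Cc(5) by blast
  then show "P \<subseteq> copies image (Fbar d)" unfolding PY using copies_image[OF f(4)] by blast
  show "nonoverlapping id P" unfolding PY by (rule nonoverlapping_isometry[of h id image, OF f(4) _ Yn]) simp
  have "\<Union>P = h ` \<Union>Y" unfolding PY by blast
  also have "\<dots> = h ` B" unfolding YU X_def f(2) cells_union[OF d2 f(1)] ..
  finally show "\<Union>P = (\<lambda>x. iota d q *\<^sub>R x) ` t" using f(5) T(2) by simp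
qed

lemma variants_nonempty:
  assumes "t \<in> Fbar d" shows "variants d t \<noteq> {}"
proof -
  have d2: "d > 2" using dq q2 by simp
  obtain T where T: "T \<in> F d" "t = fst T" using assms unfolding Fbar_def by blast
  obtain \<kappa> \<sigma> l m n where k: "\<kappa> \<in> K d" "elementary d \<kappa> \<sigma> l m n" "l < m" "m < n" "n < l + int d"
    "T = decorated d \<sigma> (ang d \<kappa> l) (ang d \<kappa> m) (ang d \<kappa> n)" by (rule F_DT[OF d2 T(1)])
  have q: "0 < q" "q < d" "d div 2 = q" using dq q2 by simp_all
  obtain \<kappa>' x u v where i: "inflation_data d q T \<kappa>' (Tri d \<kappa>' (x + l) (x + m) (x + n)) (\<lambda>z. u * z + v)"
    unfolding k(6) by (rule inflation_exists[OF d2 k(1-5) q(1,2) refl])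
  have "image (\<lambda>z. u * z + v) ` ((fst ` cells d \<kappa>' (Tri d \<kappa>' (x + l) (x + m) (x + n)) - (\<Union>c\<in>{}. quad_old d \<kappa>' c)) \<union> (\<Union>c\<in>{}. quad_new d \<kappa>' c)) \<in> variants d t"
    unfolding variants_def
    by (rule CollectI, rule exI[of _ T], rule exI[of _ \<kappa>'], rule exI[of _ "Tri d \<kappa>' (x + l) (x + m) (x + n)"],
        rule exI[of _ "\<lambda>z. u * z + v"], rule exI[of _ "{}"]) (use T i q(3) in simp)
  then show ?thesis by blast
qed

lemma iota_gt_1:
  assumes p: "2 \<le> p" "p \<le> q" shows "iota d p > 1"
proof -
  have d2: "d > 2" using dq q2 by simp
  have "sin (pi / real d) < sin (real p * pi / real d)"
  proof (rule sin_monotone_2pi)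
    show "- (pi / 2) \<le> pi / real d" by (rule order_trans[of _ 0]) simp_all
    have "1 * pi < real p * pi" using p(1) by simp
    then show "pi / real d < real p * pi / real d" using d2 by (simp add: divide_strict_right_mono)
    have "real p * pi / real d \<le> real q * pi / real d" using p(2) by (simp add: divide_right_mono)
    also have "\<dots> = pi / 2" using dq q2 by simp
    finally show "real p * pi / real d \<le> pi / 2" .
  qed
  then show ?thesis using s1_pos[OF d2] by (simp add: iota_def s_def)
qed

lemma inflation_factor_Phi_R: "inflation_factor (Fbar d) (Phi_R d) (iota d q)"
proof -
  have i: "iota d q > 1" using iota_gt_1[of q] q2 by simp
  have n: "Phi_R d \<noteq> {}" unfolding Phi_R_def using variants_nonempty by (simp add: PiE_eq_empty_iff)
  have v: "\<Psi> t \<in> variants d t" if "\<Psi> \<in> Phi_R d" "t \<in> Fbar d" for \<Psi> t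
    using that unfolding Phi_R_def by (rule PiE_mem)
  show ?thesis unfolding inflation_factor_def using i n variants_valid[OF v] by simp
qed

end

lemma extend_rule_act:
  assumes comp: "\<And>f g T. act (f \<circ> g) T = act f (act g T)" and l: "l \<noteq> 0" and f: "isometry f"
    and P: "P \<in> extend_rule act l \<F> R U"
  shows "act (scaled l f) ` P \<in> extend_rule act l \<F> R (act f U)"
proof -
  obtain g T P' where g: "isometry g" "T \<in> \<F>" "U = act g T" "P' \<in> R T" and P': "P = act (scaled l g) ` P'"
    using P unfolding extend_rule_def scaled_def by blast
  have "act (scaled l f) ` P = act (scaled l (f \<circ> g)) ` P'"
    unfolding P' scaled_comp[OF l] comp image_image ..
  moreover have "isometry (f \<circ> g)" "act f U = act (f \<circ> g) T" using isometry_comp[OF f g(1)] g(3) comp by simp_all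
  ultimately show ?thesis unfolding extend_rule_def scaled_def using g(2,4) by blast
qed

context
  fixes d :: nat
  assumes d2: "d > 2"
begin

lemma finite_F: "finite (F d)"
proof -
  have "F d = (\<Union>\<kappa>\<in>K d. cells d \<kappa> UNIV)" unfolding F_def cells_def by blast
  then show ?thesis using finite_cells[OF d2] by (simp add: K_def)
qed

text \<open>A tile is contained in its circumscribed disc, whose radius is at most 2; hence the
  bound 4.\<close>

lemma F_copy_supp:
  assumes T: "T \<in> F d" and f: "isometry f"
  shows "compact (f ` fst T)" "interior (f ` fst T) \<noteq> {}" "x \<in> f ` fst T \<Longrightarrow> y \<in> f ` fst T \<Longrightarrow> dist x y \<le> 4"
proof -
  obtain \<kappa> \<sigma> l m n where k: "elementary d \<kappa> \<sigma> l m n" "T = decorated d \<sigma> (ang d \<kappa> l) (ang d \<kappa> m) (ang d \<kappa> n)"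
    by (rule F_DT[OF d2 T])
  define z w where zw: "z = rot d \<kappa> * \<Sum>(E d ` {l, m, n})" "w = rot d \<kappa> * (cis (2 * (of_int \<sigma> * pi / real d)) - 1)"
  have T1: "fst T = convex hull ((\<lambda>e. z + w * e) ` E d ` {l, m, n})"
    unfolding k(2) decorated_DT[OF d2 k(1)] zw DT_def by simp
  show "compact (f ` fst T)" unfolding T1 isometry_convex_hull[OF f] by (rule finite_imp_compact_convex_hull) simp
  have "interior (Tri d \<kappa> l m n) \<noteq> {}"
    using regular_triangle(1)[OF Tri_iff(1)[OF d2 elementary_Tri[OF d2 k(1)]]] Tri_iff(2)[OF d2 elementary_Tri[OF d2 k(1)]] by simp
  then show "interior (f ` fst T) \<noteq> {}" unfolding isometry_interior[OF f] k(2) fst_decorated[OF d2] by simp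
  have "cmod w \<le> 2" unfolding zw norm_mult norm_rot[OF d2] norm_cis_minus_1[OF d2] by simp
  then have "(\<lambda>e. z + w * e) ` E d ` {l, m, n} \<subseteq> cball z 2" by (auto simp: dist_norm norm_mult)
  then have sub: "fst T \<subseteq> cball z 2" unfolding T1 by (rule hull_minimal) (rule convex_cball)
  show "dist x y \<le> 4" if xy: "x \<in> f ` fst T" "y \<in> f ` fst T"
  proof -
    obtain x' y' where x': "x = f x'" "y = f y'" "x' \<in> cball z 2" "y' \<in> cball z 2" using xy sub by blast
    then have "dist x y = dist x' y'" using f by (simp add: isometry_def)
    then show ?thesis using dist_triangle[of x' y' z] x'(3,4) by (simp add: dist_commute)
  qed
qed

end

section \<open>Existence of the random substitution tilings\<close>

context
  fixes d q :: nat
  assumes dq: "d = 2 * q" and q2: "q > 2"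
begin

lemma random_patch:
  assumes "U \<in> copies image (Fbar d)"
  obtains P where "P \<in> random_rule d U" "finite P" "P \<subseteq> copies image (Fbar d)" "nonoverlapping id P"
    "\<Union>P = (\<lambda>x. iota d q *\<^sub>R x) ` U"
proof -
  have l: "iota d q > 1" using iota_gt_1[OF dq q2, of q] q2 by simp
  obtain f t where f: "isometry f" "t \<in> Fbar d" "U = f ` t" using assms unfolding copies_def by blast
  note sf = isometry_scaled[OF _ f(1), of "iota d q"]
  obtain \<Psi> where \<Psi>: "\<Psi> \<in> Phi_R d" using inflation_factor_Phi_R[OF dq q2] unfolding inflation_factor_def by blast
  then have "\<Psi> t \<in> variants d t" using f(2) unfolding Phi_R_def by (rule PiE_mem)
  note v = variants_valid[OF dq q2 this]
  let ?P = "image (scaled (iota d q) f) ` \<Psi> t"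
  have "d div 2 = q" using dq by simp
  then have "?P \<in> random_rule d U"
    unfolding random_rule_def extend_rule_def scaled_def using \<Psi> f by blast
  moreover have "finite ?P" using v(1) by simp
  moreover have "?P \<subseteq> copies image (Fbar d)" using copies_image[OF sf] v(2) l by auto
  moreover have "nonoverlapping id ?P" by (rule nonoverlapping_isometry[of _ id image, OF sf _ v(3)]) (use l in simp_all)
  moreover have "\<Union>?P = (\<lambda>x. iota d q *\<^sub>R x) ` U"
  proof -
    have "\<Union>?P = scaled (iota d q) f ` \<Union>(\<Psi> t)" by blast
    also have "\<dots> = (\<lambda>x. iota d q *\<^sub>R x) ` U" unfolding v(4) f(3) scaled_def image_image using l by simp
    finally show ?thesis .
  qed
  ultimately show ?thesis by (rule that)
qed

lemma R_s_nonempty: "R_s d \<noteq> {}"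
proof -
  have d2: "d > 2" using dq q2 by simp
  have l: "iota d q > 1" using iota_gt_1[OF dq q2, of q] q2 by simp
  let ?tiles = "copies image (Fbar d)"
  obtain D where D: "D U \<in> random_rule d U \<and> finite (D U) \<and> D U \<subseteq> ?tiles \<and> nonoverlapping id (D U) \<and>
      \<Union>(D U) = (\<lambda>x. iota d q *\<^sub>R x) ` U" if "U \<in> ?tiles" for U
  proof -
    have "\<exists>P. U \<in> ?tiles \<longrightarrow> P \<in> random_rule d U \<and> finite P \<and> P \<subseteq> ?tiles \<and> nonoverlapping id P \<and> \<Union>P = (\<lambda>x. iota d q *\<^sub>R x) ` U" for U
    proof (cases "U \<in> ?tiles")
      case True
      obtain P where "P \<in> random_rule d U" "finite P" "P \<subseteq> ?tiles" "nonoverlapping id P" "\<Union>P = (\<lambda>x. iota d q *\<^sub>R x) ` U"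
        by (rule random_patch[OF True])
      then show ?thesis by (intro exI[of _ P]) simp
    qed simp
    then have "\<exists>D. \<forall>U. U \<in> ?tiles \<longrightarrow> D U \<in> random_rule d U \<and> finite (D U) \<and> D U \<subseteq> ?tiles \<and> nonoverlapping id (D U) \<and>
      \<Union>(D U) = (\<lambda>x. iota d q *\<^sub>R x) ` U" by (intro choice allI)
    then show ?thesis using that by blast
  qed
  have tl: "\<exists>f T. isometry f \<and> T \<in> F d \<and> U = f ` fst T" if "U \<in> ?tiles" for U
    using that unfolding copies_def Fbar_def by blast
  \<comment> \<open>Tiles are arbitrary copies here and the group contains the reflections; the
    diameter bound 4 comes from \<open>F_copy_supp\<close>.\<close>
  interpret substitution image id "Fbar d" "random_rule d" "iota d q" ?tiles "{f. isometry f}" D 4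
  proof unfold_locales
    show "(f \<circ> g) ` T = f ` g ` T" for f g :: "complex \<Rightarrow> complex" and T by (simp add: image_comp)
    show "isometry f" if "f \<in> {f. isometry f}" for f using that by simp
    show "f \<circ> g \<in> {f. isometry f}" if "f \<in> {f. isometry f}" "g \<in> {f. isometry f}" for f g
      using that isometry_comp by simp
    show "inv f \<in> {f. isometry f}" if "f \<in> {f. isometry f}" for f using that isometry_inv by simp
    show "scaled (iota d q) f \<in> {f. isometry f}" if "f \<in> {f. isometry f}" for f using that isometry_scaled l by simp
    show "\<exists>f\<in>{f. isometry f}. \<exists>U\<in>Fbar d. T = f ` U" if "T \<in> ?tiles" for T using that unfolding copies_def by blast
    show "f ` T \<in> ?tiles" if "f \<in> {f. isometry f}" "T \<in> ?tiles" for f T using that copies_image by simp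
    show "image (scaled (iota d q) f) ` P \<in> random_rule d (f ` U)" if P: "P \<in> random_rule d U" and f: "f \<in> {f. isometry f}" for P U f
    proof -
      have "d div 2 = q" using dq by simp
      then obtain \<Psi> where "\<Psi> \<in> Phi_R d" "P \<in> extend_rule image (iota d q) (Fbar d) (\<lambda>t. {\<Psi> t}) U"
        using P unfolding random_rule_def by auto
      moreover have "image (scaled (iota d q) f) ` P \<in> extend_rule image (iota d q) (Fbar d) (\<lambda>t. {\<Psi> t}) (f ` U)"
        by (rule extend_rule_act) (use l f calculation in \<open>simp_all add: image_comp\<close>)
      ultimately show ?thesis unfolding random_rule_def \<open>d div 2 = q\<close> by blast
    qed
    show "D U \<in> random_rule d U" "finite (D U)" "D U \<subseteq> ?tiles" "nonoverlapping id (D U)"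
      "\<Union>(id ` D U) = (\<lambda>x. iota d q *\<^sub>R x) ` id U" if "U \<in> ?tiles" for U using D[OF that] by simp_all
    show "compact (id T)" "interior (id T) \<noteq> {}" if "T \<in> ?tiles" for T
      using tl[OF that] F_copy_supp(1,2)[OF d2] by auto
    show "dist x y \<le> 4" if "T \<in> ?tiles" "x \<in> id T" "y \<in> id T" for T x y
      using tl[OF that(1)] that(2,3) F_copy_supp(3)[OF d2] by auto
  qed (use l in auto)
  have "cmod (of_real (2 * sin (pi / real d))) = 2 * sin (pi / real d)" using s1_pos[OF d2] by (simp add: norm_mult)
  moreover have "\<not> int d dvd 0 - 1" "\<not> int d dvd 1 - 2" "\<not> int d dvd 0 - 2" using d2 by (auto dest: zdvd_imp_le)
  ultimately have "?tiles \<noteq> {}" using copy_Fbar[OF dq q2] by blast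
  moreover have "finite (Fbar d)" unfolding Fbar_def using finite_F[OF d2] by simp
  ultimately show ?thesis unfolding R_s_def using finite_protos_tiling by blast
qed

end

section \<open>Rearranged tilings\<close>

text \<open>The quantifier over all types of \<open>V\<close> makes the property independent of the
  presentation of the tile, so that it can be chained through generations.\<close>

definition typed_patch :: "nat \<Rightarrow> int \<Rightarrow> dtile \<Rightarrow> dtile set \<Rightarrow> bool" where
  "typed_patch d M V P \<longleftrightarrow> (\<forall>v. is_type d v \<longrightarrow> has_type d v V \<longrightarrow>
     (\<forall>W\<in>P. \<exists>v'. next_type d M v v' \<and> has_type d v' W) \<and> (\<forall>v'. next_type d M v v' \<longrightarrow> (\<exists>W\<in>P. has_type d v' W)))"

lemma Tri_rotate: "Tri d \<kappa> l m n = Tri d \<kappa> m n l"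
  by (simp add: Tri_def triangle_def meet_def Int_commute insert_commute)

lemma direct_inv:
  assumes "cmod u = 1" shows "inv (\<lambda>z. u * z + t) = (\<lambda>z. (1 / u) * z + - (t / u))"
proof (rule inv_equality)
  have "u \<noteq> 0" using assms by auto
  then show "1 / u * (u * z + t) + - (t / u) = z" "u * (1 / u * z + - (t / u)) + t = z" for z
    by (simp_all add: divide_simps algebra_simps)
qed

context
  fixes d :: nat
  assumes d2: "d > 2"
begin

text \<open>The patch is computed from one type of \<open>V\<close>. By
  \<open>has_type_unique\<close> the other types are cyclic rotations of it, and
  \<open>next_type\<close> commutes with rotation.\<close>

lemma Phi_typed_patch:
  assumes v: "is_type d (a, b, c, \<sigma>)" and V: "has_type d (a, b, c, \<sigma>) V" and p: "0 < p" "p < d" and \<epsilon>: "\<epsilon> = 1 \<or> \<epsilon> = - 1"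
  obtains P \<kappa> \<alpha> \<beta> \<gamma> u t where "P \<in> Phi d p \<epsilon> V" "finite P" "nonoverlapping fst P" "\<Union>(fst ` P) = (\<lambda>x. iota d p *\<^sub>R x) ` fst V"
    "typed_patch d (lev d (int p) \<epsilon>) V P"
    "framed d p (lev d (lev d (int p) \<epsilon>) \<sigma>) a b V \<kappa> \<alpha> \<beta> \<gamma> u t" "P = dmap (\<lambda>z. u * z + t) ` cells d \<kappa> (Tri d \<kappa> \<alpha> \<beta> \<gamma>)"
proof -
  let ?M = "lev d (int p) \<epsilon>"
  obtain \<kappa> \<alpha> \<beta> \<gamma> u t where fr: "framed d p (lev d ?M \<sigma>) a b V \<kappa> \<alpha> \<beta> \<gamma> u t"
    and PP: "dmap (\<lambda>z. u * z + t) ` cells d \<kappa> (Tri d \<kappa> \<alpha> \<beta> \<gamma>) \<in> Phi d p \<epsilon> V" by (rule Phi_patch[OF d2 v V p \<epsilon>])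
  define h where "h = (\<lambda>z. u * z + t)"
  define P where "P = dmap h ` cells d \<kappa> (Tri d \<kappa> \<alpha> \<beta> \<gamma>)"
  have f: "frame d \<kappa> (lev d ?M \<sigma>) \<alpha> \<beta> \<gamma>" and g: "\<beta> = \<alpha> + a" "\<gamma> = \<alpha> + a + b" and u: "cmod u = 1"
    and hB: "h ` Tri d \<kappa> \<alpha> \<beta> \<gamma> = (\<lambda>z. iota d p *\<^sub>R z) ` fst V" using fr unfolding framed_def h_def by auto
  have ih: "isometry h" unfolding h_def by (rule isometry_direct[OF u])
  have gaps: "\<beta> - \<alpha> = a" "\<gamma> - \<beta> = b" "\<alpha> + int d - \<gamma> = c" using g v by (auto simp: is_type_def)
  have fin: "finite P" unfolding P_def using finite_cells[OF d2] by simp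
  have no: "nonoverlapping fst P" unfolding P_def by (rule nonoverlapping_isometry[of h fst dmap, OF ih fst_dmap cells_nonoverlapping[OF d2]])
  have "\<Union>(fst ` P) = h ` \<Union>(fst ` cells d \<kappa> (Tri d \<kappa> \<alpha> \<beta> \<gamma>))" unfolding P_def by (simp add: image_image image_UN)
  also have "\<dots> = (\<lambda>x. iota d p *\<^sub>R x) ` fst V" unfolding cells_union[OF d2 f] hB ..
  finally have cov: "\<Union>(fst ` P) = (\<lambda>x. iota d p *\<^sub>R x) ` fst V" .
  define Q where "Q = (\<lambda>v. (\<forall>W\<in>P. \<exists>v'. next_type d ?M v v' \<and> has_type d v' W) \<and> (\<forall>v'. next_type d ?M v v' \<longrightarrow> (\<exists>W\<in>P. has_type d v' W)))"
  have base: "Q (a, b, c, \<sigma>)" unfolding Q_def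
  proof (intro conjI ballI allI impI)
    fix W assume "W \<in> P"
    then obtain T where T: "T \<in> cells d \<kappa> (Tri d \<kappa> \<alpha> \<beta> \<gamma>)" "W = dmap h T" unfolding P_def by blast
    obtain \<tau> i j k where ch: "child (lev d ?M \<sigma>) (\<beta> - \<alpha>) (\<gamma> - \<beta>) (\<alpha> + int d - \<gamma>) \<tau> i j k"
      "T = decorated d \<tau> (ang d \<kappa> (\<alpha> + i + up \<tau>)) (ang d \<kappa> (\<beta> + j + up \<tau>)) (ang d \<kappa> (\<gamma> + k + up \<tau>))"
      by (rule cells_child[OF d2 f T(1)])
    have "has_type d (a + j - i, b + k - j, c + i - k, \<tau>) W"
      using typ_child[OF d2 f ch(1) u, of t] unfolding gaps T(2) ch(2) h_def .
    moreover have "next_type d ?M (a, b, c, \<sigma>) (a + j - i, b + k - j, c + i - k, \<tau>)"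
      using ch(1) unfolding gaps next_type_def by blast
    ultimately show "\<exists>v'. next_type d ?M (a, b, c, \<sigma>) v' \<and> has_type d v' W" by blast
  next
    fix v' assume "next_type d ?M (a, b, c, \<sigma>) v'"
    then obtain i j k \<tau> where ch: "child (lev d ?M \<sigma>) (\<beta> - \<alpha>) (\<gamma> - \<beta>) (\<alpha> + int d - \<gamma>) \<tau> i j k"
      and v': "v' = (a + j - i, b + k - j, c + i - k, \<tau>)" unfolding next_type_def gaps by auto
    have "has_type d v' (dmap h (decorated d \<tau> (ang d \<kappa> (\<alpha> + i + up \<tau>)) (ang d \<kappa> (\<beta> + j + up \<tau>)) (ang d \<kappa> (\<gamma> + k + up \<tau>))))"
      using typ_child[OF d2 f ch u, of t] unfolding gaps v' h_def .
    then show "\<exists>W\<in>P. has_type d v' W" unfolding P_def using child_in_cells[OF d2 f ch] by blast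
  qed
  have rot: "Q (rotate_type w)" if Qw: "Q w" and w: "is_type d w" for w
    unfolding Q_def
  proof (intro conjI ballI allI impI)
    fix W assume "W \<in> P"
    then obtain v' where "next_type d ?M w v'" "has_type d v' W" using Qw unfolding Q_def by blast
    then show "\<exists>v'. next_type d ?M (rotate_type w) v' \<and> has_type d v' W"
      using next_type_rotate has_type_rotate[OF d2] next_type_is_type[OF w] by blast
  next
    fix v' assume n: "next_type d ?M (rotate_type w) v'"
    \<comment> \<open>Two rotations invert one, as three are the identity.\<close>
    let ?v = "rotate_type (rotate_type v')"
    have "next_type d ?M w ?v" using next_type_rotate[OF next_type_rotate[OF n]] by (simp add: rotate_type_3)
    then obtain W where W: "W \<in> P" "has_type d ?v W" and iv: "is_type d ?v" using Qw next_type_is_type[OF w] unfolding Q_def by blast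
    have "has_type d v' W" using has_type_rotate[OF d2 iv W(2)] by (simp add: rotate_type_3)
    then show "\<exists>W\<in>P. has_type d v' W" using W(1) by blast
  qed
  have "Q w" if "is_type d w" "has_type d w V" for w
  proof -
    note r1 = rot[OF base v]
    note r2 = rot[OF r1 is_type_rotate[OF v]]
    show ?thesis using has_type_unique[OF d2 v V that] base r1 r2 by blast
  qed
  then have "typed_patch d ?M V P" unfolding typed_patch_def Q_def by blast
  from that[OF PP[folded h_def, folded P_def] fin no cov this fr P_def[unfolded h_def]] show ?thesis .
qed

end

section \<open>A flip in the patch of a recurring tile\<close>

context
  fixes d q :: nat
  assumes dq: "d = 2 * q" and q2: "q > 2"
begin

text \<open>The second gap is chosen such that the offset \<open>p - 2\<close> leads from \<gamma>
  to \<beta> + q, the line perpendicular to \<beta>. The child of sign -1 with first offset 1 and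
  the child of sign 1 with first offset 0 both have a side on the line \<alpha> + 1, which carries
  the shared hypotenuse. Nondegeneracy is clear since \<nu> - c = -1 and
  \<open>q > 2\<close>.\<close>

lemma framed_quad:
  assumes f: "framed d p (int p) 2 (int q - int p + 2) V \<kappa> \<alpha> \<beta> \<gamma> u t" and p: "2 \<le> p" "p \<le> q"
    and P: "P = dmap (\<lambda>z. u * z + t) ` cells d \<kappa> (Tri d \<kappa> \<alpha> \<beta> \<gamma>)"
  obtains z w \<nu> c where "cmod w = 2 * sin (pi / real d)" "\<not> int q dvd \<nu> - c" "\<not> int q dvd \<nu> - c - 1"
    "convex hull {z + w * E d c, z - w * E d c, z + w * E d \<nu>} \<in> fst ` P"
    "convex hull {z + w * E d c, z - w * E d c, z - w * E d (\<nu> - 1)} \<in> fst ` P"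
proof -
  have d2: "d > 2" using dq q2 by simp
  have fr: "frame d \<kappa> (int p) \<alpha> \<beta> \<gamma>" and g: "\<beta> = \<alpha> + 2" "\<gamma> = \<alpha> + int q - int p + 4" and u: "cmod u = 1"
    using f unfolding framed_def by auto
  let ?c = "\<alpha> + 2" and ?\<nu> = "\<alpha> + 1"
  have sum: "int d dvd 2 * ?c + int q + ?\<nu> - (\<kappa> - 1)" using fr by (simp add: frame_def g algebra_simps)
  have k: "\<not> int q dvd ?\<nu> - ?c" "\<not> int q dvd ?\<nu> - ?c - 1"
    using q2 zdvd_imp_le[of "int q" 1] zdvd_imp_le[of "int q" 2] by auto
  define z w where zw: "z = rot d \<kappa> * E d ?\<nu>" "w = rot d \<kappa> * (cis (2 * (of_int (- 1) * pi / real d)) - 1)"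
  note Q = quad_family[OF dq q2 sum k, folded zw]
  have hull: "(\<lambda>z. u * z + t) ` (convex hull {z + w * x, z - w * x, y}) = convex hull {(u * z + t) + (u * w) * x, (u * z + t) - (u * w) * x, u * y + t}" for x y
    unfolding convex_hull_complex_affine image_insert image_empty by (simp add: algebra_simps)
  have ch: "child (int p) (\<beta> - \<alpha>) (\<gamma> - \<beta>) (\<alpha> + int d - \<gamma>) (- 1) 1 0 (int p - 2)"
    "child (int p) (\<beta> - \<alpha>) (\<gamma> - \<beta>) (\<alpha> + int d - \<gamma>) 1 0 0 (int p - 2)"
    using p q2 dq by (simp_all add: child_def g)
  have "Tri d \<kappa> (\<alpha> + 1 + up (- 1)) (\<beta> + 0 + up (- 1)) (\<gamma> + (int p - 2) + up (- 1)) \<in> fst ` cells d \<kappa> (Tri d \<kappa> \<alpha> \<beta> \<gamma>)"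
    using imageI[OF child_in_cells[OF d2 fr ch(1)], of fst] unfolding fst_decorated[OF d2] .
  also have "Tri d \<kappa> (\<alpha> + 1 + up (- 1)) (\<beta> + 0 + up (- 1)) (\<gamma> + (int p - 2) + up (- 1)) = Tri d \<kappa> ?c (int q + ?c) ?\<nu>"
    by (subst Tri_rotate) (simp add: up_def g algebra_simps)
  finally have 1: "convex hull {z + w * E d ?c, z - w * E d ?c, z + w * E d ?\<nu>} \<in> fst ` cells d \<kappa> (Tri d \<kappa> \<alpha> \<beta> \<gamma>)"
    unfolding Q(8) .
  have "Tri d \<kappa> (\<alpha> + 0 + up 1) (\<beta> + 0 + up 1) (\<gamma> + (int p - 2) + up 1) \<in> fst ` cells d \<kappa> (Tri d \<kappa> \<alpha> \<beta> \<gamma>)"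
    using imageI[OF child_in_cells[OF d2 fr ch(2)], of fst] unfolding fst_decorated[OF d2] .
  also have "Tri d \<kappa> (\<alpha> + 0 + up 1) (\<beta> + 0 + up 1) (\<gamma> + (int p - 2) + up 1) = Tri d \<kappa> (?c + 1) (int q + (?c + 1)) ?\<nu>"
    by (subst Tri_rotate) (simp add: up_def g algebra_simps)
  finally have 2: "convex hull {z + w * E d ?c, z - w * E d ?c, z - w * E d (?\<nu> - 1)} \<in> fst ` cells d \<kappa> (Tri d \<kappa> \<alpha> \<beta> \<gamma>)"
    unfolding Q(9) .
  have im: "(\<lambda>z. u * z + t) ` X \<in> fst ` P" if X: "X \<in> fst ` cells d \<kappa> (Tri d \<kappa> \<alpha> \<beta> \<gamma>)" for X
  proof -
    obtain T where T: "X = fst T" "T \<in> cells d \<kappa> (Tri d \<kappa> \<alpha> \<beta> \<gamma>)" using X by (rule imageE)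
    show ?thesis unfolding P T(1) fst_dmap[symmetric] by (intro imageI T(2))
  qed
  have uw: "cmod (u * w) = 2 * sin (pi / real d)" using Q(1) u by (simp add: norm_mult)
  have e: "u * (z + w * E d ?\<nu>) + t = (u * z + t) + (u * w) * E d ?\<nu>"
    "u * (z - w * E d (?\<nu> - 1)) + t = (u * z + t) - (u * w) * E d (?\<nu> - 1)" by (simp_all add: algebra_simps)
  show ?thesis by (rule that[OF uw k im[OF 1, unfolded hull e(1)] im[OF 2, unfolded hull e(2)]])
qed

lemma rearranged_tiling:
  assumes X: "tiling dmap fst (F d) X" and w: "cmod w = 2 * sin (pi / real d)" and k: "\<not> int q dvd \<nu> - c" "\<not> int q dvd \<nu> - c - 1"
    and t: "convex hull {z + w * E d c, z - w * E d c, z + w * E d \<nu>} \<in> fst ` X" (is "?t1 \<in> _")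
      "convex hull {z + w * E d c, z - w * E d c, z - w * E d (\<nu> - 1)} \<in> fst ` X" (is "?t2 \<in> _")
  shows "\<exists>Y. tiling image id (Fbar d) Y \<and> rearrangement d (fst ` X) Y"
proof -
  have d2: "d > 2" using dq q2 by simp
  let ?u1 = "convex hull {z + w * E d \<nu>, z - w * E d (\<nu> - 1), z + w * E d c}"
  let ?u2 = "convex hull {z + w * E d \<nu>, z - w * E d (\<nu> - 1), z - w * E d c}"
  note fq = flip_quad[OF dq q2 w k refl refl refl refl, of z]
  define Y where "Y = (fst ` X - {?t1, ?t2}) \<union> {?u1, ?u2}"
  have Xc: "\<exists>f T. isometry f \<and> T \<in> F d \<and> U = dmap f T" if "U \<in> X" for U
    using X that unfolding tiling_def copies_def by blast
  have copy: "U \<in> copies image (Fbar d)" and closed: "closed U" if U: "U \<in> fst ` X" for U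
  proof -
    obtain V where V: "V \<in> X" "U = fst V" using U by blast
    obtain f T where f: "isometry f" "T \<in> F d" "V = dmap f T" using Xc[OF V(1)] by blast
    show "U \<in> copies image (Fbar d)" unfolding copies_def Fbar_def V(2) f(3) fst_dmap using f(1,2) by blast
    show "closed U" unfolding V(2) f(3) fst_dmap using F_copy_supp(1)[OF d2 f(2,1)] by (rule compact_imp_closed)
  qed
  have no: "nonoverlapping id (fst ` X)" unfolding nonoverlapping_def id_apply
  proof (intro ballI impI, elim imageE)
    fix V W T U assume "V \<noteq> W" "V = fst T" "T \<in> X" "W = fst U" "U \<in> X"
    then show "interior V \<inter> interior W = {}" using X unfolding tiling_def nonoverlapping_def by metis
  qed
  have rp: "nonoverlapping id ((fst ` X - (\<Union>i\<in>{()}. {?t1, ?t2})) \<union> (\<Union>i\<in>{()}. {?u1, ?u2}))"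
     "\<Union>((fst ` X - (\<Union>i\<in>{()}. {?t1, ?t2})) \<union> (\<Union>i\<in>{()}. {?u1, ?u2})) = \<Union>(fst ` X)"
    by (rule replace_patches[OF no closed]; use t fq(2,3) in simp)+
  have "tiling image id (Fbar d) Y" unfolding tiling_def
  proof (intro conjI)
    show "countable Y" unfolding Y_def using X by (simp add: tiling_def)
    show "Y \<subseteq> copies image (Fbar d)" unfolding Y_def using copy fq(4) by blast
    show "nonoverlapping id Y" using rp(1) by (simp add: Y_def)
    have "\<Union>Y = \<Union>(fst ` X)" using rp(2) by (simp add: Y_def)
    then show "(\<Union>T\<in>Y. id T) = UNIV" using X by (simp add: tiling_def)
  qed
  moreover have "rearrangement d (fst ` X) Y" unfolding rearrangement_def
    by (rule exI[of _ "{({?t1, ?t2}, {?u1, ?u2})}"]) (use t fq(1) in \<open>simp add: Y_def\<close>)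
  ultimately show ?thesis by blast
qed

lemma R_r_nonempty:
  assumes p: "2 \<le> p" "p \<le> q" and \<epsilon>: "\<epsilon> = 1 \<or> \<epsilon> = - 1"
  shows "R_r d p \<epsilon> \<noteq> {}"
proof -
  have d2: "d > 2" using dq q2 by simp
  have p': "0 < p" "p < d" using p dq q2 by simp_all
  have l: "iota d p > 1" by (rule iota_gt_1[OF dq q2 p])
  let ?M = "lev d (int p) \<epsilon>"
  \<comment> \<open>Sign \<epsilon> makes the level equal to \<open>p\<close> for both rules. The
    angle 2 leaves room for the offsets 0 and 1, and the last angle exceeds the offset
    \<open>p - 2\<close> because \<open>q > 2\<close>.\<close>
  define vs where "vs = (2 :: int, int q - int p + 2, int q + int p - 4, \<epsilon>)"
  have vs: "is_type d vs" using p q2 \<epsilon> by (simp add: is_type_def vs_def dq)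
  have lev: "lev d ?M \<epsilon> = int p" by (simp add: lev_def)
  let ?tiles = "{V. \<exists>v. is_type d v \<and> has_type d v V}"
  let ?grp = "{f. \<exists>u t. cmod u = 1 \<and> f = (\<lambda>z. u * z + t)}"
  \<comment> \<open>For a tile of type \<open>vs\<close> the chosen patch also records the frame
    from which it is cut; this is what later locates the quadrilateral in
    \<open>D T\<close>.\<close>
  define good where "good V P \<longleftrightarrow> P \<in> Phi d p \<epsilon> V \<and> finite P \<and> nonoverlapping fst P \<and>
     \<Union>(fst ` P) = (\<lambda>x. iota d p *\<^sub>R x) ` fst V \<and> typed_patch d ?M V P \<and>
     (has_type d vs V \<longrightarrow> (\<exists>\<kappa> \<alpha> \<beta> \<gamma> u t. framed d p (int p) 2 (int q - int p + 2) V \<kappa> \<alpha> \<beta> \<gamma> u t \<and>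
        P = dmap (\<lambda>z. u * z + t) ` cells d \<kappa> (Tri d \<kappa> \<alpha> \<beta> \<gamma>)))" for V P
  have "\<exists>P. good V P" if V: "V \<in> ?tiles" for V
  proof (cases "has_type d vs V")
    case True
    obtain P \<kappa> \<alpha> \<beta> \<gamma> u t where P: "P \<in> Phi d p \<epsilon> V" "finite P" "nonoverlapping fst P" "\<Union>(fst ` P) = (\<lambda>x. iota d p *\<^sub>R x) ` fst V"
      "typed_patch d ?M V P" "framed d p (lev d ?M \<epsilon>) 2 (int q - int p + 2) V \<kappa> \<alpha> \<beta> \<gamma> u t"
      "P = dmap (\<lambda>z. u * z + t) ` cells d \<kappa> (Tri d \<kappa> \<alpha> \<beta> \<gamma>)"
      by (rule Phi_typed_patch[OF d2 vs[unfolded vs_def] True[unfolded vs_def] p' \<epsilon>])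
    have "good V P" unfolding good_def using P(1-5) P(6)[unfolded lev] P(7) by blast
    then show ?thesis ..
  next
    case False
    obtain a b c \<sigma> where v: "is_type d (a, b, c, \<sigma>)" "has_type d (a, b, c, \<sigma>) V" using V by auto
    obtain P where "P \<in> Phi d p \<epsilon> V" "finite P" "nonoverlapping fst P" "\<Union>(fst ` P) = (\<lambda>x. iota d p *\<^sub>R x) ` fst V"
      "typed_patch d ?M V P" by (rule Phi_typed_patch[OF d2 v p' \<epsilon>])
    then have "good V P" unfolding good_def using False by blast
    then show ?thesis ..
  qed
  then obtain D where D: "good V (D V)" if "V \<in> ?tiles" for V using someI_ex[of "good _"] by metis
  note D' = D[unfolded good_def]
  have child_type: "\<exists>v'. next_type d ?M v v' \<and> has_type d v' W" if "is_type d v" "has_type d v V" "W \<in> D V" for v V W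
    using D'[of V] that unfolding typed_patch_def by blast
  have type_child: "\<exists>W\<in>D V. has_type d v' W" if "is_type d v" "has_type d v V" "next_type d ?M v v'" for v V v'
    using D'[of V] that unfolding typed_patch_def by blast
  have protos: "\<exists>f\<in>?grp. \<exists>U\<in>F d. V = dmap f U" if V: "V \<in> ?tiles" for V
  proof -
    obtain a b c \<sigma> where v: "is_type d (a, b, c, \<sigma>)" "has_type d (a, b, c, \<sigma>) V" using V by auto
    obtain \<kappa> x u t where k: "\<kappa> \<in> K d" "elementary d \<kappa> \<sigma> x (x + a) (x + a + b)" "cmod u = 1"
      "V = dmap (\<lambda>z. u * z + t) (decorated d \<sigma> (ang d \<kappa> x) (ang d \<kappa> (x + a)) (ang d \<kappa> (x + a + b)))"
      by (rule typ_copy_F[OF d2 v])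
    show ?thesis by (intro bexI[OF _ decorated_in_F[OF d2 k(1,2)]] bexI[of _ "\<lambda>z. u * z + t"]) (use k(3,4) in auto)
  qed
  have iso: "isometry f" if "f \<in> ?grp" for f using that isometry_direct by blast
  have supp: "compact (fst V)" "interior (fst V) \<noteq> {}" "x \<in> fst V \<Longrightarrow> y \<in> fst V \<Longrightarrow> dist x y \<le> 4" if "V \<in> ?tiles" for V x y
  proof -
    obtain f U where f: "f \<in> ?grp" "U \<in> F d" and V: "V = dmap f U" using protos[OF \<open>V \<in> ?tiles\<close>] by blast
    note s = F_copy_supp[OF d2 f(2) iso[OF f(1)]]
    show "compact (fst V)" "interior (fst V) \<noteq> {}" "x \<in> fst V \<Longrightarrow> y \<in> fst V \<Longrightarrow> dist x y \<le> 4"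
      unfolding V fst_dmap by (rule s; assumption)+
  qed
  interpret substitution dmap fst "F d" "Phi d p \<epsilon>" "iota d p" ?tiles ?grp D 4
  proof unfold_locales
    show "dmap (f \<circ> g) T = dmap f (dmap g T)" for f g T by (rule dmap_comp)
    show "dmap id T = T" for T by (rule dmap_id)
    show "fst (dmap f T) = f ` fst T" for f T by (rule fst_dmap)
    show "isometry f" if "f \<in> ?grp" for f by (rule iso[OF that])
    show "f \<circ> g \<in> ?grp" if fg: "f \<in> ?grp" "g \<in> ?grp" for f g
    proof -
      obtain u t u' t' where c: "cmod u = 1" "cmod u' = 1" "f = (\<lambda>z. u * z + t)" "g = (\<lambda>z. u' * z + t')" using fg by blast
      have "f \<circ> g = (\<lambda>z. (u * u') * z + (u * t' + t))" unfolding c(3,4) by (simp add: fun_eq_iff algebra_simps)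
      moreover have "cmod (u * u') = 1" using c(1,2) by (simp add: norm_mult)
      ultimately show ?thesis by blast
    qed
    show "inv f \<in> ?grp" if f: "f \<in> ?grp" for f
    proof -
      obtain u t where u: "cmod u = 1" "f = (\<lambda>z. u * z + t)" using f by blast
      have "cmod (1 / u) = 1" using u(1) by (simp add: norm_divide)
      then show ?thesis unfolding u(2) direct_inv[OF u(1)] by blast
    qed
    show "scaled (iota d p) f \<in> ?grp" if f: "f \<in> ?grp" for f
    proof -
      obtain u t where u: "cmod u = 1" "f = (\<lambda>z. u * z + t)" using f by blast
      have "scaled (iota d p) f = (\<lambda>z. u * z + of_real (iota d p) * t)" unfolding u(2) by (rule scaled_direct) (use l in simp)
      then show ?thesis using u(1) by blast
    qed
    show "\<exists>f\<in>?grp. \<exists>U\<in>F d. T = dmap f U" if "T \<in> ?tiles" for T by (rule protos[OF that])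
    show "dmap f T \<in> ?tiles" if "f \<in> ?grp" "T \<in> ?tiles" for f T using that typ_direct by blast
    show "dmap (scaled (iota d p) f) ` P \<in> Phi d p \<epsilon> (dmap f U)" if P: "P \<in> Phi d p \<epsilon> U" and f: "f \<in> ?grp" for P U f
      unfolding Phi_def by (rule extend_rule_act[OF dmap_comp _ iso[OF f] P[unfolded Phi_def]]) (use l in simp)
    show "D U \<in> Phi d p \<epsilon> U" "finite (D U)" "nonoverlapping fst (D U)" "\<Union>(fst ` D U) = (\<lambda>x. iota d p *\<^sub>R x) ` fst U"
      if "U \<in> ?tiles" for U using D'[OF that] by simp_all
    show "D U \<subseteq> ?tiles" if U: "U \<in> ?tiles" for U
    proof
      fix W assume W: "W \<in> D U"
      obtain v where v: "is_type d v" "has_type d v U" using U by blast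
      show "W \<in> ?tiles" using child_type[OF v W] next_type_is_type[OF v(1)] by blast
    qed
    show "iota d p > 1" by (rule l)
    show "compact (fst T)" "interior (fst T) \<noteq> {}" if "T \<in> ?tiles" for T by (rule supp[OF that])+
    show "dist x y \<le> 4" if "T \<in> ?tiles" "x \<in> fst T" "y \<in> fst T" for T x y by (rule supp(3)[OF that])
  qed
  have sub_Suc: "(sub ^^ Suc k) A = \<Union>(D ` (sub ^^ k) A)" for k A
    unfolding funpow.simps o_apply by (rule sub_def)
  have fwd: "\<exists>v'. (next_type d ?M)\<^sup>*\<^sup>* v v' \<and> has_type d v' W" if v: "is_type d v" "has_type d v V" and W: "W \<in> (sub ^^ n) {V}" for v V n W
    using W
  proof (induction n arbitrary: W)
    case 0
    then show ?case using v(2) by (intro exI[of _ v]) simp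
  next
    case (Suc n)
    then obtain U where U: "U \<in> (sub ^^ n) {V}" "W \<in> D U" unfolding sub_Suc by blast
    obtain v1 where v1: "(next_type d ?M)\<^sup>*\<^sup>* v v1" "has_type d v1 U" using Suc.IH[OF U(1)] by blast
    have "is_type d v1" using reachable_return[OF v1(1) v(1)] by blast
    then obtain v' where "next_type d ?M v1 v'" "has_type d v' W" using child_type[OF _ v1(2) U(2)] by blast
    then show ?case using rtranclp.rtrancl_into_rtrancl[OF v1(1)] by blast
  qed
  have bwd: "\<exists>k W. W \<in> (sub ^^ k) {V} \<and> has_type d v' W" if r: "(next_type d ?M)\<^sup>*\<^sup>* v v'" and v: "is_type d v" "has_type d v V" for v v' V
    using r
  proof (induction rule: rtranclp_induct)
    case base
    show ?case by (intro exI[of _ 0] exI[of _ V]) (simp add: v(2))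
  next
    case (step y z)
    then obtain k U where U: "U \<in> (sub ^^ k) {V}" "has_type d y U" by blast
    have y: "is_type d y" using reachable_return[OF step(1) v(1)] ..
    obtain W where W: "W \<in> D U" "has_type d z W" using type_child[OF y U(2) step(2)] by (rule bexE)
    have "W \<in> (sub ^^ Suc k) {V}" unfolding sub_Suc using U(1) W(1) by blast
    then show ?case using W(2) by blast
  qed
  define T where "T = DT d 0 (of_real (2 * sin (pi / real d))) \<epsilon> (E d ` {0, 2, 2 + (int q - int p + 2)})"
  have Tt: "has_type d vs T"
  proof -
    have "cmod (of_real (2 * sin (pi / real d))) = 2 * sin (pi / real d)" using s1_pos[OF d2] by (simp add: norm_mult)
    then show ?thesis unfolding has_type_def vs_def T_def prod.case by blast
  qed
  have T: "T \<in> ?tiles" using vs Tt by blast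
  obtain n V where V: "n > 0" "V \<in> (sub ^^ n) {T}" "fst V \<subseteq> interior ((\<lambda>x. iota d p ^ n *\<^sub>R x) ` fst T)"
    by (rule interior_tile[OF T])
  obtain v where v: "(next_type d ?M)\<^sup>*\<^sup>* vs v" "has_type d v V" using fwd[OF vs Tt V(2)] by blast
  have v': "(next_type d ?M)\<^sup>*\<^sup>* v vs" "is_type d v" using reachable_return[OF v(1) vs] by simp_all
  \<comment> \<open>The tile \<open>V\<close> in the interior can be of any type; the walk back to
    \<open>vs\<close> finds a tile of the right type inside a patch of \<open>V\<close>, which stays
    in the interior.\<close>
  obtain k W where W: "W \<in> (sub ^^ k) {V}" "has_type d vs W" using bwd[OF v'(1,2) v(2)] by blast
  obtain u t where g: "cmod u = 1" "W = dmap (\<lambda>z. u * z + t) T" by (rule typ_unique_direct[OF Tt W(2) d2])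
  have Wn: "W \<in> (sub ^^ (k + n)) {T}" by (rule sub_pow_trans[OF V(2) W(1)])
  have Wi: "fst W \<subseteq> interior ((\<lambda>x. iota d p ^ (k + n) *\<^sub>R x) ` fst T)" by (rule interior_trans[OF T V(2) W(1) V(3)])
  have grp: "(\<lambda>z. u * z + t) \<in> ?grp" using g(1) by blast
  have kn: "k + n > 0" using V(1) by simp
  obtain X where X: "T \<in> X" "X \<subseteq> ?tiles" "sub X \<in> substitution_tilings dmap fst (F d) (Phi d p \<epsilon>)"
    by (rule recurrent_tiling[OF T kn grp Wn[unfolded g(2)] Wi[unfolded g(2)]])
  have DT: "D T \<subseteq> sub X" using X(1) unfolding sub_def by blast
  obtain \<kappa> \<alpha> \<beta> \<gamma> u' t' where f: "framed d p (int p) 2 (int q - int p + 2) T \<kappa> \<alpha> \<beta> \<gamma> u' t'"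
    "D T = dmap (\<lambda>z. u' * z + t') ` cells d \<kappa> (Tri d \<kappa> \<alpha> \<beta> \<gamma>)"
    using D'[OF T, THEN conjunct2, THEN conjunct2, THEN conjunct2, THEN conjunct2, THEN conjunct2, THEN mp, OF Tt]
    by (elim exE conjE) (rule that)
  obtain z w \<nu> c where Q: "cmod w = 2 * sin (pi / real d)" "\<not> int q dvd \<nu> - c" "\<not> int q dvd \<nu> - c - 1"
    "convex hull {z + w * E d c, z - w * E d c, z + w * E d \<nu>} \<in> fst ` D T"
    "convex hull {z + w * E d c, z - w * E d c, z - w * E d (\<nu> - 1)} \<in> fst ` D T"
    by (rule framed_quad[OF f(1) p f(2)])
  have tX: "tiling dmap fst (F d) (sub X)" using X(3) unfolding substitution_tilings_def by blast
  obtain Y where Y: "tiling image id (Fbar d) Y" "rearrangement d (fst ` sub X) Y"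
    using rearranged_tiling[OF tX Q(1-3) subsetD[OF image_mono[OF DT] Q(4)] subsetD[OF image_mono[OF DT] Q(5)]] by blast
  have "(rearrangement d)\<^sup>+\<^sup>+ (fst ` sub X) Y" using Y(2) by (rule tranclp.r_into_trancl)
  then have "Y \<in> R_r d p \<epsilon>" unfolding R_r_def S_def using X(3) Y(1) by blast
  then show ?thesis by blast
qed

end

theorem theorem4p4:
  fixes d q :: nat
  assumes "d = 2 * q" and "q > 2"
  shows "(\<forall>p\<in>{2..q}. \<forall>\<epsilon>\<in>{1, -1}. R_r d p \<epsilon> \<noteq> {}) \<and>
         R_s d \<noteq> {} \<and>
         inflation_factor (Fbar d) (Phi_R d) (iota d q) \<and>
         iota d q = sin (real q * pi / real d) / sin (pi / real d)"
  using R_r_nonempty[OF assms] R_s_nonempty[OF assms] inflation_factor_Phi_R[OF assms]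
  by (simp add: iota_def s_def)

end
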